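(* Assume that $\tau$ is in the limit circle case at $a$ and $b$, and let $\{v_j(i,\cdot)\}_{j=1,2}$ be the orthonormal basis of $\mathcal N_i$ obtained from $\{u_j(i,\cdot)\}_{j=1,2}$ by the Gram–Schmidt process (given explicitly in the context). Put $\kappa=\operatorname{Im}(\widetilde u_2^{\,\prime}(i,b))/\operatorname{Im}(\widetilde u_1^{\,\prime}(i,b))$ and $$W_{1,1}^{Kr}(z)=c_1(i)\big[\widetilde u_1^{\,\prime}(z,b)-\widetilde u_1^{\,\prime}(-i,b)\big],\qquad W_{1,2}^{Kr}(z)=c_1(i)\big[\widetilde u_2^{\,\prime}(z,b)+\widetilde u_1^{\,\prime}(-i,a)\big],$$ $$W_{2,1}^{Kr}(z)=-c_2(i)\Big\{\kappa\big[\widetilde u_1^{\,\prime}(z,b)-\widetilde u_1^{\,\prime}(-i,b)\big]+\widetilde u_2^{\,\prime}(-i,b)+\widetilde u_1^{\,\prime}(z,a)\Big\},$$ $$W_{2,2}^{Kr}(z)=-c_2(i)\Big\{\kappa\big[\widetilde u_2^{\,\prime}(z,b)+\widetilde u_1^{\,\prime}(-i,a)\big]+\widetilde u_2^{\,\prime}(z,a)-\widetilde u_2^{\,\prime}(-i,a)\Big\}.$$ Then the following hold. (i) If $\alpha\in(0,\pi)$, then the Donoghue $m$-function $M_{T_{\alpha,0},\mathcal N_i}^{Do}(\cdot):\mathbb C\setminus\mathbb R\to\mathcal B(\mathcal N_i)$ for $T_{\alpha,0}$ satisfies $M_{T_{\alpha,0},\mathcal N_i}^{Do}(\pm i)=\pm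 i\,I_{\mathcal N_i}$ and, for $z\in\mathbb C\setminus\mathbb R$, $z\neq\pm i$, $$M_{T_{\alpha,0},\mathcal N_i}^{Do}(z)=M_{T_{0,0},\mathcal N_i}^{Do}(z)+\frac{z-i}{\cot(\alpha)+\widetilde u_2^{\,\prime}(z,a)}(u_2(\overline z,\cdot),\cdot)_{L^2_r((a,b))}\sum_{\ell=1}^2W_{\ell,2}^{Kr}(z)v_\ell(i,\cdot)\Big|_{\mathcal N_i}.$$ (ii) If $\beta\in(0,\pi)$, then the Donoghue $m$-function $M_{T_{0,\beta},\mathcal N_i}^{Do}(\cdot):\mathbb C\setminus\mathbb R\to\mathcal B(\mathcal N_i)$ for $T_{0,\beta}$ satisfies $M_{T_{0,\beta},\mathcal N_i}^{Do}(\pm i)=\pm i\,I_{\mathcal N_i}$ and, for $z\in\mathbb C\setminus\mathbb R$, $z\neq\pm i$, $$M_{T_{0,\beta},\mathcal N_i}^{Do}(z)=M_{T_{0,0},\mathcal N_i}^{Do}(z)-\frac{z-i}{\cot(\beta)+\widetilde u_1^{\,\prime}(z,b)}(u_1(\overline z,\cdot),\cdot)_{L^2_r((a,b))}\sum_{\ell=1}^2W_{\ell,1}^{Kr}(z)v_\ell(i,\cdot)\Big|_{\mathcal N_i}.$$ (iii) If $\varphi\in[0,2\pi)$ and $R\in SL(2,\mathbb R)$ with $R_{1,2}=0$, then the Donoghue $m$-function $M_{T_{\varphi,R},\mathcal N_i}^{Do}(\cdot):\mathbb C\setminus\mathbb R\to\mathcal B(\mathcal N_i)$ for $T_{\varphi,R}$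 satisfies $M_{T_{\varphi,R},\mathcal N_i}^{Do}(\pm i)=\pm i\,I_{\mathcal N_i}$ and, for $z\in\mathbb C\setminus\mathbb R$, $z\neq\pm i$, $$M_{T_{\varphi,R},\mathcal N_i}^{Do}(z)=M_{T_{0,0},\mathcal N_i}^{Do}(z)-\frac{z-i}{k_{\varphi,R}(z)}(u_{\varphi,R}(\overline z,\cdot),\cdot)_{L^2_r((a,b))}\sum_{\ell=1}^2\big[e^{-i\varphi}R_{2,2}W_{\ell,2}^{Kr}(z)+W_{\ell,1}^{Kr}(z)\big]v_\ell(i,\cdot)\Big|_{\mathcal N_i},$$ where $u_{\varphi,R}(\zeta,\cdot)=e^{-i\varphi}R_{2,2}u_2(\zeta,\cdot)+u_1(\zeta,\cdot)$ for $\zeta\in\rho(T_{0,0})$ and $k_{\varphi,R}(z)=-R_{2,1}R_{2,2}-e^{i\varphi}R_{2,2}\widetilde u_{\varphi,R}^{\,\prime}(z,a)+\widetilde u_{\varphi,R}^{\,\prime}(z,b)$.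
   Context: Let $(a,b)\subseteq\mathbb R$ (possibly unbounded) and let $p,q,r$ be Lebesgue measurable functions on $(a,b)$ with $r>0$ a.e., $r\in L^1_{loc}((a,b))$; $p>0$ a.e., $1/p\in L^1_{loc}((a,b))$; $q$ real-valued a.e., $q\in L^1_{loc}((a,b))$. Put $\tau f=\frac1r\big[-(pf')'+qf\big]$, $f^{[1]}=pf'$, and $W(f,g)(x)=f(x)g^{[1]}(x)-f^{[1]}(x)g(x)$. Let $L^2_r((a,b))=L^2((a,b);r\,dx)$ with inner product $(\cdot,\cdot)_{L^2_r((a,b))}$ linear in the second argument. The maximal operator is $T_{max}f=\tau f$ with $\mathrm{dom}(T_{max})=\{g\in L^2_r((a,b)) : g,g^{[1]}\in AC_{loc}((a,b)),\ \tau g\in L^2_r((a,b))\}$. The minimal operator $T_{min}$ is the closure of the restriction of $T_{max}$ to those $g\in\mathrm{dom}(T_{max})$ with compact support in $(a,b)$. For $f,g\in\mathrm{dom}(T_{max})$ the limits $W(f,g)(a)=\lim_{x\downarrow a}W(f,g)(x)$ and $W(f,g)(b)=\lim_{x\uparrow b}W(f,g)(x)$ exist. $\tau$ is in the limit circle case at an endpoint if for every $z\in\mathbb C$ all solutions of $\tau u=zu$ are in $L^2_r$ near that endpoint. Put $\mathcal N_z=\ker(T_{max}-zI)$; in the present situation $\dim\mathcal N_{\pm i}=2$. Generalized boundary values: fix real-valued $v_1,v_2\in\mathrm{dom}(T_{max})$ with $W(v_1,v_2)(a)=W(v_1,v_2)(b)=1$ and, for $g\in\mathrm{dom}(T_{max})$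 and $d\in\{a,b\}$, set $\widetilde g(d)=-W(v_2,g)(d)$ and $\widetilde g^{\,\prime}(d)=W(v_1,g)(d)$. (If $T_{min}$ is bounded from below one takes $v_1,v_2$ equal near each endpoint $d$ to a nonprincipal solution $\widehat u_d(\lambda_0,\cdot)$ and a principal solution $u_d(\lambda_0,\cdot)$ of $\tau u=\lambda_0u$ with $W(\widehat u_d,u_d)=1$, $\lambda_0\in\mathbb R$. These functions $v_1,v_2$ are unrelated to the basis functions $v_j(i,\cdot)$ below.) Self-adjoint extensions of $T_{min}$ (all are restrictions of $T_{max}$): for $\alpha,\beta\in[0,\pi)$, $\mathrm{dom}(T_{\alpha,\beta})$ consists of all $g\in\mathrm{dom}(T_{max})$ with $\cos(\alpha)\widetilde g(a)+\sin(\alpha)\widetilde g^{\,\prime}(a)=0$ and $\cos(\beta)\widetilde g(b)+\sin(\beta)\widetilde g^{\,\prime}(b)=0$; for $\varphi\in[0,2\pi)$ and $R=(R_{j,k})_{j,k=1}^2\in SL(2,\mathbb R)$, $\mathrm{dom}(T_{\varphi,R})$ consists of all $g\in\mathrm{dom}(T_{max})$ with $(\widetilde g(b),\widetilde g^{\,\prime}(b))^\top=e^{i\varphi}R\,(\widetilde g(a),\widetilde g^{\,\prime}(a))^\top$. In particular $\mathrm{dom}(T_{0,0})=\{g\in\mathrm{dom}(T_{max}):\widetilde g(a)=\widetilde g(b)=0\}$. For $z\in\rho(T_{0,0})$, $u_1(z,\cdot),u_2(z,\cdot)$ are the solutions of $\tau u=zu$ with $\widetilde u_1(z,a)=0$,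 $\widetilde u_1(z,b)=1$, $\widetilde u_2(z,a)=1$, $\widetilde u_2(z,b)=0$; $\widetilde u_j^{\,\prime}(z,d)$ denotes the second generalized boundary value of $u_j(z,\cdot)$ at $d\in\{a,b\}$ (and similarly for $u_{\varphi,R}$). The orthonormal basis of $\mathcal N_i$ is $$v_1(i,\cdot)=c_1(i)u_1(i,\cdot),\qquad v_2(i,\cdot)=c_2(i)\Big[u_2(i,\cdot)-\frac{\operatorname{Im}(\widetilde u_2^{\,\prime}(i,b))}{\operatorname{Im}(\widetilde u_1^{\,\prime}(i,b))}u_1(i,\cdot)\Big],$$ $$c_1(i)=\|u_1(i,\cdot)\|_{L^2_r((a,b))}^{-1}=\big[-\operatorname{Im}(\widetilde u_1^{\,\prime}(i,b))\big]^{-1/2},$$ $$c_2(i)=\Big\|u_2(i,\cdot)-\frac{\operatorname{Im}(\widetilde u_2^{\,\prime}(i,b))}{\operatorname{Im}(\widetilde u_1^{\,\prime}(i,b))}u_1(i,\cdot)\Big\|_{L^2_r((a,b))}^{-1}=\Big[\operatorname{Im}(\widetilde u_2^{\,\prime}(i,a))+\frac{[\operatorname{Im}(\widetilde u_2^{\,\prime}(i,b))]^2}{\operatorname{Im}(\widetilde u_1^{\,\prime}(i,b))}\Big]^{-1/2}.$$ For a self-adjoint extension $T$ of $T_{min}$, the Donoghue $m$-function is $M_{T,\mathcal N_i}^{Do}(z)=zI_{\mathcal N_i}+(z^2+1)P_{\mathcal N_i}(T-zI)^{-1}P_{\mathcal N_i}\big|_{\mathcal N_i}$, $z\in\mathbb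 C\setminus\mathbb R$, where $P_{\mathcal N_i}$ is the orthogonal projection onto $\mathcal N_i$ and $I_{\mathcal N_i}$ the identity on $\mathcal N_i$. The symbol $(f,\cdot)_{L^2_r((a,b))}\,h$ denotes the rank-one operator $g\mapsto(f,g)_{L^2_r((a,b))}h$. *)

theory Defs
  imports "HOL-Analysis.Analysis"
begin

record sl_data =
  lo :: ereal
  hi :: ereal
  coef_p :: "real \<Rightarrow> real"
  coef_q :: "real \<Rightarrow> real"
  coef_r :: "real \<Rightarrow> real"

definition dom_int :: "sl_data \<Rightarrow> real set" where
  "dom_int S = einterval (lo S) (hi S)"

definition L1_loc :: "real set \<Rightarrow> (real \<Rightarrow> real) \<Rightarrow> bool" where
  "L1_loc I f \<longleftrightarrow> (\<forall>K. compact K \<and> K \<subseteq> I \<longrightarrow> f absolutely_integrable_on K)"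

definition sturm_liouville :: "sl_data \<Rightarrow> bool" where
  "sturm_liouville S \<longleftrightarrow>
     lo S < hi S \<and>
     coef_p S \<in> borel_measurable (lebesgue_on (dom_int S)) \<and>
     coef_q S \<in> borel_measurable (lebesgue_on (dom_int S)) \<and>
     coef_r S \<in> borel_measurable (lebesgue_on (dom_int S)) \<and>
     (AE x in lebesgue_on (dom_int S). coef_r S x > 0) \<and> L1_loc (dom_int S) (coef_r S) \<and>
     (AE x in lebesgue_on (dom_int S). coef_p S x > 0) \<and> L1_loc (dom_int S) (\<lambda>x. 1 / coef_p S x) \<and>
     L1_loc (dom_int S) (coef_q S)"

definition abs_cont_on :: "real \<Rightarrow> real \<Rightarrow> (real \<Rightarrow> complex) \<Rightarrow> bool" where
  "abs_cont_on c d f \<longleftrightarrow>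
     (\<forall>\<epsilon>>0. \<exists>\<delta>>0. \<forall>(n::nat) s t.
        (\<forall>k<n. c \<le> s k \<and> s k \<le> t k \<and> t k \<le> d) \<and>
        disjoint_family_on (\<lambda>k. {s k<..<t k}) {..<n} \<and>
        (\<Sum>k<n. t k - s k) < \<delta>
        \<longrightarrow> (\<Sum>k<n. cmod (f (t k) - f (s k))) < \<epsilon>)"

definition AC_loc :: "real set \<Rightarrow> (real \<Rightarrow> complex) \<Rightarrow> bool" where
  "AC_loc I f \<longleftrightarrow> (\<forall>c d. {c..d} \<subseteq> I \<longrightarrow> abs_cont_on c d f)"

text \<open>The product \<open>p f'\<close> is only defined almost everywhere; \<open>f\<^sup>[\<^sup>1\<^sup>] \<in> AC\<^sub>l\<^sub>o\<^sub>c\<close> means that it has a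
  locally absolutely continuous representative. That representative is unique on the interval, and
  it is the one whose point values enter the Wronskian.\<close>

definition is_quasi_deriv :: "sl_data \<Rightarrow> (real \<Rightarrow> complex) \<Rightarrow> (real \<Rightarrow> complex) \<Rightarrow> bool" where
  "is_quasi_deriv S f h \<longleftrightarrow>
     AC_loc (dom_int S) h \<and>
     (AE x in lebesgue_on (dom_int S). h x = of_real (coef_p S x) * vector_derivative f (at x))"

definition quasi_deriv :: "sl_data \<Rightarrow> (real \<Rightarrow> complex) \<Rightarrow> real \<Rightarrow> complex" where
  "quasi_deriv S f = (SOME h. is_quasi_deriv S f h)"

definition sl_tau :: "sl_data \<Rightarrow> (real \<Rightarrow> complex) \<Rightarrow> real \<Rightarrow> complex" where
  "sl_tau S f x =
     (1 / of_real (coef_r S x)) *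
       (- vector_derivative (quasi_deriv S f) (at x) + of_real (coef_q S x) * f x)"

text \<open>Functions on the interval \<open>(a,b)\<close> to which \<open>\<tau>\<close> applies are represented by functions on the
  real line that vanish outside \<open>(a,b)\<close>. With this convention two such functions that agree almost
  everywhere on \<open>(a,b)\<close> are equal, so that equality in \<open>L\<^sup>2\<close> is equality of functions.\<close>

definition sl_regular :: "sl_data \<Rightarrow> (real \<Rightarrow> complex) \<Rightarrow> bool" where
  "sl_regular S f \<longleftrightarrow>
     (\<forall>x. x \<notin> dom_int S \<longrightarrow> f x = 0) \<and> AC_loc (dom_int S) f \<and> (\<exists>h. is_quasi_deriv S f h)"

definition sl_solution :: "sl_data \<Rightarrow> complex \<Rightarrow> (real \<Rightarrow> complex) \<Rightarrow> bool" where
  "sl_solution S z u \<longleftrightarrow>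
     sl_regular S u \<and> (AE x in lebesgue_on (dom_int S). sl_tau S u x = z * u x)"

definition r_measure :: "sl_data \<Rightarrow> real measure" where
  "r_measure S = density (lebesgue_on (dom_int S)) (\<lambda>x. ennreal (coef_r S x))"

text \<open>Elements of \<open>L\<^sup>2((a,b); r dx)\<close> are represented by functions; only their restriction to
  \<open>(a,b)\<close>, up to null sets, matters.\<close>

definition L2r :: "sl_data \<Rightarrow> (real \<Rightarrow> complex) set" where
  "L2r S = {f \<in> borel_measurable (r_measure S). integrable (r_measure S) (\<lambda>x. (cmod (f x))\<^sup>2)}"

definition L2r_inner :: "sl_data \<Rightarrow> (real \<Rightarrow> complex) \<Rightarrow> (real \<Rightarrow> complex) \<Rightarrow> complex" where
  "L2r_inner S f g = (LINT x|r_measure S. cnj (f x) * g x)"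

definition L2r_norm :: "sl_data \<Rightarrow> (real \<Rightarrow> complex) \<Rightarrow> real" where
  "L2r_norm S f = sqrt (LINT x|r_measure S. (cmod (f x))\<^sup>2)"

definition dom_max :: "sl_data \<Rightarrow> (real \<Rightarrow> complex) set" where
  "dom_max S = {g \<in> L2r S. sl_regular S g \<and> sl_tau S g \<in> L2r S}"

datatype endpoint = Left_End | Right_End

text \<open>The endpoints may be infinite; \<open>real_of_ereal\<close> transports the one-sided neighbourhoods of an
  extended real number to the real line.\<close>

fun end_filter :: "sl_data \<Rightarrow> endpoint \<Rightarrow> real filter" where
  "end_filter S Left_End = filtermap real_of_ereal (at_right (lo S))"
| "end_filter S Right_End = filtermap real_of_ereal (at_left (hi S))"

fun near_end :: "sl_data \<Rightarrow> endpoint \<Rightarrow> real \<Rightarrow> real set" where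
  "near_end S Left_End c = {x \<in> dom_int S. x < c}"
| "near_end S Right_End c = {x \<in> dom_int S. c < x}"

definition limit_circle :: "sl_data \<Rightarrow> endpoint \<Rightarrow> bool" where
  "limit_circle S d \<longleftrightarrow>
     (\<forall>z u. sl_solution S z u \<longrightarrow>
        (\<exists>c \<in> dom_int S. set_integrable (r_measure S) (near_end S d c) (\<lambda>x. (cmod (u x))\<^sup>2)))"

definition wronskian :: "sl_data \<Rightarrow> (real \<Rightarrow> complex) \<Rightarrow> (real \<Rightarrow> complex) \<Rightarrow> real \<Rightarrow> complex" where
  "wronskian S f g x = f x * quasi_deriv S g x - quasi_deriv S f x * g x"

definition wronskian_at ::
    "sl_data \<Rightarrow> (real \<Rightarrow> complex) \<Rightarrow> (real \<Rightarrow> complex) \<Rightarrow> endpoint \<Rightarrow> complex" where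
  "wronskian_at S f g d = Lim (end_filter S d) (wronskian S f g)"

text \<open>The generalized boundary values \<open>g\<close>-tilde and \<open>g\<close>-tilde-prime at an endpoint; \<open>v\<close> is the pair
  \<open>(v\<^sub>1, v\<^sub>2)\<close> of reference functions.\<close>

type_synonym ref_pair = "(real \<Rightarrow> complex) \<times> (real \<Rightarrow> complex)"

definition boundary_reference :: "sl_data \<Rightarrow> ref_pair \<Rightarrow> bool" where
  "boundary_reference S v \<longleftrightarrow>
     fst v \<in> dom_max S \<and> snd v \<in> dom_max S \<and>
     (\<forall>x. fst v x \<in> \<real>) \<and> (\<forall>x. snd v x \<in> \<real>) \<and>
     (\<forall>d. wronskian_at S (fst v) (snd v) d = 1)"

definition bval :: "sl_data \<Rightarrow> ref_pair \<Rightarrow> (real \<Rightarrow> complex) \<Rightarrow> endpoint \<Rightarrow> complex" where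
  "bval S v g d = - wronskian_at S (snd v) g d"

definition bval' :: "sl_data \<Rightarrow> ref_pair \<Rightarrow> (real \<Rightarrow> complex) \<Rightarrow> endpoint \<Rightarrow> complex" where
  "bval' S v g d = wronskian_at S (fst v) g d"

text \<open>All operators that occur are restrictions of the maximal operator \<open>T\<^sub>m\<^sub>a\<^sub>x f = \<tau> f\<close>, so an operator
  is given by its domain \<open>D \<subseteq> dom_max S\<close>.\<close>

definition dom_sep :: "sl_data \<Rightarrow> ref_pair \<Rightarrow> real \<Rightarrow> real \<Rightarrow> (real \<Rightarrow> complex) set" where
  "dom_sep S v \<alpha> \<beta> = {g \<in> dom_max S.
     of_real (cos \<alpha>) * bval S v g Left_End + of_real (sin \<alpha>) * bval' S v g Left_End = 0 \<and>
     of_real (cos \<beta>) * bval S v g Right_End + of_real (sin \<beta>) * bval' S v g Right_End = 0}"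

definition dom_coupled :: "sl_data \<Rightarrow> ref_pair \<Rightarrow> real \<Rightarrow> real^2^2 \<Rightarrow> (real \<Rightarrow> complex) set" where
  "dom_coupled S v \<phi> R = {g \<in> dom_max S.
     bval S v g Right_End =
       cis \<phi> * (of_real (R$1$1) * bval S v g Left_End + of_real (R$1$2) * bval' S v g Left_End) \<and>
     bval' S v g Right_End =
       cis \<phi> * (of_real (R$2$1) * bval S v g Left_End + of_real (R$2$2) * bval' S v g Left_End)}"

definition resolvent_set :: "sl_data \<Rightarrow> (real \<Rightarrow> complex) set \<Rightarrow> complex set" where
  "resolvent_set S D = {z.
     (\<forall>h \<in> L2r S. \<exists>!f. f \<in> D \<and> (AE x in lebesgue_on (dom_int S). sl_tau S f x - z * f x = h x)) \<and>
     (\<exists>C. \<forall>f \<in> D. L2r_norm S f \<le> C * L2r_norm S (\<lambda>x. sl_tau S f x - z * f x))}"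

definition resolvent ::
    "sl_data \<Rightarrow> (real \<Rightarrow> complex) set \<Rightarrow> complex \<Rightarrow> (real \<Rightarrow> complex) \<Rightarrow> real \<Rightarrow> complex" where
  "resolvent S D z h =
     (THE f. f \<in> D \<and> (AE x in lebesgue_on (dom_int S). sl_tau S f x - z * f x = h x))"

definition ker_max :: "sl_data \<Rightarrow> complex \<Rightarrow> (real \<Rightarrow> complex) set" where
  "ker_max S z = {f \<in> dom_max S. AE x in lebesgue_on (dom_int S). sl_tau S f x - z * f x = 0}"

definition orth_proj ::
    "sl_data \<Rightarrow> (real \<Rightarrow> complex) set \<Rightarrow> (real \<Rightarrow> complex) \<Rightarrow> real \<Rightarrow> complex" where
  "orth_proj S N h = (THE g. g \<in> N \<and> (\<forall>k \<in> N. L2r_inner S k (\<lambda>x. h x - g x) = 0))"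

definition bounded_op_on ::
    "sl_data \<Rightarrow> (real \<Rightarrow> complex) set \<Rightarrow> ((real \<Rightarrow> complex) \<Rightarrow> real \<Rightarrow> complex) \<Rightarrow> bool" where
  "bounded_op_on S N A \<longleftrightarrow>
     (\<forall>f \<in> N. A f \<in> N) \<and>
     (\<forall>f \<in> N. \<forall>g \<in> N. A (\<lambda>x. f x + g x) = (\<lambda>x. A f x + A g x)) \<and>
     (\<forall>c. \<forall>f \<in> N. A (\<lambda>x. c * f x) = (\<lambda>x. c * A f x)) \<and>
     (\<exists>C. \<forall>f \<in> N. L2r_norm S (A f) \<le> C * L2r_norm S f)"

definition donoghue ::
    "sl_data \<Rightarrow> (real \<Rightarrow> complex) set \<Rightarrow> complex \<Rightarrow> (real \<Rightarrow> complex) \<Rightarrow> real \<Rightarrow> complex" where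
  "donoghue S D z f = (\<lambda>x.
     z * f x + (z\<^sup>2 + 1) *
       orth_proj S (ker_max S \<i>) (resolvent S D z (orth_proj S (ker_max S \<i>) f)) x)"

end

theory Submission
  imports Defs
begin

text \<open>
  The \<open>m\<close>-function of an extension \<open>T\<close> sees \<open>T\<close> only through the resolvent, compressed to
  \<open>\<N>\<^sub>i = ker (T\<^sub>m\<^sub>a\<^sub>x - i)\<close>. For an extension \<open>T\<close> given by two boundary conditions, \<open>(T - z)\<^sup>-\<^sup>1 f\<close> and
  \<open>(T\<^sub>0\<^sub>,\<^sub>0 - z)\<^sup>-\<^sup>1 f\<close> solve the same inhomogeneous equation, so their difference solves \<open>\<tau>u = zu\<close>. For
  the extensions considered here one boundary condition leaves only a multiple \<open>k u\<close> of one fixed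
  solution \<open>u\<close>, and the other determines \<open>k\<close>: its denominator vanishes only if \<open>u\<close> is an
  eigenfunction of \<open>T\<close>, which is impossible for nonreal \<open>z\<close>. Green's formula turns the boundary values
  of \<open>(T\<^sub>0\<^sub>,\<^sub>0 - z)\<^sup>-\<^sup>1 f\<close> in the numerator into inner products of \<open>f\<close> with the solutions \<open>u\<^sub>j\<close> at the
  conjugate of \<open>z\<close> (\<open>resolvent_reference\<close>). This gives the Krein formulas \<open>resolvent_sep_left\<close>,
  \<open>resolvent_sep_right\<close> and \<open>resolvent_coupled\<close>. Projecting \<open>k u\<close> onto \<open>\<N>\<^sub>i\<close> requires the inner products of
  \<open>u\<^sub>j(z, \<cdot>)\<close> with the orthonormal basis; Green's formula expresses them by boundary values as
  well, and after multiplication by \<open>z\<^sup>2 + 1 = (z - i)(z + i)\<close> they are the functions \<open>W\<close>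
  (\<open>basis_coefficients\<close>).

  The existence of the resolvents is proved directly. An extension with symmetric boundary
  conditions satisfies \<open>\<bar>Im z\<bar> \<parallel>f\<parallel> \<le> \<parallel>(T - z) f\<parallel>\<close>, so for nonreal \<open>z\<close> the two boundary conditions are
  injective on the two-dimensional space of solutions of \<open>\<tau>u = zu\<close>, hence bijective, and any
  solution of the inhomogeneous equation can be corrected to satisfy them
  (\<open>resolvent_exists\<close>). The limit circle hypothesis enters here: it makes all
  solutions of the homogeneous equation square integrable, and then also those of the inhomogeneous
  one, because their coordinates with respect to a fundamental system are Wronskians, which remain
  bounded (\<open>inhomogeneous_solution_L2r\<close>).

  These arguments rest on calculus for absolutely continuous functions. By
  \<open>abs_cont_on_fundamental_theorem\<close> such a function is differentiable almost everywhere and is the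
  integral of its derivative. The proof combines Lebesgue's differentiation theorem, from Henstock's
  lemma and Vitali's covering theorem, with the Jordan decomposition of the function and the
  Radon-Nikodym theorem. With it the differential expression is rewritten as a first-order system in
  integral form (\<open>sl_sys\<close>), which is linear, admits Lagrange's identity (\<open>sl_sys_wronskian\<close>), and
  can be solved by iteration (\<open>volterra_system_exists\<close>).
\<close>

section \<open>Differentiation of indefinite integrals\<close>

text \<open>Lebesgue's differentiation theorem on the line. If the difference quotient of the integral stays
  off by \<open>e\<close> at every scale at the points of a set, the offending intervals form a Vitali
  covering of this set; Henstock's lemma bounds the total length of finitely many disjoint ones.\<close>

lemma has_vector_derivative_indefinite_integral_ae:
  fixes f :: "real \<Rightarrow> 'a::euclidean_space"
  assumes f: "f integrable_on {a..b}"
  shows "negligible {x \<in> {a<..<b}.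
           \<not> ((\<lambda>y. integral {a..y} f) has_vector_derivative f x) (at x)}"
proof -
  define F where "F = (\<lambda>y. integral {a..y} f)"
  define D where "D = (\<lambda>e. {x \<in> {a<..<b}. \<forall>\<delta>>0. \<exists>y \<in> {a<..<b}.
      \<bar>y - x\<bar> < \<delta> \<and> e * \<bar>y - x\<bar> < norm (F y - F x - (y - x) *\<^sub>R f x)})"
  have incr: "F v - F u = integral {u..v} f" if "a \<le> u" "u \<le> v" "v \<le> b" for u v
  proof -
    have "f integrable_on {a..v}"
      using f that by (auto intro: integrable_on_subinterval)
    from Henstock_Kurzweil_Integration.integral_combine[OF that(1,2) this] show ?thesis
      unfolding F_def by (simp add: algebra_simps)
  qed
  have negl: "negligible (D e)" if e: "0 < e" for e
  proof -
    have "\<exists>T. D e \<subseteq> T \<and> T \<in> lmeasurable \<and> measure lebesgue T \<le> \<epsilon>" if \<epsilon>: "0 < \<epsilon>" for \<epsilon>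
    proof -
      have "f integrable_on cbox a b" using f by simp
      from Henstock_lemma[OF this, of "\<epsilon> * e"] obtain \<gamma> where \<gamma>: "gauge \<gamma>"
        and hen: "\<And>p. \<lbrakk>p tagged_partial_division_of (cbox a b); \<gamma> fine p\<rbrakk> \<Longrightarrow>
             (\<Sum>(x,k)\<in>p. norm (measure lborel k *\<^sub>R f x - integral k f)) < \<epsilon> * e"
        using \<epsilon> e by auto
      \<comment> \<open>tagged intervals with the tag at one end, on which the quotient is off by \<open>e\<close>\<close>
      define K where "K = {(x, u, v). x \<in> {u, v} \<and> a < u \<and> u < v \<and> v < b \<and> {u..v} \<subseteq> \<gamma> x \<and>
          e * (v - u) < norm ((v - u) *\<^sub>R f x - integral {u..v} f)}"
      define m :: "real \<times> real \<times> real \<Rightarrow> real" where "m = (\<lambda>(x, u, v). (u + v) / 2)"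
      define r :: "real \<times> real \<times> real \<Rightarrow> real" where "r = (\<lambda>(x, u, v). (v - u) / 2)"
      have cb: "cball (m (x,u,v)) (r (x,u,v)) = {u..v}" for x u v
        by (auto simp: m_def r_def cball_eq_atLeastAtMost field_simps)
      have r0: "0 < r i" if "i \<in> K" for i
        using that by (auto simp: K_def r_def)
      have cov: "\<exists>i. i \<in> K \<and> x \<in> cball (m i) (r i) \<and> r i < d" if x: "x \<in> D e" and d: "0 < d" for x d
      proof -
        have "open (\<gamma> x)" "x \<in> \<gamma> x" using \<gamma> by (auto simp: gauge_def)
        then obtain \<delta> where \<delta>: "\<delta> > 0" "cball x \<delta> \<subseteq> \<gamma> x" by (meson open_contains_cball)
        obtain y where y: "y \<in> {a<..<b}" "\<bar>y - x\<bar> < min \<delta> d"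
            "e * \<bar>y - x\<bar> < norm (F y - F x - (y - x) *\<^sub>R f x)"
          using x \<delta> d unfolding D_def by (auto dest!: spec[of _ "min \<delta> d"])
        have "y \<noteq> x" using y(3) by auto
        then consider "x < y" | "y < x" by linarith
        then show ?thesis
        proof cases
          case 1
          have "(x, x, y) \<in> K"
            using x y 1 \<delta> incr[of x y]
            by (auto simp: K_def D_def norm_minus_commute subset_iff dist_real_def)
          then show ?thesis using y 1 by (intro exI[of _ "(x,x,y)"]) (auto simp: cb, auto simp: r_def)
        next
          case 2
          have eq: "F y - F x - (y - x) *\<^sub>R f x = (x - y) *\<^sub>R f x - integral {y..x} f"
            using incr[of y x] x y 2 by (auto simp: D_def algebra_simps)
          have "(x, y, x) \<in> K"
            using x y(1,2) 2 \<delta> y(3)[unfolded eq]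
            by (auto simp: K_def D_def subset_iff dist_real_def)
          then show ?thesis using y 2 by (intro exI[of _ "(x,y,x)"]) (auto simp: cb, auto simp: r_def)
        qed
      qed
      from Vitali_covering_theorem_cballs[of K r "D e" m, OF r0 cov] obtain C
        where C: "countable C" "C \<subseteq> K"
          and disj: "pairwise (\<lambda>i j. disjnt (cball (m i) (r i)) (cball (m j) (r j))) C"
          and neg: "negligible (D e - (\<Union>i\<in>C. cball (m i) (r i)))" by blast
      have bound: "measure lebesgue (\<Union>i\<in>C'. cball (m i) (r i)) \<le> \<epsilon>"
        if C': "C' \<subseteq> C" "finite C'" for C'
      proof -
        define p where "p = (\<lambda>(x, u, v). (x, {u..v})) ` C'"
        have inj: "inj_on (\<lambda>(x::real, u::real, v::real). (x, {u..v})) C'"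
          using C' C by (auto simp: inj_on_def K_def Icc_eq_Icc)
        have pd: "p tagged_partial_division_of (cbox a b)"
          unfolding tagged_partial_division_of_def
        proof (intro conjI allI impI)
          show "finite p" using C' by (simp add: p_def)
          fix x k assume "(x, k) \<in> p"
          then obtain u v where uv: "(x,u,v) \<in> C'" "k = {u..v}" by (auto simp: p_def)
          then have "(x,u,v) \<in> K" using C' C by auto
          then show "x \<in> k" "k \<subseteq> cbox a b" "\<exists>a b. k = cbox a b"
            using uv by (auto simp: K_def)
        next
          fix x k x2 k2 assume *: "(x, k) \<in> p \<and> (x2, k2) \<in> p \<and> (x, k) \<noteq> (x2, k2)"
          then obtain u v where uv: "(x,u,v) \<in> C'" "k = {u..v}" by (auto simp: p_def)
          from * have "(x2, k2) \<in> p" and ne: "(x, k) \<noteq> (x2, k2)" by auto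
          then obtain u2 v2 where uv2: "(x2,u2,v2) \<in> C'" "k2 = {u2..v2}" by (auto simp: p_def)
          then have "disjnt (cball (m (x,u,v)) (r (x,u,v))) (cball (m (x2,u2,v2)) (r (x2,u2,v2)))"
            using pairwiseD[OF disj, of "(x,u,v)" "(x2,u2,v2)"] C' uv uv2 ne by auto
          then have "disjnt k k2" by (simp only: cb uv uv2)
          then show "interior k \<inter> interior k2 = {}"
            using interior_subset by (fastforce simp: disjnt_def)
        qed
        have pf: "\<gamma> fine p"
          unfolding fine_def
        proof safe
          fix x k y assume "(x,k) \<in> p" "y \<in> k"
          then obtain u v where uv: "(x,u,v) \<in> C'" "k = {u..v}" by (auto simp: p_def)
          then have "(x,u,v) \<in> K" using C' C by auto
          then show "y \<in> \<gamma> x" using uv \<open>y \<in> k\<close> by (auto simp: K_def)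
        qed
        have "e * (\<Sum>(x,u,v)\<in>C'. v - u) = (\<Sum>(x,u,v)\<in>C'. e * (v - u))"
          by (simp add: sum_distrib_left case_prod_unfold)
        also have "\<dots> \<le> (\<Sum>(x,u,v)\<in>C'. norm ((v - u) *\<^sub>R f x - integral {u..v} f))"
          using C' C by (intro sum_mono) (auto simp: K_def)
        also have "\<dots> = (\<Sum>(x,u,v)\<in>C'. norm (measure lborel {u..v} *\<^sub>R f x - integral {u..v} f))"
          using C' C by (intro sum.cong) (auto simp: K_def)
        also have "\<dots> = (\<Sum>(x,k)\<in>p. norm (measure lborel k *\<^sub>R f x - integral k f))"
          unfolding p_def by (subst sum.reindex[OF inj]) (auto simp: case_prod_unfold)
        also have "\<dots> < \<epsilon> * e" by (rule hen[OF pd pf])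
        finally have *: "(\<Sum>(x,u,v)\<in>C'. v - u) < \<epsilon>" using e by (simp add: mult.commute)
        have "measure lebesgue (\<Union>i\<in>C'. cball (m i) (r i)) \<le> (\<Sum>i\<in>C'. measure lebesgue (cball (m i) (r i)))"
          by (intro measure_UNION_le C') auto
        also have "\<dots> = (\<Sum>(x,u,v)\<in>C'. v - u)"
        proof (intro sum.cong refl)
          fix i assume "i \<in> C'"
          moreover obtain x u v where "i = (x,u,v)" by (cases i)
          ultimately show "measure lebesgue (cball (m i) (r i)) = (case i of (x,u,v) \<Rightarrow> v - u)"
            using C' C by (auto simp: K_def cb)
        qed
        finally show ?thesis using * by simp
      qed
      define U where "U = (\<Union>i\<in>C. cball (m i) (r i))"
      have U: "U \<in> lmeasurable" "measure lebesgue U \<le> \<epsilon>"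
        unfolding U_def
        by (rule fmeasurable_UN_bound[OF C(1)], simp, rule bound, assumption+,
            rule measure_UN_bound[OF C(1)], simp, rule bound, assumption+)
      have N: "D e - U \<in> lmeasurable" "measure lebesgue (D e - U) = 0"
        using neg by (auto simp: U_def negligible_imp_measurable negligible_imp_measure0)
      have "measure lebesgue ((D e - U) \<union> U) \<le> measure lebesgue (D e - U) + measure lebesgue U"
        using N U by (intro measure_Un_le) auto
      moreover have "D e \<union> U \<in> lmeasurable"
        using fmeasurable.Un[OF N(1) U(1)] by simp
      ultimately show ?thesis
        using N U by (intro exI[of _ "D e \<union> U"]) auto
    qed
    then show ?thesis unfolding negligible_outer_le by blast
  qed
  have "{x \<in> {a<..<b}. \<not> (F has_vector_derivative f x) (at x)} \<subseteq> (\<Union>n. D (inverse (Suc n)))"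
  proof clarify
    fix x assume x: "x \<in> {a<..<b}" and nd: "\<not> (F has_vector_derivative f x) (at x)"
    have "bounded_linear (\<lambda>h. h *\<^sub>R f x)" by (rule bounded_linear_scaleR_left)
    with nd obtain e where e: "e > 0"
      and bad: "\<And>d. d > 0 \<Longrightarrow> \<exists>y. \<bar>y - x\<bar> < d \<and> e * \<bar>y - x\<bar> < norm (F y - F x - (y - x) *\<^sub>R f x)"
      unfolding has_vector_derivative_def has_derivative_at_alt
      by (auto simp: not_le)
    obtain n where n: "inverse (real (Suc n)) < e" using e reals_Archimedean by blast
    have "x \<in> D (inverse (Suc n))"
      unfolding D_def
    proof (clarsimp, intro conjI allI impI)
      show "a < x" "x < b" using x by auto
      fix \<delta> :: real assume "\<delta> > 0"
      then obtain y where y: "\<bar>y - x\<bar> < min \<delta> (min (x - a) (b - x))"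
          "e * \<bar>y - x\<bar> < norm (F y - F x - (y - x) *\<^sub>R f x)"
        using bad[of "min \<delta> (min (x - a) (b - x))"] x by auto
      have "inverse (real (Suc n)) * \<bar>y - x\<bar> \<le> e * \<bar>y - x\<bar>"
        using n by (intro mult_right_mono) auto
      then show "\<exists>y\<in>{a<..<b}. \<bar>y - x\<bar> < \<delta> \<and>
          inverse (1 + real n) * \<bar>y - x\<bar> < norm (F y - F x - (y - x) *\<^sub>R f x)"
        using y by (intro bexI[of _ y]) (auto simp: abs_less_iff)
    qed
    then show "x \<in> (\<Union>n. D (inverse (Suc n)))" by blast
  qed
  moreover have "negligible (\<Union>n. D (inverse (Suc n)))"
    by (rule negligible_countable_Union) (auto intro: negl)
  ultimately show ?thesis unfolding F_def by (rule negligible_subset[rotated])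
qed

section \<open>Absolutely continuous functions\<close>

text \<open>The families of intervals in the definition of absolute continuity may be indexed by any finite
  set.\<close>

lemma abs_cont_on_finite_index:
  assumes "abs_cont_on c d f" "0 < \<epsilon>"
  shows "\<exists>\<delta>>0. \<forall>(P::'i set) s t.
      finite P \<and> (\<forall>k\<in>P. c \<le> s k \<and> s k \<le> t k \<and> t k \<le> d) \<and>
      disjoint_family_on (\<lambda>k. {s k<..<t k}) P \<and> (\<Sum>k\<in>P. t k - s k) < \<delta>
      \<longrightarrow> (\<Sum>k\<in>P. cmod (f (t k) - f (s k))) < \<epsilon>"
proof -
  obtain \<delta> where \<delta>: "0 < \<delta>"
    and *: "\<And>(n::nat) s t. \<lbrakk>\<And>k. k < n \<Longrightarrow> c \<le> s k \<and> s k \<le> t k \<and> t k \<le> d;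
        disjoint_family_on (\<lambda>k. {s k<..<t k}) {..<n}; (\<Sum>k<n. t k - s k) < \<delta>\<rbrakk>
      \<Longrightarrow> (\<Sum>k<n. cmod (f (t k) - f (s k))) < \<epsilon>"
    using assms unfolding abs_cont_on_def by meson
  show ?thesis
  proof (intro exI[of _ \<delta>] conjI \<delta> allI impI, elim conjE)
    fix P :: "'i set" and s t
    assume P: "finite P" "\<forall>k\<in>P. c \<le> s k \<and> s k \<le> t k \<and> t k \<le> d"
        "disjoint_family_on (\<lambda>k. {s k<..<t k}) P" "(\<Sum>k\<in>P. t k - s k) < \<delta>"
    obtain h where h: "bij_betw h {..<card P} P"
      using ex_bij_betw_nat_finite[OF P(1)] by (auto simp: atLeast0LessThan)
    have inP: "h k \<in> P" if "k < card P" for k using h that by (auto simp: bij_betw_def)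
    have "(\<Sum>k<card P. cmod (f ((t \<circ> h) k) - f ((s \<circ> h) k))) < \<epsilon>"
    proof (rule *)
      show "c \<le> (s \<circ> h) k \<and> (s \<circ> h) k \<le> (t \<circ> h) k \<and> (t \<circ> h) k \<le> d" if "k < card P" for k
        using P(2) inP[OF that] by simp
      show "disjoint_family_on (\<lambda>k. {(s \<circ> h) k<..<(t \<circ> h) k}) {..<card P}"
        unfolding disjoint_family_on_def
      proof (intro ballI impI)
        fix i j assume "i \<in> {..<card P}" "j \<in> {..<card P}" "i \<noteq> j"
        then have "h i \<noteq> h j" "h i \<in> P" "h j \<in> P"
          using h by (auto simp: bij_betw_def inj_on_def)
        then show "{(s \<circ> h) i<..<(t \<circ> h) i} \<inter> {(s \<circ> h) j<..<(t \<circ> h) j} = {}"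
          using P(3) by (simp add: disjoint_family_on_def)
      qed
      show "(\<Sum>k<card P. (t \<circ> h) k - (s \<circ> h) k) < \<delta>"
        using P(4) sum.reindex_bij_betw[OF h, of "\<lambda>k. t k - s k"] by simp
    qed
    then show "(\<Sum>k\<in>P. cmod (f (t k) - f (s k))) < \<epsilon>"
      using sum.reindex_bij_betw[OF h, of "\<lambda>k. cmod (f (t k) - f (s k))"] by simp
  qed
qed

lemma abs_cont_on_continuous:
  assumes "abs_cont_on c d f"
  shows "continuous_on {c..d} f"
  unfolding continuous_on_iff
proof (intro ballI allI impI)
  fix x e :: real assume x: "x \<in> {c..d}" and e: "0 < e"
  obtain \<delta> where \<delta>: "0 < \<delta>"
    and *: "\<And>(P::unit set) s t. finite P \<and> (\<forall>k\<in>P. c \<le> s k \<and> s k \<le> t k \<and> t k \<le> d) \<and>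
        disjoint_family_on (\<lambda>k. {s k<..<t k}) P \<and> (\<Sum>k\<in>P. t k - s k) < \<delta>
      \<Longrightarrow> (\<Sum>k\<in>P. cmod (f (t k) - f (s k))) < e"
    using abs_cont_on_finite_index[OF assms e, where ?'i = unit] by blast
  have "dist (f y) (f x) < e" if y: "y \<in> {c..d}" "dist y x < \<delta>" for y
  proof -
    have "(\<Sum>k\<in>{()}. cmod (f (max x y) - f (min x y))) < e"
      using x y by (intro *) (auto simp: disjoint_family_on_def dist_real_def)
    then have "cmod (f (max x y) - f (min x y)) < e" by simp
    then show ?thesis
      by (cases "x \<le> y") (simp_all add: max_def min_def dist_norm norm_minus_commute)
  qed
  then show "\<exists>d'>0. \<forall>x'\<in>{c..d}. dist x' x < d' \<longrightarrow> dist (f x') (f x) < e"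
    using \<delta> by blast
qed

lemma abs_cont_on_subinterval:
  assumes "abs_cont_on c d f" "c \<le> c'" "d' \<le> d"
  shows "abs_cont_on c' d' f"
  unfolding abs_cont_on_def
proof (intro allI impI)
  fix \<epsilon> :: real assume "0 < \<epsilon>"
  with assms(1) obtain \<delta> where "\<delta> > 0" and *: "\<forall>(n::nat) s t.
        (\<forall>k<n. c \<le> s k \<and> s k \<le> t k \<and> t k \<le> d) \<and>
        disjoint_family_on (\<lambda>k. {s k<..<t k}) {..<n} \<and> (\<Sum>k<n. t k - s k) < \<delta>
        \<longrightarrow> (\<Sum>k<n. cmod (f (t k) - f (s k))) < \<epsilon>"
    unfolding abs_cont_on_def by blast
  have "(\<Sum>k<n. cmod (f (t k) - f (s k))) < \<epsilon>" if
    "(\<forall>k<n. c' \<le> s k \<and> s k \<le> t k \<and> t k \<le> d') \<and>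
        disjoint_family_on (\<lambda>k. {s k<..<t k}) {..<n} \<and> (\<Sum>k<n. t k - s k) < \<delta>" for n :: nat and s t
  proof (rule *[rule_format])
    show "(\<forall>k<n. c \<le> s k \<and> s k \<le> t k \<and> t k \<le> d) \<and>
        disjoint_family_on (\<lambda>k. {s k<..<t k}) {..<n} \<and> (\<Sum>k<n. t k - s k) < \<delta>"
      using that assms(2,3) by (meson order_trans)
  qed
  then show "\<exists>\<delta>>0. \<forall>(n::nat) s t.
        (\<forall>k<n. c' \<le> s k \<and> s k \<le> t k \<and> t k \<le> d') \<and>
        disjoint_family_on (\<lambda>k. {s k<..<t k}) {..<n} \<and> (\<Sum>k<n. t k - s k) < \<delta>
        \<longrightarrow> (\<Sum>k<n. cmod (f (t k) - f (s k))) < \<epsilon>"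
    using \<open>\<delta> > 0\<close> by blast
qed

text \<open>For nondecreasing \<open>G\<close> the interval measure of \<open>G\<close>, extended by constants, is absolutely
  continuous with respect to Lebesgue measure; its Radon-Nikodym density is the derivative sought.\<close>

lemma abs_cont_on_mono_has_integral:
  fixes G :: "real \<Rightarrow> real"
  assumes cd: "c \<le> d" and mono: "mono_on {c..d} G"
    and ac: "abs_cont_on c d (\<lambda>x. of_real (G x))"
  shows "\<exists>g. g absolutely_integrable_on {c..d} \<and>
    (\<forall>x\<in>{c..d}. (g has_integral (G x - G c)) {c..x})"
proof -
  \<comment> \<open>clamping to \<open>[c, d]\<close> extends \<open>G\<close> by constants and shrinks intervals\<close>
  define cl where "cl = (\<lambda>x. max c (min d x))"
  have cl: "cl x \<in> {c..d}" "x \<le> y \<Longrightarrow> cl x \<le> cl y" "x \<le> y \<Longrightarrow> cl y - cl x \<le> y - x" for x y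
    using cd by (auto simp: cl_def max_def min_def)
  have cl_id: "cl x = x" if "x \<in> {c..d}" for x using that by (auto simp: cl_def)
  define V where "V = (\<lambda>x. G (cl x))"
  have Vmono: "x \<le> y \<Longrightarrow> V x \<le> V y" for x y
    unfolding V_def using cl mono by (auto simp: mono_on_def)
  have contG: "continuous_on {c..d} G"
    using continuous_on_Re[OF abs_cont_on_continuous[OF ac]] by simp
  have "continuous_on UNIV cl" unfolding cl_def by (intro continuous_intros)
  then have "continuous_on UNIV V"
    unfolding V_def using cl contG
    by (intro continuous_on_compose2[of "{c..d}" G UNIV cl]) auto
  then have Vcont: "continuous (at_right a) V" for a
    by (metis UNIV_I continuous_at_imp_continuous_at_within continuous_on_eq_continuous_at open_UNIV)
  define M where "M = interval_measure V"
  have sM[simp]: "sets M = sets borel" by (simp add: M_def)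
  have Ioc: "emeasure M {a<..b} = V b - V a" if "a \<le> b" for a b
    unfolding M_def using that Vmono Vcont by (intro emeasure_interval_measure_Ioc) auto
  have Vc: "continuous_on UNIV V" by fact
  have Icc: "emeasure M {a..b} = V b - V a" if "a \<le> b" for a b
    unfolding M_def using that Vmono Vc by (intro emeasure_interval_measure_Icc) auto
  have "absolutely_continuous lborel M"
    unfolding absolutely_continuous_def
  proof
    fix N :: "real set" assume N: "N \<in> null_sets lborel"
    have "emeasure M N \<le> ennreal \<epsilon>" if \<epsilon>: "0 < \<epsilon>" for \<epsilon>
    proof -
      obtain \<delta> where \<delta>: "0 < \<delta>"
        and *: "\<And>(P::real set set) s t. finite P \<and> (\<forall>k\<in>P. c \<le> s k \<and> s k \<le> t k \<and> t k \<le> d) \<and>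
            disjoint_family_on (\<lambda>k. {s k<..<t k}) P \<and> (\<Sum>k\<in>P. t k - s k) < \<delta>
          \<Longrightarrow> (\<Sum>k\<in>P. cmod (of_real (G (t k)) - of_real (G (s k)))) < \<epsilon>"
        using abs_cont_on_finite_index[OF ac \<epsilon>, where ?'i = "real set"] by blast
      have "N \<in> null_sets lebesgue" using N by (rule null_sets_completionI)
      then have "N \<in> sets lebesgue" "emeasure lebesgue N = 0" by auto
      then obtain U where U: "open U" "N \<subseteq> U" "U - N \<in> lmeasurable" "emeasure lebesgue (U - N) < \<delta>"
        using sets_lebesgue_outer_open \<delta> by blast
      have "emeasure lebesgue U = emeasure lebesgue (U - N)"
        using U(1) null_sets_completionI[OF N] by (intro emeasure_Diff_null_set[symmetric]) auto
      then have Ud: "emeasure lebesgue U < \<delta>" using U by simp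
      obtain \<D> where \<D>: "countable \<D>" "\<D> \<subseteq> Pow U" "\<And>X. X \<in> \<D> \<Longrightarrow> \<exists>a b. X = cbox a b" "\<Union>\<D> = U"
        using open_countable_Union_open_cbox[OF U(1)] by metis
      have \<D>2: "\<D> \<subseteq> fmeasurable M" 
      proof
        fix X assume "X \<in> \<D>"
        then obtain a b where "X = {a..b}" using \<D>(3)[of X] by auto
        then show "X \<in> fmeasurable M"
          using Icc[of a b] by (cases "a \<le> b") (auto intro!: fmeasurableI)
      qed
      have fin: "measure M (\<Union>F) \<le> \<epsilon>" if F: "F \<subseteq> \<D>" "finite F" for F
      proof -
        have "\<exists>a b. X = cbox a b" if "X \<in> F" for X
          using \<D>(3)[of X] F(1) that by auto
        from elementary_unions_intervals[OF F(2) this]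
        obtain p where p: "p division_of (\<Union>F)" by auto
        have fp: "finite p" by (rule division_ofD(1)[OF p])
        have pint: "\<exists>a b. K = {a..b} \<and> a \<le> b" if "K \<in> p" for K
          using division_ofD(3,4)[OF p that] by (auto simp: cbox_interval)
        then have "\<forall>K\<in>p. \<exists>a b. K = {a..b} \<and> a \<le> b" by simp
        then obtain s t where "\<forall>K\<in>p. K = {s K..t K} \<and> s K \<le> t K" by metis
        then have st: "\<And>K. K \<in> p \<Longrightarrow> K = {s K..t K} \<and> s K \<le> t K" by blast
        have stle: "\<And>K. K \<in> p \<Longrightarrow> s K \<le> t K" using conjunct2[OF st] .
        have ints: "interior K = {s K<..<t K}" if "K \<in> p" for K
          by (rule trans[OF arg_cong[OF conjunct1[OF st[OF that]], of interior]]) simp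
        have dis: "disjoint_family_on (\<lambda>K. {s K<..<t K}) p"
          unfolding disjoint_family_on_def using division_ofD(5)[OF p] ints by simp
        have "(\<Sum>K\<in>p. t K - s K) = (\<Sum>K\<in>p. measure lebesgue K)"
        proof (intro sum.cong refl)
          fix K assume "K \<in> p"
          note K = conjunct1[OF st[OF this]] conjunct2[OF st[OF this]]
          from K(2) have "measure lebesgue {s K..t K} = t K - s K" by simp
          from trans[OF arg_cong[OF K(1), of "measure lebesgue"] this]
          show "t K - s K = measure lebesgue K" by (rule sym)
        qed
        also have "\<dots> = measure lebesgue (\<Union>F)"
          using content_division[OF p] by simp
        also have "\<dots> < \<delta>"
        proof -
          have "emeasure lebesgue (\<Union>F) \<le> emeasure lebesgue U"
            using F \<D> U(1) by (intro emeasure_mono) (auto intro: borel_open)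
          then have "emeasure lebesgue (\<Union>F) < \<delta>" using Ud by simp
          moreover from this have "emeasure lebesgue (\<Union>F) \<noteq> top" by auto
          ultimately show ?thesis using \<delta>
            by (simp add: emeasure_eq_ennreal_measure ennreal_less_iff)
        qed
        finally have sm: "(\<Sum>K\<in>p. t K - s K) < \<delta>" .
        have "measure M (\<Union>F) = measure M (\<Union>p)" using division_ofD(6)[OF p] by simp
        also have "\<dots> \<le> (\<Sum>K\<in>p. measure M K)"
        proof (intro measure_Union_le fp)
          fix K assume "K \<in> p"
          then obtain u w where "K = {u..w}" using pint by blast
          then show "K \<in> sets M" by simp
        qed
        also have "\<dots> = (\<Sum>K\<in>p. V (t K) - V (s K))"
        proof (intro sum.cong refl)
          fix K assume "K \<in> p"
          note K = conjunct1[OF st[OF this]] conjunct2[OF st[OF this]]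
          from Icc[OF K(2)] Vmono[OF K(2)] have "measure M {s K..t K} = V (t K) - V (s K)"
            by (simp add: measure_def)
          then show "measure M K = V (t K) - V (s K)"
            by (rule trans[OF arg_cong[OF K(1), of "measure M"]])
        qed
        also have "\<dots> \<le> (\<Sum>K\<in>p. cmod (of_real (G (cl (t K))) - of_real (G (cl (s K)))))"
          unfolding V_def by (intro sum_mono) (simp flip: of_real_diff)
        also have "\<dots> < \<epsilon>"
        proof (intro * conjI ballI)
          show "finite p" by fact
          show "c \<le> cl (s K)" "cl (s K) \<le> cl (t K)" "cl (t K) \<le> d" if "K \<in> p" for K
            using cl stle that by auto
          show "disjoint_family_on (\<lambda>K. {cl (s K)<..<cl (t K)}) p"
            unfolding disjoint_family_on_def
          proof (intro ballI impI)
            fix K L assume "K \<in> p" "L \<in> p" "K \<noteq> L"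
            then have "{s K<..<t K} \<inter> {s L<..<t L} = {}"
              using dis by (simp add: disjoint_family_on_def)
            moreover have "{cl (s K)<..<cl (t K)} \<subseteq> {s K<..<t K}" for K
              by (auto simp: cl_def)
            ultimately show "{cl (s K)<..<cl (t K)} \<inter> {cl (s L)<..<cl (t L)} = {}" by blast
          qed
          show "(\<Sum>K\<in>p. cl (t K) - cl (s K)) < \<delta>"
            by (rule le_less_trans[OF sum_mono sm]) (use stle cl in auto)
        qed
        finally show ?thesis by simp
      qed
      have "U \<in> fmeasurable M" "measure M U \<le> \<epsilon>"
        using fmeasurable_Union_bound[of \<D> M \<epsilon>] measure_Union_bound[of \<D> M \<epsilon>] fin \<D>(1,4)
          subsetD[OF \<D>2] by auto
      then have "emeasure M U \<le> \<epsilon>" by (simp add: emeasure_eq_measure2 ennreal_leI)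
      moreover have "emeasure M N \<le> emeasure M U"
        using U by (intro emeasure_mono) auto
      ultimately show ?thesis by simp
    qed
    then have "emeasure M N \<le> 0"
      by - (rule ennreal_le_epsilon, simp)
    moreover have "N \<in> sets M" using N sM by (metis null_setsD2 sets_lborel)
    ultimately show "N \<in> null_sets M" by (intro null_setsI) simp_all
  qed
  then have "\<exists>h \<in> borel_measurable lborel. density lborel h = M"
    by (intro sigma_finite_measure.Radon_Nikodym sigma_finite_lborel) simp_all
  then obtain h where "h \<in> borel_measurable lborel" and dens: "density lborel h = M"
    by (elim bexE)
  then have [measurable]: "h \<in> borel_measurable borel" by simp
  define g where "g = (\<lambda>x. enn2real (h x))"
  have [measurable]: "g \<in> borel_measurable borel" unfolding g_def by measurable
  have fin: "AE y in lborel. h y * indicator {c<..d} y \<noteq> \<infinity>"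
  proof (rule nn_integral_noteq_infinite)
    have "(\<integral>\<^sup>+y. h y * indicator {c<..d} y \<partial>lborel) = emeasure M {c<..d}"
      unfolding dens[symmetric] by (subst emeasure_density) auto
    then show "(\<integral>\<^sup>+y. h y * indicator {c<..d} y \<partial>lborel) \<noteq> \<infinity>" using Ioc[OF cd] by simp
  qed auto
  have int: "(g has_integral (G x - G c)) {c..x}" if x: "x \<in> {c..d}" for x
  proof -
    have "(\<integral>\<^sup>+y. ennreal (indicator {c<..x} y * g y) \<partial>lborel) = (\<integral>\<^sup>+y. h y * indicator {c<..x} y \<partial>lborel)"
    proof (rule nn_integral_cong_AE)
      from fin show "AE y in lborel. ennreal (indicator {c<..x} y * g y) = h y * indicator {c<..x} y"
      proof eventually_elim
        case (elim y)
        then show ?case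
          using x by (cases "y \<in> {c<..x}") (simp_all add: g_def less_top)
      qed
    qed
    also have "\<dots> = emeasure M {c<..x}"
      unfolding dens[symmetric] by (subst emeasure_density) auto
    also have "\<dots> = G x - G c" using x cd by (subst Ioc) (auto simp: V_def cl_id)
    finally have "((\<lambda>y. indicator {c<..x} y * g y) has_integral (G x - G c)) UNIV"
      using x mono by (intro nn_integral_has_integral) (auto simp: g_def mono_on_def)
    moreover have "(\<lambda>y. indicator {c<..x} y * g y) = (\<lambda>y. if y \<in> {c<..x} then g y else 0)"
      by (auto simp: indicator_def)
    ultimately have "(g has_integral (G x - G c)) {c<..x}"
      by (simp only: has_integral_restrict_UNIV)
    moreover have "negligible {y \<in> {c..x} - {c<..x}. g y \<noteq> 0}"
      by (rule negligible_subset[of "{c}"]) auto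
    moreover have "negligible {y \<in> {c<..x} - {c..x}. g y \<noteq> 0}"
      by (rule negligible_subset[of "{}"]) auto
    ultimately show ?thesis by (subst has_integral_spike_set_eq)
  qed
  have "g absolutely_integrable_on {c..d}"
    using int[of d] cd by (intro nonnegative_absolutely_integrable_1) (auto simp: g_def)
  with int show ?thesis by (intro exI[of _ g] conjI ballI)
qed

text \<open>The closure properties of absolute continuity that are needed follow from this comparison of
  increments.\<close>

lemma abs_cont_on_dominated:
  assumes f1: "abs_cont_on c d f1" and f2: "abs_cont_on c d f2" and K: "0 < K"
    and le: "\<And>x y. \<lbrakk>c \<le> x; x \<le> y; y \<le> d\<rbrakk> \<Longrightarrow>
              cmod (g y - g x) \<le> K * (cmod (f1 y - f1 x) + cmod (f2 y - f2 x))"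
  shows "abs_cont_on c d g"
  unfolding abs_cont_on_def
proof (intro allI impI)
  fix \<epsilon> :: real assume "0 < \<epsilon>"
  define \<eta> where "\<eta> = \<epsilon> / (2 * K)"
  have "0 < \<eta>" using \<open>0 < \<epsilon>\<close> K by (simp add: \<eta>_def)
  obtain \<delta>1 where d1: "\<delta>1 > 0" "\<And>(n::nat) s t.
        (\<forall>k<n. c \<le> s k \<and> s k \<le> t k \<and> t k \<le> d) \<and>
        disjoint_family_on (\<lambda>k. {s k<..<t k}) {..<n} \<and> (\<Sum>k<n. t k - s k) < \<delta>1
        \<Longrightarrow> (\<Sum>k<n. cmod (f1 (t k) - f1 (s k))) < \<eta>"
    using f1 \<open>0 < \<eta>\<close> unfolding abs_cont_on_def by blast
  obtain \<delta>2 where d2: "\<delta>2 > 0" "\<And>(n::nat) s t.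
        (\<forall>k<n. c \<le> s k \<and> s k \<le> t k \<and> t k \<le> d) \<and>
        disjoint_family_on (\<lambda>k. {s k<..<t k}) {..<n} \<and> (\<Sum>k<n. t k - s k) < \<delta>2
        \<Longrightarrow> (\<Sum>k<n. cmod (f2 (t k) - f2 (s k))) < \<eta>"
    using f2 \<open>0 < \<eta>\<close> unfolding abs_cont_on_def by blast
  have "(\<Sum>k<n. cmod (g (t k) - g (s k))) < \<epsilon>" if
    st: "(\<forall>k<n. c \<le> s k \<and> s k \<le> t k \<and> t k \<le> d) \<and>
        disjoint_family_on (\<lambda>k. {s k<..<t k}) {..<n} \<and> (\<Sum>k<n. t k - s k) < min \<delta>1 \<delta>2"
    for n :: nat and s t
  proof -
    have "(\<Sum>k<n. cmod (g (t k) - g (s k)))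
        \<le> (\<Sum>k<n. K * (cmod (f1 (t k) - f1 (s k)) + cmod (f2 (t k) - f2 (s k))))"
      using st by (intro sum_mono le) auto
    also have "\<dots> = K * ((\<Sum>k<n. cmod (f1 (t k) - f1 (s k))) + (\<Sum>k<n. cmod (f2 (t k) - f2 (s k))))"
      by (simp add: sum_distrib_left sum.distrib distrib_left)
    also have "\<dots> < K * (\<eta> + \<eta>)"
      using K d1(2)[of n s t] d2(2)[of n s t] st by (intro mult_strict_left_mono add_strict_mono) simp_all
    also have "\<dots> = \<epsilon>" using K by (simp add: \<eta>_def)
    finally show ?thesis .
  qed
  moreover have "min \<delta>1 \<delta>2 > 0" using d1 d2 by simp
  ultimately show "\<exists>\<delta>>0. \<forall>(n::nat) s t.
        (\<forall>k<n. c \<le> s k \<and> s k \<le> t k \<and> t k \<le> d) \<and>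
        disjoint_family_on (\<lambda>k. {s k<..<t k}) {..<n} \<and> (\<Sum>k<n. t k - s k) < \<delta>
        \<longrightarrow> (\<Sum>k<n. cmod (g (t k) - g (s k))) < \<epsilon>"
    by blast
qed

lemma abs_cont_on_diff:
  assumes "abs_cont_on c d f" "abs_cont_on c d g"
  shows "abs_cont_on c d (\<lambda>x. f x - g x)"
proof (rule abs_cont_on_dominated[OF assms, of 1])
  fix x y
  have "(f y - g y) - (f x - g x) = (f y - f x) - (g y - g x)" by simp
  then show "cmod ((f y - g y) - (f x - g x)) \<le> 1 * (cmod (f y - f x) + cmod (g y - g x))"
    using norm_triangle_ineq4[of "f y - f x" "g y - g x"] by (simp only: mult_1)
qed simp

lemma abs_cont_on_mult:
  assumes f: "abs_cont_on c d f" and g: "abs_cont_on c d g"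
  shows "abs_cont_on c d (\<lambda>x. f x * g x)"
proof -
  have "bounded (f ` {c..d})" "bounded (g ` {c..d})"
    by (intro compact_imp_bounded compact_continuous_image abs_cont_on_continuous f g compact_Icc)+
  then obtain A B where A: "\<And>x. x \<in> {c..d} \<Longrightarrow> cmod (f x) \<le> A"
    and B: "\<And>x. x \<in> {c..d} \<Longrightarrow> cmod (g x) \<le> B"
    unfolding bounded_iff by blast
  define K where "K = max 1 (max A B)"
  show ?thesis
  proof (rule abs_cont_on_dominated[OF f g, of K])
    show "0 < K" by (simp add: K_def)
    fix x y assume xy: "c \<le> x" "x \<le> y" "y \<le> d"
    have K: "cmod (f x) \<le> K" "cmod (g y) \<le> K" using A[of x] B[of y] xy by (auto simp: K_def)
    have "f y * g y - f x * g x = (f y - f x) * g y + f x * (g y - g x)" by (simp add: algebra_simps)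
    then have "cmod (f y * g y - f x * g x) \<le> cmod (f y - f x) * cmod (g y) + cmod (f x) * cmod (g y - g x)"
      using norm_triangle_ineq[of "(f y - f x) * g y" "f x * (g y - g x)"] by (simp add: norm_mult)
    also have "\<dots> \<le> cmod (f y - f x) * K + K * cmod (g y - g x)"
      using K by (intro add_mono mult_left_mono mult_right_mono) simp_all
    finally show "cmod (f y * g y - f x * g x) \<le> K * (cmod (f y - f x) + cmod (g y - g x))"
      by (simp add: algebra_simps)
  qed
qed

lemma sum_integral_disjoint_intervals_le:
  fixes u :: "real \<Rightarrow> real"
  assumes P: "finite P" "\<And>k. k \<in> P \<Longrightarrow> c \<le> s k \<and> s k \<le> t k \<and> t k \<le> d"
      "disjoint_family_on (\<lambda>k. {s k<..<t k}) P"
    and u: "u integrable_on {c..d}" "\<And>x. x \<in> {c..d} \<Longrightarrow> 0 \<le> u x"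
  shows "(\<Sum>k\<in>P. integral {s k..t k} u) \<le> integral {c..d} u"
proof -
  have hi: "((\<lambda>x. if x \<in> {s k<..<t k} then u x else 0) has_integral integral {s k..t k} u) {c..d}"
    if "k \<in> P" for k
  proof -
    have "u integrable_on {s k..t k}"
      using u(1) by (rule integrable_on_subinterval) (use P(2)[OF that] in auto)
    then have "(u has_integral integral {s k..t k} u) {s k<..<t k}"
      using integrable_integral has_integral_Icc_iff_Ioo by blast
    moreover have "{s k<..<t k} \<subseteq> {c..d}" using P(2)[OF that] by auto
    ultimately show ?thesis by (simp add: has_integral_restrict del: greaterThanLessThan_iff)
  qed
  have "((\<lambda>x. \<Sum>k\<in>P. if x \<in> {s k<..<t k} then u x else 0) has_integral
      (\<Sum>k\<in>P. integral {s k..t k} u)) {c..d}"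
    by (rule has_integral_sum[OF P(1) hi])
  then show ?thesis
  proof (rule has_integral_le[OF _ integrable_integral[OF u(1)]])
    fix x assume x: "x \<in> {c..d}"
    show "(\<Sum>k\<in>P. if x \<in> {s k<..<t k} then u x else 0) \<le> u x"
    proof (cases "\<exists>k\<in>P. x \<in> {s k<..<t k}")
      case True
      then obtain k where k: "k \<in> P" "x \<in> {s k<..<t k}" by blast
      have "(\<Sum>j\<in>P. if x \<in> {s j<..<t j} then u x else 0) = (\<Sum>j\<in>{k}. if x \<in> {s j<..<t j} then u x else 0)"
      proof (rule sum.mono_neutral_right)
        show "\<forall>j\<in>P - {k}. (if x \<in> {s j<..<t j} then u x else 0) = 0"
        proof
          fix j assume "j \<in> P - {k}"
          then have "{s j<..<t j} \<inter> {s k<..<t k} = {}"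
            using P(3) k unfolding disjoint_family_on_def by blast
          then have "x \<notin> {s j<..<t j}" using k by blast
          then show "(if x \<in> {s j<..<t j} then u x else 0) = 0" by (rule if_not_P)
        qed
      qed (use P k in auto)
      then show ?thesis using k by simp
    next
      case False
      then have "(\<Sum>k\<in>P. if x \<in> {s k<..<t k} then u x else 0) = 0"
        by (intro sum.neutral) auto
      then show ?thesis using u(2)[OF x] by linarith
    qed
  qed
qed

text \<open>Absolute continuity of the integral: the integrand is approximated in the mean by its bounded
  truncations.\<close>

lemma abs_cont_on_integral:
  fixes h F :: "real \<Rightarrow> complex"
  assumes h: "h absolutely_integrable_on {c..d}"
    and F: "\<And>x y. \<lbrakk>c \<le> x; x \<le> y; y \<le> d\<rbrakk> \<Longrightarrow> F y - F x = integral {x..y} h"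
  shows "abs_cont_on c d F"
  unfolding abs_cont_on_def
proof (intro allI impI)
  fix \<epsilon> :: real assume \<epsilon>: "0 < \<epsilon>"
  define u where "u = (\<lambda>x. cmod (h x))"
  have u: "u absolutely_integrable_on {c..d}"
    unfolding u_def by (rule absolutely_integrable_norm[OF h, unfolded comp_def])
  define m where "m = (\<lambda>(n::nat) x. min (u x) (real n))"
  have m: "m n absolutely_integrable_on {c..d}" for n
    unfolding m_def by (intro absolutely_integrable_min_1 u absolutely_integrable_on_const) auto
  have ui: "u integrable_on {c..d}" and mi: "m n integrable_on {c..d}" for n
    using set_lebesgue_integral_eq_integral(1) u m by blast+
  have "(\<lambda>n. integral {c..d} (m n)) \<longlonglongrightarrow> integral {c..d} u"
  proof (rule dominated_convergence(2)[OF mi ui])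
    show "norm (m n x) \<le> u x" for n x by (simp add: m_def u_def)
    fix x
    obtain N :: nat where "u x \<le> real N" using real_arch_simple by blast
    then have "eventually (\<lambda>n. m n x = u x) sequentially"
      by (intro eventually_sequentiallyI[of N]) (simp add: m_def min_def)
    then show "(\<lambda>n. m n x) \<longlonglongrightarrow> u x" by (rule tendsto_eventually)
  qed
  from tendstoD[OF this, of "\<epsilon> / 2"] \<epsilon>
  have "\<forall>\<^sub>F n in sequentially. dist (integral {c..d} (m n)) (integral {c..d} u) < \<epsilon> / 2" by simp
  then obtain n where "dist (integral {c..d} (m n)) (integral {c..d} u) < \<epsilon> / 2"
    unfolding eventually_sequentially by blast
  then have n: "integral {c..d} u - integral {c..d} (m n) < \<epsilon> / 2"
    unfolding dist_real_def by linarith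
  \<comment> \<open>the truncation is bounded by \<open>n\<close>, so this length contributes at most \<open>\<epsilon>/2\<close>\<close>
  define \<delta> where "\<delta> = \<epsilon> / (2 * (real n + 1))"
  have \<delta>: "0 < \<delta>" using \<epsilon> by (simp add: \<delta>_def)
  have "(\<Sum>k<N. cmod (F (t k) - F (s k))) < \<epsilon>" if
    st: "\<forall>k<N. c \<le> s k \<and> s k \<le> t k \<and> t k \<le> d"
        "disjoint_family_on (\<lambda>k. {s k<..<t k}) {..<N}" "(\<Sum>k<N. t k - s k) < \<delta>"
    for N :: nat and s t
  proof -
    have "cmod (F (t k) - F (s k)) \<le> integral {s k..t k} (\<lambda>x. u x - m n x) + real n * (t k - s k)"
      if "k < N" for k
    proof -
      have k: "c \<le> s k" "s k \<le> t k" "t k \<le> d" and sub: "{s k..t k} \<subseteq> {c..d}" using st that by auto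
      have int: "h integrable_on {s k..t k}" "u integrable_on {s k..t k}" "m n integrable_on {s k..t k}"
        using sub set_lebesgue_integral_eq_integral(1)[OF h] ui mi[of n] by (auto intro: integrable_on_subinterval)
      have "cmod (F (t k) - F (s k)) = cmod (integral {s k..t k} h)" using F[OF k] by simp
      also have "\<dots> \<le> integral {s k..t k} u"
        by (rule integral_norm_bound_integral[OF int(1,2)]) (simp add: u_def)
      also have "\<dots> = integral {s k..t k} (\<lambda>x. u x - m n x) + integral {s k..t k} (m n)"
        using int by (simp add: integral_diff)
      also have "integral {s k..t k} (m n) \<le> integral {s k..t k} (\<lambda>_. real n)"
        by (rule integral_le[OF int(3)]) (auto simp: m_def)
      also have "\<dots> = real n * (t k - s k)" using k by simp
      finally show ?thesis by simp
    qed
    then have "(\<Sum>k<N. cmod (F (t k) - F (s k)))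
        \<le> (\<Sum>k<N. integral {s k..t k} (\<lambda>x. u x - m n x) + real n * (t k - s k))"
      by (intro sum_mono) simp
    also have "\<dots> = (\<Sum>k<N. integral {s k..t k} (\<lambda>x. u x - m n x)) + real n * (\<Sum>k<N. t k - s k)"
      by (simp only: sum.distrib sum_distrib_left)
    also have "(\<Sum>k<N. integral {s k..t k} (\<lambda>x. u x - m n x)) \<le> integral {c..d} (\<lambda>x. u x - m n x)"
      using st by (intro sum_integral_disjoint_intervals_le integrable_diff ui mi) (auto simp: m_def)
    also have "\<dots> = integral {c..d} u - integral {c..d} (m n)" by (rule integral_diff[OF ui mi])
    also have "\<dots> < \<epsilon> / 2" by (rule n)
    also have "real n * (\<Sum>k<N. t k - s k) \<le> real n * \<delta>"
      using st(3) by (intro mult_left_mono) auto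
    also have "\<dots> \<le> \<epsilon> / 2" using \<epsilon> by (simp add: \<delta>_def field_simps)
    finally show ?thesis by simp
  qed
  then show "\<exists>\<delta>>0. \<forall>(N::nat) s t.
        (\<forall>k<N. c \<le> s k \<and> s k \<le> t k \<and> t k \<le> d) \<and>
        disjoint_family_on (\<lambda>k. {s k<..<t k}) {..<N} \<and> (\<Sum>k<N. t k - s k) < \<delta>
        \<longrightarrow> (\<Sum>k<N. cmod (F (t k) - F (s k))) < \<epsilon>"
    using \<delta> by blast
qed

text \<open>The sums whose supremum is the total variation of \<open>f\<close> on \<open>[x, y]\<close>. Families of intervals, which
  need not cover \<open>[x, y]\<close>, are used instead of partitions, to match the definition of absolute
  continuity; the index type \<open>nat\<close> is immaterial.\<close>

definition variation_sums :: "(real \<Rightarrow> real) \<Rightarrow> real \<Rightarrow> real \<Rightarrow> real set" where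
  "variation_sums f x y = {\<Sum>k\<in>P. \<bar>f (t k) - f (s k)\<bar> | (P :: nat set) s t.
     finite P \<and> (\<forall>k\<in>P. x \<le> s k \<and> s k \<le> t k \<and> t k \<le> y) \<and>
     disjoint_family_on (\<lambda>k. {s k<..<t k}) P}"

lemma variation_sumsI:
  "\<lbrakk>finite (P :: nat set); \<And>k. k \<in> P \<Longrightarrow> x \<le> s k \<and> s k \<le> t k \<and> t k \<le> y;
    disjoint_family_on (\<lambda>k. {s k<..<t k}) P\<rbrakk>
   \<Longrightarrow> (\<Sum>k\<in>P. \<bar>f (t k) - f (s k)\<bar>) \<in> variation_sums f x y"
  unfolding variation_sums_def by blast

lemma variation_sumsE:
  assumes "v \<in> variation_sums f x y"
  obtains P :: "nat set" and s t where "finite P" "\<forall>k\<in>P. x \<le> s k \<and> s k \<le> t k \<and> t k \<le> y"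
    "disjoint_family_on (\<lambda>k. {s k<..<t k}) P" "v = (\<Sum>k\<in>P. \<bar>f (t k) - f (s k)\<bar>)"
  using assms unfolding variation_sums_def by blast

lemma zero_in_variation_sums: "0 \<in> variation_sums f x y"
  using variation_sumsI[of "{}" x "\<lambda>_. 0" "\<lambda>_. 0" y f] by (simp add: disjoint_family_on_def)

lemma variation_sums_mono:
  assumes "x' \<le> x" "y \<le> y'"
  shows "variation_sums f x y \<subseteq> variation_sums f x' y'"
proof
  fix v assume "v \<in> variation_sums f x y"
  then obtain P :: "nat set" and s t where P: "finite P" "\<forall>k\<in>P. x \<le> s k \<and> s k \<le> t k \<and> t k \<le> y"
    "disjoint_family_on (\<lambda>k. {s k<..<t k}) P" and v: "v = (\<Sum>k\<in>P. \<bar>f (t k) - f (s k)\<bar>)"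
    by (rule variation_sumsE)
  show "v \<in> variation_sums f x' y'"
    unfolding v
  proof (rule variation_sumsI)
    show "x' \<le> s k \<and> s k \<le> t k \<and> t k \<le> y'" if "k \<in> P" for k using bspec[OF P(2) that] assms by auto
  qed fact+
qed

lemma variation_sums_append:
  assumes "v \<in> variation_sums f c x" "c \<le> x" "x \<le> y"
  shows "v + \<bar>f y - f x\<bar> \<in> variation_sums f c y"
proof -
  obtain P :: "nat set" and s t where P: "finite P" "\<forall>k\<in>P. c \<le> s k \<and> s k \<le> t k \<and> t k \<le> x"
    "disjoint_family_on (\<lambda>k. {s k<..<t k}) P" and v: "v = (\<Sum>k\<in>P. \<bar>f (t k) - f (s k)\<bar>)"
    using assms(1) by (rule variation_sumsE)
  obtain n where n: "n \<notin> P" using P(1) by (metis ex_new_if_finite infinite_UNIV_nat)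
  define s' t' where "s' = s(n := x)" and "t' = t(n := y)"
  have "(\<Sum>k\<in>insert n P. \<bar>f (t' k) - f (s' k)\<bar>) \<in> variation_sums f c y"
  proof (rule variation_sumsI)
    show "c \<le> s' k \<and> s' k \<le> t' k \<and> t' k \<le> y" if "k \<in> insert n P" for k
      using that P(2) assms(2,3) by (auto simp: s'_def t'_def)
    have "{s k<..<t k} \<inter> {x<..<y} = {}" if "k \<in> P" for k
      using bspec[OF P(2) that] by auto
    then show "disjoint_family_on (\<lambda>k. {s' k<..<t' k}) (insert n P)"
      using P(3) n unfolding disjoint_family_on_def s'_def t'_def
      by (simp add: Int_commute del: greaterThanLessThan_iff Int_greaterThanLessThan)
  qed (use P in simp)
  moreover have "(\<Sum>k\<in>insert n P. \<bar>f (t' k) - f (s' k)\<bar>) = v + \<bar>f y - f x\<bar>"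
  proof -
    have "(\<Sum>k\<in>P. \<bar>f (t' k) - f (s' k)\<bar>) = v"
      unfolding v using n by (intro sum.cong refl) (auto simp: s'_def t'_def)
    then show ?thesis using n P(1) by (simp add: s'_def t'_def)
  qed
  ultimately show ?thesis by simp
qed

text \<open>Cutting every interval of a family at \<open>x\<close> splits a variation sum.\<close>

lemma variation_sums_split:
  assumes "v \<in> variation_sums f c y" "c \<le> x" "x \<le> y"
  shows "\<exists>v1 \<in> variation_sums f c x. \<exists>v2 \<in> variation_sums f x y. v \<le> v1 + v2"
proof -
  obtain P :: "nat set" and s t where P: "finite P" "\<forall>k\<in>P. c \<le> s k \<and> s k \<le> t k \<and> t k \<le> y"
    "disjoint_family_on (\<lambda>k. {s k<..<t k}) P" and v: "v = (\<Sum>k\<in>P. \<bar>f (t k) - f (s k)\<bar>)"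
    using assms(1) by (rule variation_sumsE)
  have dis: "disjoint_family_on (\<lambda>k. {s' k<..<t' k}) P"
    if "\<And>k. {s' k<..<t' k} \<subseteq> {s k<..<t k}" for s' t' :: "nat \<Rightarrow> real"
    unfolding disjoint_family_on_def
  proof (intro ballI impI)
    fix k l assume "k \<in> P" "l \<in> P" "k \<noteq> l"
    then have "{s k<..<t k} \<inter> {s l<..<t l} = {}" using P(3) by (simp add: disjoint_family_on_def)
    then show "{s' k<..<t' k} \<inter> {s' l<..<t' l} = {}" using that[of k] that[of l] by blast
  qed
  have "(\<Sum>k\<in>P. \<bar>f (min (t k) x) - f (min (s k) x)\<bar>) \<in> variation_sums f c x"
  proof (rule variation_sumsI[OF P(1) _ dis])
    show "c \<le> min (s k) x \<and> min (s k) x \<le> min (t k) x \<and> min (t k) x \<le> x" if "k \<in> P" for k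
      using bspec[OF P(2) that] assms(2,3) by (auto simp: min_def)
  qed (auto simp: min_def)
  moreover have "(\<Sum>k\<in>P. \<bar>f (max (t k) x) - f (max (s k) x)\<bar>) \<in> variation_sums f x y"
  proof (rule variation_sumsI[OF P(1) _ dis])
    show "x \<le> max (s k) x \<and> max (s k) x \<le> max (t k) x \<and> max (t k) x \<le> y" if "k \<in> P" for k
      using bspec[OF P(2) that] assms(2,3) by (auto simp: max_def)
  qed (auto simp: max_def)
  moreover have "v \<le> (\<Sum>k\<in>P. \<bar>f (min (t k) x) - f (min (s k) x)\<bar>) +
      (\<Sum>k\<in>P. \<bar>f (max (t k) x) - f (max (s k) x)\<bar>)"
    unfolding v sum.distrib[symmetric]
  proof (rule sum_mono)
    fix k assume "k \<in> P"
    then have "s k \<le> t k" using P(2) by blast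
    then show "\<bar>f (t k) - f (s k)\<bar> \<le>
      \<bar>f (min (t k) x) - f (min (s k) x)\<bar> + \<bar>f (max (t k) x) - f (max (s k) x)\<bar>"
      by (cases "t k \<le> x"; cases "s k \<le> x") (simp_all add: min_def max_def)
  qed
  ultimately show ?thesis by blast
qed

text \<open>Jordan decomposition: a real absolutely continuous function of bounded variation is a
  difference of two nondecreasing absolutely continuous ones, the variation and the variation
  minus the function.\<close>

lemma abs_cont_on_real_has_integral_bounded_variation:
  fixes f :: "real \<Rightarrow> real"
  assumes cd: "c \<le> d" and ac: "abs_cont_on c d (\<lambda>x. of_real (f x))"
    and bdd: "bdd_above (variation_sums f c d)"
  shows "\<exists>g. g absolutely_integrable_on {c..d} \<and>
    (\<forall>x\<in>{c..d}. (g has_integral (f x - f c)) {c..x})"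
proof -
  define tv where "tv = (\<lambda>x y. Sup (variation_sums f x y))"
  have bd: "bdd_above (variation_sums f x y)" if "c \<le> x" "y \<le> d" for x y
    using bdd variation_sums_mono[OF that] by (rule bdd_above_mono)
  have up: "v \<le> tv x y" if "v \<in> variation_sums f x y" "c \<le> x" "y \<le> d" for v x y
    unfolding tv_def using that bd by (intro cSup_upper) auto
  have le: "tv x y \<le> B" if "\<And>v. v \<in> variation_sums f x y \<Longrightarrow> v \<le> B" for x y B
    unfolding tv_def using zero_in_variation_sums that by (intro cSup_least) blast+
  define V where "V = (\<lambda>x. tv c x)"
  have V1: "V x + \<bar>f y - f x\<bar> \<le> V y" if "c \<le> x" "x \<le> y" "y \<le> d" for x y
  proof -
    have "tv c x \<le> V y - \<bar>f y - f x\<bar>"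
      using up[OF variation_sums_append[OF _ that(1,2)]] that(3)
      by (intro le) (simp add: V_def le_diff_eq)
    then show ?thesis by (simp add: V_def)
  qed
  have V2: "V y - V x \<le> tv x y" if "c \<le> x" "x \<le> y" "y \<le> d" for x y
  proof -
    have "v \<le> V x + tv x y" if v: "v \<in> variation_sums f c y" for v
    proof -
      obtain v1 v2 where "v1 \<in> variation_sums f c x" "v2 \<in> variation_sums f x y" "v \<le> v1 + v2"
        using variation_sums_split[OF v \<open>c \<le> x\<close> \<open>x \<le> y\<close>] by blast
      moreover have "v1 \<le> V x" "v2 \<le> tv x y"
        using calculation \<open>c \<le> x\<close> \<open>x \<le> y\<close> \<open>y \<le> d\<close> up[of v1 c x] up[of v2 x y] by (simp_all add: V_def)
      ultimately show ?thesis by linarith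
    qed
    from le[of c y, OF this] show ?thesis by (simp add: V_def)
  qed
  have Vmono: "V x \<le> V y" if "c \<le> x" "x \<le> y" "y \<le> d" for x y
    using V1[OF that] by linarith
  have acV: "abs_cont_on c d (\<lambda>x. of_real (V x))"
    unfolding abs_cont_on_def
  proof (intro allI impI)
    fix \<epsilon> :: real assume \<epsilon>: "0 < \<epsilon>"
    then have "0 < \<epsilon> / 2" by simp
    from abs_cont_on_finite_index[OF ac this, where ?'i = "nat \<times> nat"]
    obtain \<delta> where \<delta>: "\<delta> > 0" and *: "\<And>(P::(nat \<times> nat) set) s t.
        finite P \<and> (\<forall>k\<in>P. c \<le> s k \<and> s k \<le> t k \<and> t k \<le> d) \<and>
        disjoint_family_on (\<lambda>k. {s k<..<t k}) P \<and> (\<Sum>k\<in>P. t k - s k) < \<delta>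
        \<Longrightarrow> (\<Sum>k\<in>P. cmod (of_real (f (t k)) - of_real (f (s k)))) < \<epsilon> / 2"
      by blast
    have "(\<Sum>k<n. cmod (of_real (V (t k)) - of_real (V (s k)))) < \<epsilon>" if
      st: "\<forall>k<n. c \<le> s k \<and> s k \<le> t k \<and> t k \<le> d"
        "disjoint_family_on (\<lambda>k. {s k<..<t k}) {..<n}" "(\<Sum>k<n. t k - s k) < \<delta>" for n :: nat and s t
    proof -
      \<comment> \<open>each of the \<open>n\<close> variations is approximated up to \<open>\<eta>\<close> by a sum over a family \<open>Q k\<close>\<close>
      define \<eta> where "\<eta> = \<epsilon> / (2 * (real n + 1))"
      have \<eta>: "0 < \<eta>" using \<epsilon> by (simp add: \<eta>_def)
      define \<phi> where "\<phi> = (\<lambda>k (P::nat set) S T. finite P \<and>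
          (\<forall>j\<in>P. s k \<le> S j \<and> S j \<le> T j \<and> T j \<le> t k) \<and>
          disjoint_family_on (\<lambda>j. {S j<..<T j}) P \<and>
          tv (s k) (t k) < (\<Sum>j\<in>P. \<bar>f (T j) - f (S j)\<bar>) + \<eta>)"
      have "\<exists>P S T. \<phi> k P S T" for k
      proof -
        have "tv (s k) (t k) - \<eta> < Sup (variation_sums f (s k) (t k))" using \<eta> by (simp add: tv_def)
        from less_cSupD[OF _ this] obtain v where v: "v \<in> variation_sums f (s k) (t k)" "tv (s k) (t k) - \<eta> < v"
          using zero_in_variation_sums by blast
        from v(1) obtain P :: "nat set" and S T where "finite P"
          "\<forall>j\<in>P. s k \<le> S j \<and> S j \<le> T j \<and> T j \<le> t k"
          "disjoint_family_on (\<lambda>j. {S j<..<T j}) P" "v = (\<Sum>j\<in>P. \<bar>f (T j) - f (S j)\<bar>)"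
          by (rule variation_sumsE)
        with v(2) have "\<phi> k P S T" unfolding \<phi>_def by simp
        then show ?thesis by blast
      qed
      then obtain Q S T where "\<And>k. \<phi> k (Q k) (S k) (T k)" by metis
      then have Q: "\<And>k. finite (Q k)" "\<And>k j. j \<in> Q k \<Longrightarrow> s k \<le> S k j \<and> S k j \<le> T k j \<and> T k j \<le> t k"
           "\<And>k. disjoint_family_on (\<lambda>j. {S k j<..<T k j}) (Q k)"
           "\<And>k. tv (s k) (t k) < (\<Sum>j\<in>Q k. \<bar>f (T k j) - f (S k j)\<bar>) + \<eta>"
        unfolding \<phi>_def by simp_all
      \<comment> \<open>all these families together form one family of disjoint intervals\<close>
      define P where "P = Sigma {..<n} Q"
      have finP: "finite P" unfolding P_def using Q(1) by (intro finite_SigmaI) auto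
      have "(\<Sum>p\<in>P. cmod (of_real (f (case_prod T p)) - of_real (f (case_prod S p)))) < \<epsilon> / 2"
      proof (intro * conjI ballI finP)
        fix p assume "p \<in> P"
        then obtain k j where p: "p = (k, j)" "k < n" "j \<in> Q k" by (auto simp: P_def)
        with Q(2)[OF p(3)] st(1)
        show "c \<le> case_prod S p" "case_prod S p \<le> case_prod T p" "case_prod T p \<le> d" by force+
      next
        show "disjoint_family_on (\<lambda>p. {case_prod S p<..<case_prod T p}) P"
          unfolding disjoint_family_on_def
        proof (intro ballI impI)
          fix p p' assume "p \<in> P" "p' \<in> P" and ne: "p \<noteq> p'"
          then obtain k j k' j' where p: "p = (k, j)" "k < n" "j \<in> Q k" "p' = (k', j')" "k' < n" "j' \<in> Q k'"
            by (auto simp: P_def)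
          show "{case_prod S p<..<case_prod T p} \<inter> {case_prod S p'<..<case_prod T p'} = {}"
          proof (cases "k = k'")
            case True
            then have "j \<noteq> j'" using ne p by auto
            then show ?thesis using Q(3)[of k] p True by (simp add: disjoint_family_on_def)
          next
            case False
            then have "{s k<..<t k} \<inter> {s k'<..<t k'} = {}"
              using st(2) p by (simp add: disjoint_family_on_def)
            moreover have "{S k j<..<T k j} \<subseteq> {s k<..<t k}" "{S k' j'<..<T k' j'} \<subseteq> {s k'<..<t k'}"
              using Q(2)[OF p(3)] Q(2)[OF p(6)] by auto
            ultimately show ?thesis unfolding p(1,4) prod.case by blast
          qed
        qed
        have "(\<Sum>p\<in>P. case_prod T p - case_prod S p) = (\<Sum>k<n. \<Sum>j\<in>Q k. T k j - S k j)"
          unfolding P_def using Q(1) by (subst sum.Sigma) (auto simp: case_prod_unfold)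
        also have "\<dots> \<le> (\<Sum>k<n. t k - s k)"
        proof (rule sum_mono)
          fix k assume "k \<in> {..<n}"
          then have k: "s k \<le> t k" using st(1) by auto
          have "(\<Sum>j\<in>Q k. T k j - S k j) = (\<Sum>j\<in>Q k. integral {S k j..T k j} (\<lambda>_. 1))"
            using Q(2)[of _ k] by (intro sum.cong refl) auto
          also have "\<dots> \<le> integral {s k..t k} (\<lambda>_. 1)"
            by (rule sum_integral_disjoint_intervals_le) (use Q in auto)
          also have "\<dots> = t k - s k" using k by simp
          finally show "(\<Sum>j\<in>Q k. T k j - S k j) \<le> t k - s k" .
        qed
        finally show "(\<Sum>p\<in>P. case_prod T p - case_prod S p) < \<delta>" using st(3) by linarith
      qed
      also have "(\<Sum>p\<in>P. cmod (of_real (f (case_prod T p)) - of_real (f (case_prod S p))))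
          = (\<Sum>k<n. \<Sum>j\<in>Q k. \<bar>f (T k j) - f (S k j)\<bar>)"
        unfolding P_def using Q(1)
        by (subst sum.Sigma) (auto simp: case_prod_unfold simp flip: of_real_diff)
      finally have small: "(\<Sum>k<n. \<Sum>j\<in>Q k. \<bar>f (T k j) - f (S k j)\<bar>) < \<epsilon> / 2" .
      have "(\<Sum>k<n. cmod (of_real (V (t k)) - of_real (V (s k)))) = (\<Sum>k<n. V (t k) - V (s k))"
        using st(1) Vmono by (intro sum.cong refl) (simp flip: of_real_diff)
      also have "\<dots> \<le> (\<Sum>k<n. (\<Sum>j\<in>Q k. \<bar>f (T k j) - f (S k j)\<bar>) + \<eta>)"
      proof (rule sum_mono)
        fix k assume "k \<in> {..<n}"
        then have "V (t k) - V (s k) \<le> tv (s k) (t k)" using st(1) by (intro V2) auto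
        then show "V (t k) - V (s k) \<le> (\<Sum>j\<in>Q k. \<bar>f (T k j) - f (S k j)\<bar>) + \<eta>"
          using Q(4)[of k] by linarith
      qed
      also have "\<dots> = (\<Sum>k<n. \<Sum>j\<in>Q k. \<bar>f (T k j) - f (S k j)\<bar>) + real n * \<eta>"
        by (simp add: sum.distrib)
      also have "real n * \<eta> \<le> \<epsilon> / 2" using \<epsilon> by (simp add: \<eta>_def field_simps)
      finally show ?thesis using small by linarith
    qed
    then show "\<exists>\<delta>>0. \<forall>(n::nat) s t.
        (\<forall>k<n. c \<le> s k \<and> s k \<le> t k \<and> t k \<le> d) \<and>
        disjoint_family_on (\<lambda>k. {s k<..<t k}) {..<n} \<and> (\<Sum>k<n. t k - s k) < \<delta>
        \<longrightarrow> (\<Sum>k<n. cmod (of_real (V (t k)) - of_real (V (s k)))) < \<epsilon>"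
      using \<delta> by blast
  qed
  have acW: "abs_cont_on c d (\<lambda>x. of_real (V x - f x))"
    using abs_cont_on_diff[OF acV ac] by simp
  have mV: "mono_on {c..d} V" using Vmono by (intro mono_onI) auto
  have mW: "mono_on {c..d} (\<lambda>x. V x - f x)"
  proof (rule mono_onI)
    fix x y assume "x \<in> {c..d}" "y \<in> {c..d}" "x \<le> y"
    then show "V x - f x \<le> V y - f y" using V1[of x y] by auto
  qed
  obtain gV where gV: "gV absolutely_integrable_on {c..d}"
    "\<And>x. x \<in> {c..d} \<Longrightarrow> (gV has_integral (V x - V c)) {c..x}"
    using abs_cont_on_mono_has_integral[OF cd mV acV] by blast
  obtain gW where gW: "gW absolutely_integrable_on {c..d}"
    "\<And>x. x \<in> {c..d} \<Longrightarrow> (gW has_integral ((V x - f x) - (V c - f c))) {c..x}"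
    using abs_cont_on_mono_has_integral[OF cd mW acW] by blast
  have "((\<lambda>x. gV x - gW x) has_integral (f x - f c)) {c..x}" if "x \<in> {c..d}" for x
    using has_integral_diff[OF gV(2)[OF that] gW(2)[OF that]] by (simp add: algebra_simps)
  moreover have "(\<lambda>x. gV x - gW x) absolutely_integrable_on {c..d}"
    using gV(1) gW(1) by (rule set_integral_diff)
  ultimately show ?thesis by (intro exI[of _ "\<lambda>x. gV x - gW x"] conjI ballI)
qed

section \<open>The fundamental theorem for absolutely continuous functions\<close>

text \<open>On intervals shorter than the \<open>\<delta>\<close> that absolute continuity provides for \<open>\<epsilon> = 1\<close>, the variation
  is at most \<open>1\<close>. The densities obtained there are glued.\<close>

lemma abs_cont_on_real_has_integral:
  fixes f :: "real \<Rightarrow> real"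
  assumes cd: "c \<le> d" and ac: "abs_cont_on c d (\<lambda>x. of_real (f x))"
  shows "\<exists>g. g absolutely_integrable_on {c..d} \<and>
    (\<forall>x\<in>{c..d}. (g has_integral (f x - f c)) {c..x})"
proof -
  from abs_cont_on_finite_index[OF ac zero_less_one, where ?'i = nat]
  obtain \<delta> where \<delta>: "\<delta> > 0" and *: "\<And>(P::nat set) s t.
      finite P \<and> (\<forall>k\<in>P. c \<le> s k \<and> s k \<le> t k \<and> t k \<le> d) \<and>
      disjoint_family_on (\<lambda>k. {s k<..<t k}) P \<and> (\<Sum>k\<in>P. t k - s k) < \<delta>
      \<Longrightarrow> (\<Sum>k\<in>P. cmod (of_real (f (t k)) - of_real (f (s k)))) < 1"
    by blast
  have short: "bdd_above (variation_sums f x y)" if xy: "c \<le> x" "x \<le> y" "y \<le> d" "y - x < \<delta>" for x y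
  proof (rule bdd_aboveI)
    fix v assume "v \<in> variation_sums f x y"
    then obtain P :: "nat set" and s t where P: "finite P" "\<forall>k\<in>P. x \<le> s k \<and> s k \<le> t k \<and> t k \<le> y"
      "disjoint_family_on (\<lambda>k. {s k<..<t k}) P" and v: "v = (\<Sum>k\<in>P. \<bar>f (t k) - f (s k)\<bar>)"
      by (rule variation_sumsE)
    have "(\<Sum>k\<in>P. t k - s k) = (\<Sum>k\<in>P. integral {s k..t k} (\<lambda>_. 1))"
      using P(2) by (intro sum.cong refl) auto
    also have "\<dots> \<le> integral {x..y} (\<lambda>_. 1)"
      by (rule sum_integral_disjoint_intervals_le) (use P in auto)
    also have "\<dots> = y - x" using xy by simp
    finally have "(\<Sum>k\<in>P. t k - s k) < \<delta>" using xy by linarith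
    moreover have "\<forall>k\<in>P. c \<le> s k \<and> s k \<le> t k \<and> t k \<le> d"
      using P(2) xy by fastforce
    ultimately have "(\<Sum>k\<in>P. cmod (of_real (f (t k)) - of_real (f (s k)))) < 1"
      using P by (intro *) blast
    then show "v \<le> 1" unfolding v by (simp flip: of_real_diff)
  qed
  have "\<exists>g. g absolutely_integrable_on {c..d'} \<and> (\<forall>x\<in>{c..d'}. (g has_integral (f x - f c)) {c..x})"
    if "c \<le> d'" "d' \<le> d" "d' - c \<le> real n * (\<delta> / 2)" for n d'
    using that
  proof (induction n arbitrary: d')
    case 0
    then have "d' = c" by simp
    then show ?case by (intro exI[of _ "\<lambda>_. 0"]) auto
  next
    case (Suc n)
    \<comment> \<open>the last piece has length at most \<open>\<delta>/2\<close>\<close>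
    define m where "m = max c (d' - \<delta> / 2)"
    have m: "c \<le> m" "m \<le> d'" "m - c \<le> real n * (\<delta> / 2)" "d' - m < \<delta>" "m \<le> d"
      using Suc.prems \<delta> by (auto simp: m_def max_def field_simps)
    obtain g1 where g1: "g1 absolutely_integrable_on {c..m}"
      "\<And>x. x \<in> {c..m} \<Longrightarrow> (g1 has_integral (f x - f c)) {c..x}"
      using Suc.IH[OF m(1,5,3)] by blast
    have "abs_cont_on m d' (\<lambda>x. of_real (f x))"
      using ac m Suc.prems by (intro abs_cont_on_subinterval[OF ac]) auto
    from abs_cont_on_real_has_integral_bounded_variation[OF m(2) this short]
    obtain g2 where g2: "g2 absolutely_integrable_on {m..d'}"
      "\<And>x. x \<in> {m..d'} \<Longrightarrow> (g2 has_integral (f x - f m)) {m..x}"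
      using m Suc.prems by blast
    define g where "g = (\<lambda>x. if x \<le> m then g1 x else g2 x)"
    have 1: "(g has_integral (f x - f c)) {c..x}" if "x \<in> {c..m}" for x
      using g1(2)[OF that] by (rule has_integral_eq[rotated]) (use that in \<open>auto simp: g_def\<close>)
    have 2: "(g has_integral (f x - f m)) {m..x}" if "x \<in> {m..d'}" for x
      by (rule has_integral_spike[OF _ _ g2(2)[OF that], of "{m}"]) (auto simp: g_def)
    have a1: "g absolutely_integrable_on {c..m}"
      by (rule absolutely_integrable_spike[OF g1(1), of "{}"]) (auto simp: g_def)
    have a2: "g absolutely_integrable_on {m..d'}"
      by (rule absolutely_integrable_spike[OF g2(1), of "{m}"]) (auto simp: g_def)
    have "g absolutely_integrable_on {c..m} \<union> {m..d'}"
      by (rule absolutely_integrable_Un[OF a1 a2])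
    moreover have "{c..m} \<union> {m..d'} = {c..d'}" using m by auto
    moreover have "(g has_integral (f x - f c)) {c..x}" if x: "x \<in> {c..d'}" for x
    proof (cases "x \<le> m")
      case True
      then show ?thesis using 1 x by auto
    next
      case False
      then have xm: "x \<in> {m..d'}" "m \<in> {c..m}" "m \<le> x" using x m by auto
      have "(g has_integral ((f m - f c) + (f x - f m))) {c..x}"
        by (rule has_integral_combine[OF m(1) xm(3) 1[OF xm(2)] 2[OF xm(1)]])
      then show ?thesis by simp
    qed
    ultimately show ?case by auto
  qed
  note step = this
  obtain n :: nat where "(d - c) / (\<delta> / 2) \<le> real n" using real_arch_simple by blast
  then have "d - c \<le> real n * (\<delta> / 2)" using \<delta> by (simp add: field_simps)
  then show ?thesis by (rule step[OF cd order_refl])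
qed

lemma abs_cont_on_has_integral:
  assumes cd: "c \<le> d" and ac: "abs_cont_on c d f"
  shows "\<exists>g. g absolutely_integrable_on {c..d} \<and>
    (\<forall>x\<in>{c..d}. (g has_integral (f x - f c)) {c..x})"
proof -
  have "abs_cont_on c d (\<lambda>x. of_real (Re (f x)))"
  proof (rule abs_cont_on_dominated[OF ac ac, of 1])
    fix x y
    have "\<bar>Re (f y - f x)\<bar> \<le> cmod (f y - f x)" by (rule abs_Re_le_cmod)
    also have "\<dots> \<le> 1 * (cmod (f y - f x) + cmod (f y - f x))" by simp
    finally show "cmod (of_real (Re (f y)) - of_real (Re (f x)))
        \<le> 1 * (cmod (f y - f x) + cmod (f y - f x))"
      by (simp only: norm_of_real minus_complex.sel flip: of_real_diff)
  qed simp
  from abs_cont_on_real_has_integral[OF cd this]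
  obtain g1 where g1: "g1 absolutely_integrable_on {c..d}"
    "\<And>x. x \<in> {c..d} \<Longrightarrow> (g1 has_integral (Re (f x) - Re (f c))) {c..x}" by blast
  have "abs_cont_on c d (\<lambda>x. of_real (Im (f x)))"
  proof (rule abs_cont_on_dominated[OF ac ac, of 1])
    fix x y
    have "\<bar>Im (f y - f x)\<bar> \<le> cmod (f y - f x)" by (rule abs_Im_le_cmod)
    also have "\<dots> \<le> 1 * (cmod (f y - f x) + cmod (f y - f x))" by simp
    finally show "cmod (of_real (Im (f y)) - of_real (Im (f x)))
        \<le> 1 * (cmod (f y - f x) + cmod (f y - f x))"
      by (simp only: norm_of_real minus_complex.sel flip: of_real_diff)
  qed simp
  from abs_cont_on_real_has_integral[OF cd this]
  obtain g2 where g2: "g2 absolutely_integrable_on {c..d}"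
    "\<And>x. x \<in> {c..d} \<Longrightarrow> (g2 has_integral (Im (f x) - Im (f c))) {c..x}" by blast
  define g where "g = (\<lambda>x. of_real (g1 x) + \<i> * of_real (g2 x))"
  have bl: "bounded_linear (\<lambda>x. \<i> * of_real x :: complex)"
    by (rule bounded_linear_compose[OF bounded_linear_mult_right bounded_linear_of_real])
  have "g absolutely_integrable_on {c..d}"
    unfolding g_def
    using absolutely_integrable_linear[OF g1(1) bounded_linear_of_real]
      absolutely_integrable_linear[OF g2(1) bl]
    by (intro set_integral_add) (simp_all add: comp_def)
  moreover have "(g has_integral (f x - f c)) {c..x}" if "x \<in> {c..d}" for x
  proof -
    have "(g has_integral (of_real (Re (f x) - Re (f c)) + \<i> * of_real (Im (f x) - Im (f c)))) {c..x}"
      unfolding g_def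
      using has_integral_linear[OF g1(2)[OF that] bounded_linear_of_real]
        has_integral_linear[OF g2(2)[OF that] bl]
      by (intro has_integral_add) (simp_all add: comp_def)
    moreover have "of_real (Re (f x) - Re (f c)) + \<i> * of_real (Im (f x) - Im (f c)) = f x - f c"
      by (simp add: complex_eq_iff)
    ultimately show ?thesis by simp
  qed
  ultimately show ?thesis by (intro exI[of _ g] conjI ballI)
qed

lemma has_vector_derivative_ae_of_integral:
  fixes f g :: "real \<Rightarrow> 'a::euclidean_space"
  assumes g: "g integrable_on {c..d}" and fg: "\<And>x. x \<in> {c..d} \<Longrightarrow> (g has_integral (f x - f c)) {c..x}"
  shows "negligible {x \<in> {c<..<d}. \<not> (f has_vector_derivative g x) (at x)}"
proof (rule negligible_subset[OF has_vector_derivative_indefinite_integral_ae[OF g]], clarify)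
  fix x assume x: "x \<in> {c<..<d}" and nd: "\<not> (f has_vector_derivative g x) (at x)"
    and "((\<lambda>y. integral {c..y} g) has_vector_derivative g x) (at x)"
  then have "((\<lambda>y. f c + integral {c..y} g) has_vector_derivative g x) (at x)"
    by (auto intro!: derivative_eq_intros)
  then have "(f has_vector_derivative g x) (at x)"
  proof (rule has_vector_derivative_transform_within_open[where S = "{c<..<d}"])
    fix y assume "y \<in> {c<..<d}"
    then have "integral {c..y} g = f y - f c" by (intro integral_unique fg) auto
    then show "f c + integral {c..y} g = f y" by simp
  qed (use x in auto)
  then show False using nd by contradiction
qed

theorem abs_cont_on_fundamental_theorem:
  assumes cd: "c \<le> d" and ac: "abs_cont_on c d f"
  shows "negligible {x \<in> {c<..<d}. \<not> f differentiable (at x)}"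
    and "(\<lambda>x. vector_derivative f (at x)) absolutely_integrable_on {c..d}"
    and "\<And>x. x \<in> {c..d} \<Longrightarrow> ((\<lambda>x. vector_derivative f (at x)) has_integral (f x - f c)) {c..x}"
proof -
  obtain g where g: "g absolutely_integrable_on {c..d}"
    and fg: "\<And>x. x \<in> {c..d} \<Longrightarrow> (g has_integral (f x - f c)) {c..x}"
    using abs_cont_on_has_integral[OF assms] by blast
  let ?N = "{x \<in> {c<..<d}. \<not> (f has_vector_derivative g x) (at x)}"
  have N: "negligible ?N"
    using set_lebesgue_integral_eq_integral(1)[OF g] fg by (rule has_vector_derivative_ae_of_integral)
  show "negligible {x \<in> {c<..<d}. \<not> f differentiable (at x)}"
    by (rule negligible_subset[OF N]) (auto dest: differentiableI_vector)
  have N': "negligible (insert c (insert d ?N))" using N by simp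
  have eq: "vector_derivative f (at x) = g x" if "x \<in> {c..d} - insert c (insert d ?N)" for x
    using that by (intro vector_derivative_at) auto
  show "(\<lambda>x. vector_derivative f (at x)) absolutely_integrable_on {c..d}"
    by (rule absolutely_integrable_spike[OF g N' eq])
  show "((\<lambda>x. vector_derivative f (at x)) has_integral (f x - f c)) {c..x}" if "x \<in> {c..d}" for x
    by (rule has_integral_spike[OF N' _ fg[OF that]]) (use eq that in auto)
qed

section \<open>Local primitives\<close>

text \<open>\<open>F\<close> is a primitive of the locally integrable function \<open>G\<close> on \<open>I\<close>. For open \<open>I\<close> this is the same as: \<open>F\<close> is locally
  absolutely continuous with derivative \<open>G\<close> almost everywhere.\<close>

definition loc_primitive :: "real set \<Rightarrow> (real \<Rightarrow> complex) \<Rightarrow> (real \<Rightarrow> complex) \<Rightarrow> bool" where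
  "loc_primitive I F G \<longleftrightarrow> (\<forall>c d. c \<le> d \<and> {c..d} \<subseteq> I \<longrightarrow>
     G absolutely_integrable_on {c..d} \<and> (G has_integral (F d - F c)) {c..d})"

lemma loc_primitiveD:
  assumes "loc_primitive I F G" "c \<le> d" "{c..d} \<subseteq> I"
  shows "G absolutely_integrable_on {c..d}" "(G has_integral (F d - F c)) {c..d}"
    "integral {c..d} G = F d - F c"
  using assms by (auto simp: loc_primitive_def intro: integral_unique)

lemma AE_lebesgue_on_iff_negligible:
  assumes "I \<in> sets lebesgue"
  shows "(AE x in lebesgue_on I. P x) \<longleftrightarrow> (\<exists>N. negligible N \<and> (\<forall>x\<in>I - N. P x))"
proof -
  have "(AE x in lebesgue_on I. P x) \<longleftrightarrow> (AE x in lebesgue. x \<in> I \<longrightarrow> P x)"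
    using assms by (intro AE_restrict_space_iff) simp
  also have "\<dots> \<longleftrightarrow> (\<exists>N. negligible N \<and> (\<forall>x\<in>I - N. P x))"
    unfolding eventually_ae_filter negligible_iff_null_sets by (simp, blast)
  finally show ?thesis .
qed

lemma loc_primitive_AC_loc:
  assumes "loc_primitive I F G"
  shows "AC_loc I F"
  unfolding AC_loc_def
proof (intro allI impI)
  fix c d assume cd: "{c..d} \<subseteq> I"
  show "abs_cont_on c d F"
  proof (cases "c \<le> d")
    case True
    show ?thesis
    proof (rule abs_cont_on_integral)
      show "G absolutely_integrable_on {c..d}" by (rule loc_primitiveD(1)[OF assms True cd])
      fix x y assume "c \<le> x" "x \<le> y" "y \<le> d"
      then show "F y - F x = integral {x..y} G"
        using cd by (intro loc_primitiveD(3)[OF assms, symmetric]) auto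
    qed
  next
    case False
    then have no: "\<not> (c \<le> s \<and> s \<le> t \<and> t \<le> d)" for s t by linarith
    show ?thesis
      unfolding abs_cont_on_def
    proof (intro allI impI exI[of _ 1] conjI)
      fix \<epsilon> :: real and n :: nat and s t
      assume "0 < \<epsilon>" and *: "(\<forall>k<n. c \<le> s k \<and> s k \<le> t k \<and> t k \<le> d) \<and>
        disjoint_family_on (\<lambda>k. {s k<..<t k}) {..<n} \<and> (\<Sum>k<n. t k - s k) < 1"
      then have "n = 0" using no by blast
      then show "(\<Sum>k<n. cmod (F (t k) - F (s k))) < \<epsilon>" using \<open>0 < \<epsilon>\<close> by simp
    qed simp
  qed
qed

lemma AC_loc_continuous_on:
  assumes I: "open I" and F: "AC_loc I F"
  shows "continuous_on I F"
proof (rule continuous_at_imp_continuous_on, rule ballI)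
  fix x assume "x \<in> I"
  then obtain e where e: "0 < e" "cball x e \<subseteq> I" using I open_contains_cball by blast
  then have "{x - e..x + e} \<subseteq> I" by (simp add: cball_eq_atLeastAtMost)
  then have "continuous_on {x - e..x + e} F"
    using F abs_cont_on_continuous by (simp add: AC_loc_def)
  then have "continuous_on {x - e<..<x + e} F"
    by (rule continuous_on_subset) auto
  then show "isCont F x"
    using e(1) by (simp add: continuous_on_eq_continuous_at)
qed

lemma negligible_locally_interval:
  fixes I :: "real set"
  assumes I: "open I" and N: "\<And>c d. \<lbrakk>c \<le> d; {c..d} \<subseteq> I\<rbrakk> \<Longrightarrow> negligible {x \<in> {c<..<d}. P x}"
  shows "negligible {x \<in> I. P x}"
proof (subst locally_negligible_alt, rule ballI)
  fix x :: real assume x: "x \<in> {x \<in> I. P x}"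
  then obtain e where e: "0 < e" "cball x e \<subseteq> I" using I open_contains_cball by blast
  then have sub: "{x - e..x + e} \<subseteq> I" by (simp add: cball_eq_atLeastAtMost)
  let ?U = "{x \<in> I. P x} \<inter> {x - e<..<x + e}"
  have "negligible {y \<in> {x - e<..<x + e}. P y}" using e sub by (intro N) auto
  then have "negligible ?U" by (rule negligible_subset) auto
  moreover have "openin (top_of_set {x \<in> I. P x}) ?U" by (rule openin_open_Int) simp
  moreover have "x \<in> ?U" using x e by simp
  ultimately show "\<exists>U. openin (top_of_set {x \<in> I. P x}) U \<and> x \<in> U \<and> negligible U" by blast
qed

lemma loc_primitive_has_vector_derivative_ae:
  assumes I: "open I" and F: "loc_primitive I F G"
  shows "negligible {x \<in> I. \<not> (F has_vector_derivative G x) (at x)}"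
proof (rule negligible_locally_interval[OF I])
  fix c d :: real assume cd: "c \<le> d" "{c..d} \<subseteq> I"
  show "negligible {x \<in> {c<..<d}. \<not> (F has_vector_derivative G x) (at x)}"
  proof (rule has_vector_derivative_ae_of_integral)
    show "G integrable_on {c..d}" using loc_primitiveD(2)[OF F cd] by blast
    fix x assume "x \<in> {c..d}"
    then show "(G has_integral F x - F c) {c..x}"
      using cd by (intro loc_primitiveD(2)[OF F]) auto
  qed
qed

lemma loc_primitive_spike:
  assumes F: "loc_primitive I F G" and N: "negligible N" and eq: "\<And>x. x \<in> I - N \<Longrightarrow> G' x = G x"
  shows "loc_primitive I F G'"
  unfolding loc_primitive_def
proof (intro allI impI, elim conjE, intro conjI)
  fix c d assume cd: "c \<le> d" "{c..d} \<subseteq> I"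
  show "G' absolutely_integrable_on {c..d}"
    by (rule absolutely_integrable_spike[OF loc_primitiveD(1)[OF F cd] N]) (use eq cd in auto)
  show "(G' has_integral (F d - F c)) {c..d}"
    by (rule has_integral_spike[OF N _ loc_primitiveD(2)[OF F cd]]) (use eq cd in auto)
qed

lemma AC_loc_loc_primitive:
  assumes "AC_loc I F"
  shows "loc_primitive I F (\<lambda>x. vector_derivative F (at x))"
  unfolding loc_primitive_def
proof (intro allI impI, elim conjE)
  fix c d assume cd: "c \<le> d" "{c..d} \<subseteq> I"
  have ac: "abs_cont_on c d F" using assms cd by (simp add: AC_loc_def)
  show "(\<lambda>x. vector_derivative F (at x)) absolutely_integrable_on {c..d} \<and>
      ((\<lambda>x. vector_derivative F (at x)) has_integral F d - F c) {c..d}"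
    using abs_cont_on_fundamental_theorem(2,3)[OF cd(1) ac] cd(1) by simp
qed

lemma AC_loc_loc_primitiveI:
  assumes "AC_loc I F" and N: "negligible N"
    and eq: "\<And>x. x \<in> I - N \<Longrightarrow> (F has_vector_derivative G x) (at x)"
  shows "loc_primitive I F G"
  by (rule loc_primitive_spike[OF AC_loc_loc_primitive[OF assms(1)] N])
    (use eq vector_derivative_at in metis)

lemma loc_primitive_cong:
  assumes "loc_primitive I F G" "\<And>x. x \<in> I \<Longrightarrow> F' x = F x" "\<And>x. x \<in> I \<Longrightarrow> G' x = G x"
  shows "loc_primitive I F' G'"
proof -
  have "loc_primitive I F G'" by (rule loc_primitive_spike[OF assms(1) negligible_empty]) (use assms(3) in auto)
  moreover have "F' d - F' c = F d - F c" if "c \<le> d" "{c..d} \<subseteq> I" for c d :: real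
  proof -
    have "c \<in> I" "d \<in> I" using that by auto
    then show ?thesis using assms(2) by simp
  qed
  ultimately show ?thesis unfolding loc_primitive_def by presburger
qed

lemma loc_primitive_add:
  assumes "loc_primitive I F1 G1" "loc_primitive I F2 G2"
  shows "loc_primitive I (\<lambda>x. F1 x + F2 x) (\<lambda>x. G1 x + G2 x)"
  unfolding loc_primitive_def
proof (intro allI impI, elim conjE, intro conjI)
  fix c d assume cd: "c \<le> d" "{c..d} \<subseteq> I"
  note 1 = loc_primitiveD[OF assms(1) cd] and 2 = loc_primitiveD[OF assms(2) cd]
  show "(\<lambda>x. G1 x + G2 x) absolutely_integrable_on {c..d}" by (rule set_integral_add(1)[OF 1(1) 2(1)])
  have "((\<lambda>x. G1 x + G2 x) has_integral ((F1 d - F1 c) + (F2 d - F2 c))) {c..d}"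
    by (rule has_integral_add[OF 1(2) 2(2)])
  then show "((\<lambda>x. G1 x + G2 x) has_integral (F1 d + F2 d - (F1 c + F2 c))) {c..d}"
    by (simp add: algebra_simps)
qed

lemma loc_primitive_linear:
  assumes "loc_primitive I F G" and T: "bounded_linear T"
  shows "loc_primitive I (\<lambda>x. T (F x)) (\<lambda>x. T (G x))"
  unfolding loc_primitive_def
proof (intro allI impI, elim conjE, intro conjI)
  fix c d assume cd: "c \<le> d" "{c..d} \<subseteq> I"
  note 1 = loc_primitiveD[OF assms(1) cd]
  show "(\<lambda>x. T (G x)) absolutely_integrable_on {c..d}"
    using absolutely_integrable_linear[OF 1(1) T] by (simp add: comp_def)
  show "((\<lambda>x. T (G x)) has_integral (T (F d) - T (F c))) {c..d}"
    using has_integral_linear[OF 1(2) T] by (simp add: comp_def linear_diff[OF bounded_linear.linear[OF T]])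
qed

lemma loc_primitive_mult:
  assumes I: "open I" and F1: "loc_primitive I F1 G1" and F2: "loc_primitive I F2 G2"
  shows "loc_primitive I (\<lambda>x. F1 x * F2 x) (\<lambda>x. F1 x * G2 x + G1 x * F2 x)"
proof (rule AC_loc_loc_primitiveI)
  show "AC_loc I (\<lambda>x. F1 x * F2 x)"
    using loc_primitive_AC_loc[OF F1] loc_primitive_AC_loc[OF F2]
    unfolding AC_loc_def by (auto intro: abs_cont_on_mult)
  show "negligible ({x \<in> I. \<not> (F1 has_vector_derivative G1 x) (at x)} \<union>
      {x \<in> I. \<not> (F2 has_vector_derivative G2 x) (at x)})"
    by (intro negligible_Un loc_primitive_has_vector_derivative_ae I F1 F2)
  fix x assume "x \<in> I - ({x \<in> I. \<not> (F1 has_vector_derivative G1 x) (at x)} \<union>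
      {x \<in> I. \<not> (F2 has_vector_derivative G2 x) (at x)})"
  then have "(F1 has_vector_derivative G1 x) (at x)" "(F2 has_vector_derivative G2 x) (at x)" by auto
  then show "((\<lambda>x. F1 x * F2 x) has_vector_derivative (F1 x * G2 x + G1 x * F2 x)) (at x)"
    by (rule has_vector_derivative_mult)
qed

text \<open>The locally absolutely continuous representative of a quasi-derivative is unique for this
  reason.\<close>

lemma continuous_ae_eq_on_open:
  fixes f g :: "real \<Rightarrow> complex"
  assumes I: "open I" and f: "continuous_on I f" and g: "continuous_on I g"
    and N: "negligible N" and eq: "\<And>x. x \<in> I - N \<Longrightarrow> f x = g x" and x: "x \<in> I"
  shows "f x = g x"
proof (rule ccontr)
  assume ne: "f x \<noteq> g x"
  have "open (I \<inter> (\<lambda>x. f x - g x) -` (- {0}))"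
    by (intro continuous_open_preimage continuous_on_diff f g I) auto
  moreover have "x \<in> I \<inter> (\<lambda>x. f x - g x) -` (- {0})" using x ne by simp
  ultimately have "\<not> negligible (I \<inter> (\<lambda>x. f x - g x) -` (- {0}))"
    by (metis empty_iff open_not_negligible)
  moreover have "I \<inter> (\<lambda>x. f x - g x) -` (- {0}) \<subseteq> N" using eq by auto
  ultimately show False using N negligible_subset by blast
qed

section \<open>Limits of primitives at the endpoints\<close>

lemma
  shows open_dom_int: "open (dom_int S)"
    and dom_int_sets_lebesgue: "dom_int S \<in> sets lebesgue"
    and dom_int_Icc_subset: "\<lbrakk>c \<in> dom_int S; d \<in> dom_int S\<rbrakk> \<Longrightarrow> {c..d} \<subseteq> dom_int S"
proof -
  show "open (dom_int S)" by (simp add: dom_int_def)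
  then show "dom_int S \<in> sets lebesgue" by (simp add: borel_open sets_completionI_sets)
  show "{c..d} \<subseteq> dom_int S" if cd: "c \<in> dom_int S" "d \<in> dom_int S"
  proof
    fix x assume "x \<in> {c..d}"
    then have "ereal c \<le> ereal x" "ereal x \<le> ereal d" by auto
    moreover have "lo S < ereal c" "ereal d < hi S" using cd by (auto simp: dom_int_def einterval_iff)
    ultimately have "lo S < ereal x" "ereal x < hi S" by (blast intro: less_le_trans le_less_trans)+
    then show "x \<in> dom_int S" by (simp add: dom_int_def einterval_iff)
  qed
qed

lemma end_filter_neq_bot:
  assumes "lo S < hi S"
  shows "end_filter S e \<noteq> bot"
proof (cases e)
  case Left_End
  have "at_right (lo S) \<noteq> bot"
  proof
    assume "at_right (lo S) = bot"
    then have "eventually (\<lambda>_. False) (at_right (lo S))" by simp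
    then obtain b where "lo S < b" "\<forall>y>lo S. y < b \<longrightarrow> False"
      using eventually_at_right[OF assms] by auto
    then show False using dense[of "lo S" b] by blast
  qed
  then show ?thesis using Left_End by (simp add: filtermap_bot_iff)
next
  case Right_End
  have "at_left (hi S) \<noteq> bot"
  proof
    assume "at_left (hi S) = bot"
    then have "eventually (\<lambda>_. False) (at_left (hi S))" by simp
    then obtain b where "b < hi S" "\<forall>y>b. y < hi S \<longrightarrow> False"
      using eventually_at_left[OF assms] by auto
    then show False using dense[of b "hi S"] by blast
  qed
  then show ?thesis using Right_End by (simp add: filtermap_bot_iff)
qed

lemma real_of_ereal_in_dom_int:
  assumes "lo S < y" "y < hi S"
  shows "real_of_ereal y \<in> dom_int S" "ereal (real_of_ereal y) = y"
proof -
  have "\<bar>y\<bar> \<noteq> \<infinity>" using assms by auto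
  then show "ereal (real_of_ereal y) = y" by (rule ereal_real')
  with assms show "real_of_ereal y \<in> dom_int S" by (simp add: dom_int_def einterval_iff)
qed

text \<open>A primitive of a function that is integrable up to the endpoints has limits there.\<close>

lemma loc_primitive_end_limit_aux:
  assumes lh: "lo S < hi S" and F: "loc_primitive (dom_int S) F G"
    and G: "G absolutely_integrable_on dom_int S" and c: "c \<in> dom_int S"
  shows "(F \<longlongrightarrow> F c + integral (dom_int S) (\<lambda>x. if c \<le> x then G x else 0)) (end_filter S Right_End)"
    and "(F \<longlongrightarrow> F c - integral (dom_int S) (\<lambda>x. if x \<le> c then G x else 0)) (end_filter S Left_End)"
proof -
  let ?I = "dom_int S"
  have Gn: "(\<lambda>x. cmod (G x)) integrable_on ?I"
    using absolutely_integrable_norm[OF G] set_lebesgue_integral_eq_integral(1) by (simp add: comp_def)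
  have cb: "lo S < ereal c" "ereal c < hi S" using c by (auto simp: dom_int_def einterval_iff)
  have part: "(\<lambda>x. if x \<in> {u..v} then G x else 0) integrable_on ?I"
      "integral ?I (\<lambda>x. if x \<in> {u..v} then G x else 0) = F v - F u"
    if "u \<le> v" "u \<in> ?I" "v \<in> ?I" for u v
  proof -
    have sub: "{u..v} \<subseteq> ?I" by (rule dom_int_Icc_subset[OF that(2,3)])
    have "((\<lambda>x. if x \<in> {u..v} then G x else 0) has_integral (F v - F u)) ?I"
      by (subst has_integral_restrict[OF sub]) (rule loc_primitiveD(2)[OF F that(1) sub])
    then show "(\<lambda>x. if x \<in> {u..v} then G x else 0) integrable_on ?I"
      "integral ?I (\<lambda>x. if x \<in> {u..v} then G x else 0) = F v - F u"
      by (auto intro: integral_unique)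
  qed
  have "((\<lambda>y. F (real_of_ereal y)) \<longlongrightarrow> F c + integral ?I (\<lambda>x. if c \<le> x then G x else 0)) (at_left (hi S))"
  proof (rule tendsto_at_left_sequentially[OF cb(2)])
    fix y assume y: "\<And>n. y n < hi S" "\<And>n. ereal c < y n" "incseq y" "y \<longlonglongrightarrow> hi S"
    define u where "u = (\<lambda>n. real_of_ereal (y n))"
    have u: "u n \<in> ?I" "ereal (u n) = y n" for n
      unfolding u_def using real_of_ereal_in_dom_int[of S "y n"] y(1,2)[of n] cb(1) by (auto intro: less_trans)
    have cu: "c \<le> u n" for n using y(2)[of n] unfolding u(2)[of n, symmetric] by simp
    have "(\<lambda>n. integral ?I (\<lambda>x. if x \<in> {c..u n} then G x else 0)) \<longlonglongrightarrow>
        integral ?I (\<lambda>x. if c \<le> x then G x else 0)"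
    proof (rule dominated_convergence(2)[OF _ Gn])
      show "(\<lambda>x. if x \<in> {c..u n} then G x else 0) integrable_on ?I" for n
        by (rule part(1)[OF cu c u(1)])
      show "norm (if x \<in> {c..u n} then G x else 0) \<le> cmod (G x)" for n x by simp
      fix x assume "x \<in> ?I"
      then have "ereal x < hi S" by (simp add: dom_int_def einterval_iff)
      then have "eventually (\<lambda>n. ereal x < y n) sequentially" using order_tendstoD(1)[OF y(4)] by blast
      then have "eventually (\<lambda>n. (if x \<in> {c..u n} then G x else 0) = (if c \<le> x then G x else 0)) sequentially"
      proof eventually_elim
        case (elim n)
        then have "x < u n" unfolding u(2)[of n, symmetric] by simp
        then show ?case by simp
      qed
      then show "(\<lambda>n. if x \<in> {c..u n} then G x else 0) \<longlonglongrightarrow> (if c \<le> x then G x else 0)"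
        by (rule tendsto_eventually)
    qed
    then have "(\<lambda>n. F c + integral ?I (\<lambda>x. if x \<in> {c..u n} then G x else 0)) \<longlonglongrightarrow>
        F c + integral ?I (\<lambda>x. if c \<le> x then G x else 0)"
      by (intro tendsto_intros)
    moreover have "F c + integral ?I (\<lambda>x. if x \<in> {c..u n} then G x else 0) = F (u n)" for n
      using part(2)[OF cu c u(1)] by simp
    ultimately show "(\<lambda>n. F (real_of_ereal (y n))) \<longlonglongrightarrow> F c + integral ?I (\<lambda>x. if c \<le> x then G x else 0)"
      by (simp add: u_def)
  qed
  then show "(F \<longlongrightarrow> F c + integral ?I (\<lambda>x. if c \<le> x then G x else 0)) (end_filter S Right_End)"
    by (simp add: filterlim_filtermap)
  have "((\<lambda>y. F (real_of_ereal y)) \<longlongrightarrow> F c - integral ?I (\<lambda>x. if x \<le> c then G x else 0)) (at_right (lo S))"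
  proof (rule tendsto_at_right_sequentially[OF cb(1)])
    fix y assume y: "\<And>n. lo S < y n" "\<And>n. y n < ereal c" "decseq y" "y \<longlonglongrightarrow> lo S"
    define u where "u = (\<lambda>n. real_of_ereal (y n))"
    have u: "u n \<in> ?I" "ereal (u n) = y n" for n
      unfolding u_def using real_of_ereal_in_dom_int[of S "y n"] y(1,2)[of n] cb(2) by (auto intro: less_trans)
    have cu: "u n \<le> c" for n using y(2)[of n] unfolding u(2)[of n, symmetric] by simp
    have "(\<lambda>n. integral ?I (\<lambda>x. if x \<in> {u n..c} then G x else 0)) \<longlonglongrightarrow>
        integral ?I (\<lambda>x. if x \<le> c then G x else 0)"
    proof (rule dominated_convergence(2)[OF _ Gn])
      show "(\<lambda>x. if x \<in> {u n..c} then G x else 0) integrable_on ?I" for n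
        by (rule part(1)[OF cu u(1) c])
      show "norm (if x \<in> {u n..c} then G x else 0) \<le> cmod (G x)" for n x by simp
      fix x assume "x \<in> ?I"
      then have "lo S < ereal x" by (simp add: dom_int_def einterval_iff)
      then have "eventually (\<lambda>n. y n < ereal x) sequentially" using order_tendstoD(2)[OF y(4)] by blast
      then have "eventually (\<lambda>n. (if x \<in> {u n..c} then G x else 0) = (if x \<le> c then G x else 0)) sequentially"
      proof eventually_elim
        case (elim n)
        then have "u n < x" unfolding u(2)[of n, symmetric] by simp
        then show ?case by simp
      qed
      then show "(\<lambda>n. if x \<in> {u n..c} then G x else 0) \<longlonglongrightarrow> (if x \<le> c then G x else 0)"
        by (rule tendsto_eventually)
    qed
    then have "(\<lambda>n. F c - integral ?I (\<lambda>x. if x \<in> {u n..c} then G x else 0)) \<longlonglongrightarrow>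
        F c - integral ?I (\<lambda>x. if x \<le> c then G x else 0)"
      by (intro tendsto_intros)
    moreover have "F c - integral ?I (\<lambda>x. if x \<in> {u n..c} then G x else 0) = F (u n)" for n
      using part(2)[OF cu u(1) c] by simp
    ultimately show "(\<lambda>n. F (real_of_ereal (y n))) \<longlonglongrightarrow> F c - integral ?I (\<lambda>x. if x \<le> c then G x else 0)"
      by (simp add: u_def)
  qed
  then show "(F \<longlongrightarrow> F c - integral ?I (\<lambda>x. if x \<le> c then G x else 0)) (end_filter S Left_End)"
    by (simp add: filterlim_filtermap)
qed

lemma loc_primitive_end_limits:
  assumes lh: "lo S < hi S" and F: "loc_primitive (dom_int S) F G"
    and G: "G absolutely_integrable_on dom_int S"
  shows "\<exists>A B. (F \<longlongrightarrow> A) (end_filter S Left_End) \<and> (F \<longlongrightarrow> B) (end_filter S Right_End) \<and>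
    B - A = integral (dom_int S) G"
proof -
  let ?I = "dom_int S"
  obtain c where c: "c \<in> ?I" using einterval_nonempty[OF lh] by (auto simp: dom_int_def)
  have ai: "(\<lambda>x. if x \<in> T then G x else 0) absolutely_integrable_on ?I" if "T \<in> sets lebesgue" for T
  proof -
    have "G absolutely_integrable_on (?I \<inter> T)"
      by (rule set_integrable_subset[OF G]) (use that dom_int_sets_lebesgue in auto)
    moreover have "(\<lambda>x. indicat_real ?I x *\<^sub>R (if x \<in> T then G x else 0))
        = (\<lambda>x. indicat_real (?I \<inter> T) x *\<^sub>R G x)"
      by (auto simp: indicator_def)
    ultimately show ?thesis unfolding set_integrable_def by simp
  qed
  have 1: "(\<lambda>x. if c \<le> x then G x else 0) integrable_on ?I" "(\<lambda>x. if x \<le> c then G x else 0) integrable_on ?I"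
    using set_lebesgue_integral_eq_integral(1)[OF ai[of "{c..}"]]
      set_lebesgue_integral_eq_integral(1)[OF ai[of "{..c}"]] by simp_all
  have "integral ?I (\<lambda>x. if c \<le> x then G x else 0) + integral ?I (\<lambda>x. if x \<le> c then G x else 0)
      = integral ?I (\<lambda>x. (if c \<le> x then G x else 0) + (if x \<le> c then G x else 0))"
    by (rule Henstock_Kurzweil_Integration.integral_add[OF 1, symmetric])
  also have "\<dots> = integral ?I G"
    by (rule integral_spike[of "{c}"]) auto
  finally show ?thesis
    using loc_primitive_end_limit_aux[OF assms c]
    by (intro exI[of _ "F c - integral ?I (\<lambda>x. if x \<le> c then G x else 0)"]
        exI[of _ "F c + integral ?I (\<lambda>x. if c \<le> x then G x else 0)"]) (simp add: algebra_simps)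
qed

section \<open>The first-order system of a Sturm-Liouville equation\<close>

text \<open>The first-order system \<open>p f' = h\<close>, \<open>h' = q f - r k\<close> in integral form, so that \<open>\<tau>f = k\<close> with
  quasi-derivative \<open>h\<close>. In contrast to \<open>vector_derivative\<close>, which is unspecified where the
  derivative does not exist, this form is visibly linear.\<close>

definition sl_sys :: "sl_data \<Rightarrow> (real \<Rightarrow> complex) \<Rightarrow> (real \<Rightarrow> complex) \<Rightarrow> (real \<Rightarrow> complex) \<Rightarrow> bool" where
  "sl_sys S f h k \<longleftrightarrow> (\<forall>x. x \<notin> dom_int S \<longrightarrow> f x = 0) \<and>
     loc_primitive (dom_int S) f (\<lambda>x. h x / of_real (coef_p S x)) \<and>
     loc_primitive (dom_int S) h (\<lambda>x. of_real (coef_q S x) * f x - of_real (coef_r S x) * k x)"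

lemma AE_dom_int_iff:
  "(AE x in lebesgue_on (dom_int S). P x) \<longleftrightarrow> (\<exists>N. negligible N \<and> (\<forall>x\<in>dom_int S - N. P x))"
  by (rule AE_lebesgue_on_iff_negligible[OF dom_int_sets_lebesgue])

lemma sturm_liouville_pos_ae:
  assumes "sturm_liouville S"
  shows "\<exists>N. negligible N \<and> (\<forall>x\<in>dom_int S - N. 0 < coef_p S x \<and> 0 < coef_r S x)"
proof -
  have "AE x in lebesgue_on (dom_int S). 0 < coef_p S x" "AE x in lebesgue_on (dom_int S). 0 < coef_r S x"
    using assms by (auto simp: sturm_liouville_def)
  then have "AE x in lebesgue_on (dom_int S). 0 < coef_p S x \<and> 0 < coef_r S x"
    by (rule AE_conjI)
  then show ?thesis by (simp only: AE_dom_int_iff)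
qed

text \<open>This lemma and \<open>sl_regular_sl_sys\<close> translate between the integral form and the definitions
  of the quasi-derivative and of \<open>\<tau>\<close>.\<close>

lemma sl_sys_imp_regular:
  assumes S: "sturm_liouville S" and sys: "sl_sys S f h k"
  shows "is_quasi_deriv S f h" "sl_regular S f"
    and "\<And>x. x \<in> dom_int S \<Longrightarrow> quasi_deriv S f x = h x"
    and "AE x in lebesgue_on (dom_int S). sl_tau S f x = k x"
proof -
  let ?I = "dom_int S"
  note I = open_dom_int[of S]
  obtain N0 where N0: "negligible N0" "\<And>x. x \<in> ?I - N0 \<Longrightarrow> 0 < coef_p S x \<and> 0 < coef_r S x"
    using sturm_liouville_pos_ae[OF S] by blast
  have f: "loc_primitive ?I f (\<lambda>x. h x / of_real (coef_p S x))"
    and h: "loc_primitive ?I h (\<lambda>x. of_real (coef_q S x) * f x - of_real (coef_r S x) * k x)"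
    and van: "\<And>x. x \<notin> ?I \<Longrightarrow> f x = 0"
    using sys by (auto simp: sl_sys_def)
  let ?N1 = "{x \<in> ?I. \<not> (f has_vector_derivative h x / of_real (coef_p S x)) (at x)}"
  let ?N2 = "{x \<in> ?I. \<not> (h has_vector_derivative of_real (coef_q S x) * f x - of_real (coef_r S x) * k x) (at x)}"
  have N1: "negligible ?N1" and N2: "negligible ?N2"
    by (rule loc_primitive_has_vector_derivative_ae[OF I f], rule loc_primitive_has_vector_derivative_ae[OF I h])
  show qd: "is_quasi_deriv S f h"
    unfolding is_quasi_deriv_def AE_dom_int_iff
  proof (intro conjI exI[of _ "N0 \<union> ?N1"] ballI)
    show "AC_loc ?I h" by (rule loc_primitive_AC_loc[OF h])
    show "negligible (N0 \<union> ?N1)" using N0(1) N1 by (rule negligible_Un)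
    fix x assume x: "x \<in> ?I - (N0 \<union> ?N1)"
    then have "vector_derivative f (at x) = h x / of_real (coef_p S x)"
      by (intro vector_derivative_at) auto
    moreover have "coef_p S x \<noteq> 0" using N0(2)[of x] x by auto
    ultimately show "h x = of_real (coef_p S x) * vector_derivative f (at x)" by simp
  qed
  show "sl_regular S f"
    using qd van loc_primitive_AC_loc[OF f] by (auto simp: sl_regular_def)
  have "is_quasi_deriv S f (quasi_deriv S f)"
    unfolding quasi_deriv_def by (rule someI[of "is_quasi_deriv S f", OF qd])
  then have AC': "AC_loc ?I (quasi_deriv S f)"
    and "AE x in lebesgue_on ?I. quasi_deriv S f x = of_real (coef_p S x) * vector_derivative f (at x)"
    and "AE x in lebesgue_on ?I. h x = of_real (coef_p S x) * vector_derivative f (at x)"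
    using qd by (auto simp: is_quasi_deriv_def)
  from this(2,3) have "AE x in lebesgue_on ?I. quasi_deriv S f x = h x"
    by eventually_elim simp
  then obtain N3 where N3: "negligible N3" "\<And>x. x \<in> ?I - N3 \<Longrightarrow> quasi_deriv S f x = h x"
    unfolding AE_dom_int_iff by blast
  show eq: "quasi_deriv S f x = h x" if "x \<in> ?I" for x
    by (rule continuous_ae_eq_on_open[OF I AC_loc_continuous_on[OF I AC']
          AC_loc_continuous_on[OF I loc_primitive_AC_loc[OF h]] N3 that])
  show "AE x in lebesgue_on ?I. sl_tau S f x = k x"
    unfolding AE_dom_int_iff
  proof (intro exI[of _ "N0 \<union> ?N2"] conjI ballI)
    show "negligible (N0 \<union> ?N2)" using N0(1) N2 by (rule negligible_Un)
    fix x assume x: "x \<in> ?I - (N0 \<union> ?N2)"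
    then have "(h has_vector_derivative of_real (coef_q S x) * f x - of_real (coef_r S x) * k x) (at x)"
      by auto
    then have "(quasi_deriv S f has_vector_derivative of_real (coef_q S x) * f x - of_real (coef_r S x) * k x) (at x)"
      by (rule has_vector_derivative_transform_within_open[OF _ I]) (use x eq in auto)
    then have "vector_derivative (quasi_deriv S f) (at x) = of_real (coef_q S x) * f x - of_real (coef_r S x) * k x"
      by (rule vector_derivative_at)
    moreover have "coef_r S x \<noteq> 0" using N0(2)[of x] x by auto
    ultimately show "sl_tau S f x = k x" unfolding sl_tau_def by simp
  qed
qed

lemma sl_regular_sl_sys:
  assumes S: "sturm_liouville S" and f: "sl_regular S f"
  shows "sl_sys S f (quasi_deriv S f) (sl_tau S f)"
proof -
  let ?I = "dom_int S"
  obtain N0 where N0: "negligible N0" "\<And>x. x \<in> ?I - N0 \<Longrightarrow> 0 < coef_p S x \<and> 0 < coef_r S x"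
    using sturm_liouville_pos_ae[OF S] by blast
  have "\<exists>h. is_quasi_deriv S f h" and AC: "AC_loc ?I f" and van: "\<And>x. x \<notin> ?I \<Longrightarrow> f x = 0"
    using f by (auto simp: sl_regular_def)
  from this(1) have qd: "is_quasi_deriv S f (quasi_deriv S f)"
    unfolding quasi_deriv_def by (rule someI_ex[of "is_quasi_deriv S f"])
  then obtain N1 where N1: "negligible N1"
    "\<And>x. x \<in> ?I - N1 \<Longrightarrow> quasi_deriv S f x = of_real (coef_p S x) * vector_derivative f (at x)"
    unfolding is_quasi_deriv_def AE_dom_int_iff by blast
  have "loc_primitive ?I f (\<lambda>x. quasi_deriv S f x / of_real (coef_p S x))"
  proof (rule loc_primitive_spike[OF AC_loc_loc_primitive[OF AC]])
    show "negligible (N0 \<union> N1)" using N0(1) N1(1) by (rule negligible_Un)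
    fix x assume "x \<in> ?I - (N0 \<union> N1)"
    then show "quasi_deriv S f x / of_real (coef_p S x) = vector_derivative f (at x)"
      using N0(2)[of x] N1(2)[of x] by simp
  qed
  moreover have "loc_primitive ?I (quasi_deriv S f)
      (\<lambda>x. of_real (coef_q S x) * f x - of_real (coef_r S x) * sl_tau S f x)"
  proof (rule loc_primitive_spike[OF AC_loc_loc_primitive N0(1)])
    show "AC_loc ?I (quasi_deriv S f)" using qd by (simp add: is_quasi_deriv_def)
    fix x assume "x \<in> ?I - N0"
    then show "of_real (coef_q S x) * f x - of_real (coef_r S x) * sl_tau S f x
        = vector_derivative (quasi_deriv S f) (at x)"
      using N0(2)[of x] by (simp add: sl_tau_def)
  qed
  ultimately show ?thesis using van by (simp add: sl_sys_def)
qed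

lemma sl_sys_add:
  assumes "sl_sys S f h k" "sl_sys S f' h' k'"
  shows "sl_sys S (\<lambda>x. f x + f' x) (\<lambda>x. h x + h' x) (\<lambda>x. k x + k' x)"
proof -
  have 1: "loc_primitive (dom_int S) (\<lambda>x. f x + f' x)
      (\<lambda>x. h x / of_real (coef_p S x) + h' x / of_real (coef_p S x))"
    by (rule loc_primitive_add) (use assms in \<open>simp_all add: sl_sys_def\<close>)
  have 2: "loc_primitive (dom_int S) (\<lambda>x. h x + h' x)
      (\<lambda>x. (of_real (coef_q S x) * f x - of_real (coef_r S x) * k x) +
            (of_real (coef_q S x) * f' x - of_real (coef_r S x) * k' x))"
    by (rule loc_primitive_add) (use assms in \<open>simp_all add: sl_sys_def\<close>)
  have 3: "\<forall>x. x \<notin> dom_int S \<longrightarrow> f x + f' x = 0"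
    using assms by (simp add: sl_sys_def)
  show ?thesis
    unfolding sl_sys_def
    by (rule conjI[OF 3 conjI [OF loc_primitive_cong[OF 1] loc_primitive_cong[OF 2]]])
      (simp_all add: add_divide_distrib right_diff_distrib distrib_left)
qed

lemma sl_sys_scale:
  assumes "sl_sys S f h k"
  shows "sl_sys S (\<lambda>x. c * f x) (\<lambda>x. c * h x) (\<lambda>x. c * k x)"
proof -
  have 1: "loc_primitive (dom_int S) (\<lambda>x. c * f x) (\<lambda>x. c * (h x / of_real (coef_p S x)))"
    by (rule loc_primitive_linear[OF _ bounded_linear_mult_right]) (use assms in \<open>simp add: sl_sys_def\<close>)
  have 2: "loc_primitive (dom_int S) (\<lambda>x. c * h x)
      (\<lambda>x. c * (of_real (coef_q S x) * f x - of_real (coef_r S x) * k x))"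
    by (rule loc_primitive_linear[OF _ bounded_linear_mult_right]) (use assms in \<open>simp add: sl_sys_def\<close>)
  have 3: "\<forall>x. x \<notin> dom_int S \<longrightarrow> c * f x = 0"
    using assms by (simp add: sl_sys_def)
  show ?thesis
    unfolding sl_sys_def
    by (rule conjI[OF 3 conjI [OF loc_primitive_cong[OF 1] loc_primitive_cong[OF 2]]])
      (simp_all add: add_divide_distrib right_diff_distrib distrib_left)
qed

lemma sl_sys_cnj:
  assumes "sl_sys S f h k"
  shows "sl_sys S (\<lambda>x. cnj (f x)) (\<lambda>x. cnj (h x)) (\<lambda>x. cnj (k x))"
proof -
  have 1: "loc_primitive (dom_int S) (\<lambda>x. cnj (f x)) (\<lambda>x. cnj (h x / of_real (coef_p S x)))"
    by (rule loc_primitive_linear[OF _ bounded_linear_cnj]) (use assms in \<open>simp add: sl_sys_def\<close>)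
  have 2: "loc_primitive (dom_int S) (\<lambda>x. cnj (h x))
      (\<lambda>x. cnj (of_real (coef_q S x) * f x - of_real (coef_r S x) * k x))"
    by (rule loc_primitive_linear[OF _ bounded_linear_cnj]) (use assms in \<open>simp add: sl_sys_def\<close>)
  have 3: "\<forall>x. x \<notin> dom_int S \<longrightarrow> cnj (f x) = 0"
    using assms by (simp add: sl_sys_def)
  show ?thesis
    unfolding sl_sys_def
    by (rule conjI[OF 3 conjI [OF loc_primitive_cong[OF 1] loc_primitive_cong[OF 2]]])
      (simp_all add: add_divide_distrib right_diff_distrib distrib_left)
qed

text \<open>Lagrange's identity.\<close>

lemma sl_sys_wronskian:
  assumes "sl_sys S f h k" "sl_sys S f' h' k'"
  shows "loc_primitive (dom_int S) (\<lambda>x. f x * h' x - h x * f' x)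
           (\<lambda>x. of_real (coef_r S x) * (k x * f' x - f x * k' x))"
proof -
  note sys = assms[unfolded sl_sys_def]
  have 1: "loc_primitive (dom_int S) (\<lambda>x. f x * h' x)
     (\<lambda>x. f x * (of_real (coef_q S x) * f' x - of_real (coef_r S x) * k' x) + h x / of_real (coef_p S x) * h' x)"
    by (rule loc_primitive_mult[OF open_dom_int]) (use sys in blast)+
  have "loc_primitive (dom_int S) (\<lambda>x. h x * f' x)
     (\<lambda>x. h x * (h' x / of_real (coef_p S x)) + (of_real (coef_q S x) * f x - of_real (coef_r S x) * k x) * f' x)"
    by (rule loc_primitive_mult[OF open_dom_int]) (use sys in blast)+
  from loc_primitive_add[OF 1 loc_primitive_linear[OF this bounded_linear_minus[OF bounded_linear_ident]]]
  show ?thesis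
    by (rule loc_primitive_cong) (simp_all add: algebra_simps)
qed

section \<open>Linear Volterra systems\<close>

text \<open>Complex-valued version of \<open>L1_loc\<close>, for intervals.\<close>

definition loc_abs_integrable :: "real set \<Rightarrow> (real \<Rightarrow> complex) \<Rightarrow> bool" where
  "loc_abs_integrable I g \<longleftrightarrow> (\<forall>c d. c \<le> d \<and> {c..d} \<subseteq> I \<longrightarrow> g absolutely_integrable_on {c..d})"

text \<open>The primitive of \<open>g\<close> that vanishes at \<open>c\<close>, on both sides of \<open>c\<close>.\<close>

definition prim :: "real \<Rightarrow> (real \<Rightarrow> complex) \<Rightarrow> real \<Rightarrow> complex" where
  "prim c g x = (if c \<le> x then integral {c..x} g else - integral {x..c} g)"

lemma prim_base [simp]: "prim c g c = 0"
  by (simp add: prim_def)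

lemma loc_primitive_prim:
  assumes I: "\<And>c d. \<lbrakk>c \<in> I; d \<in> I\<rbrakk> \<Longrightarrow> {c..d} \<subseteq> I" and c: "c \<in> I"
    and g: "loc_abs_integrable I g"
  shows "loc_primitive I (prim c g) g"
  unfolding loc_primitive_def
proof (intro allI impI, elim conjE, intro conjI)
  fix x y assume xy: "x \<le> y" "{x..y} \<subseteq> I"
  then have xyI: "x \<in> I" "y \<in> I" by auto
  have int: "g integrable_on {u..v}" if "u \<in> I" "v \<in> I" for u v
  proof (cases "u \<le> v")
    case True
    then have "g absolutely_integrable_on {u..v}"
      using g I[OF that] by (simp add: loc_abs_integrable_def)
    then show ?thesis by (rule set_lebesgue_integral_eq_integral(1))
  next
    case False
    then have "{u..v} = {}" by simp
    then show ?thesis by (simp only: integrable_on_empty)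
  qed
  show "g absolutely_integrable_on {x..y}" using g xy by (simp add: loc_abs_integrable_def)
  have "prim c g y - prim c g x = integral {x..y} g"
  proof -
    consider "c \<le> x" | "x < c" "c \<le> y" | "y < c" by linarith
    then show ?thesis
    proof cases
      case 1
      have "integral {c..x} g + integral {x..y} g = integral {c..y} g"
        by (rule Henstock_Kurzweil_Integration.integral_combine[OF 1 xy(1) int[OF c xyI(2)]])
      then show ?thesis using 1 xy by (simp add: prim_def algebra_simps)
    next
      case 2
      have "integral {x..c} g + integral {c..y} g = integral {x..y} g"
        by (rule Henstock_Kurzweil_Integration.integral_combine) (use 2 int[OF xyI] in auto)
      then show ?thesis using 2 xy by (simp add: prim_def algebra_simps)
    next
      case 3
      have "integral {x..y} g + integral {y..c} g = integral {x..c} g"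
        by (rule Henstock_Kurzweil_Integration.integral_combine) (use 3 xy int[OF xyI(1) c] in auto)
      then show ?thesis using 3 xy by (simp add: prim_def algebra_simps)
    qed
  qed
  then show "(g has_integral prim c g y - prim c g x) {x..y}"
    using integrable_integral[OF int[OF xyI]] by simp
qed

lemma absolutely_integrable_mult_continuous:
  fixes g F :: "real \<Rightarrow> complex"
  assumes g: "g absolutely_integrable_on {c..d}" and F: "continuous_on {c..d} F"
  shows "(\<lambda>x. g x * F x) absolutely_integrable_on {c..d}"
proof -
  have "(\<lambda>x. F x * g x) absolutely_integrable_on {c..d}"
  proof (rule absolutely_integrable_bounded_measurable_product[OF bilinear_times _ _ _ g])
    show "F \<in> borel_measurable (lebesgue_on {c..d})"
      by (rule continuous_imp_measurable_on_sets_lebesgue[OF F]) simp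
    show "bounded (F ` {c..d})"
      by (intro compact_imp_bounded compact_continuous_image F compact_Icc)
  qed simp
  then show ?thesis by (simp add: mult.commute)
qed

lemma loc_primitive_power:
  assumes I: "open I" and A: "loc_primitive I A a"
  shows "loc_primitive I (\<lambda>x. A x ^ Suc n) (\<lambda>x. of_nat (Suc n) * A x ^ n * a x)"
proof (induction n)
  case 0
  then show ?case using A by simp
next
  case (Suc n)
  show ?case
    by (rule loc_primitive_cong[OF loc_primitive_mult[OF I A Suc]]) (simp_all add: algebra_simps)
qed

lemma has_integral_power_primitive:
  fixes A a :: "real \<Rightarrow> real"
  assumes I: "open I" and A: "loc_primitive I (\<lambda>x. of_real (A x)) (\<lambda>x. of_real (a x))"
    and cd: "c \<le> d" "{c..d} \<subseteq> I"
  shows "((\<lambda>x. A x ^ n * a x) has_integral (A d ^ Suc n - A c ^ Suc n) / real (Suc n)) {c..d}"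
proof -
  have "((\<lambda>x. Re (of_nat (Suc n) * of_real (A x) ^ n * of_real (a x))) has_integral
      Re (of_real (A d) ^ Suc n - of_real (A c) ^ Suc n)) {c..d}"
    using has_integral_linear[OF loc_primitiveD(2)[OF loc_primitive_power[OF I A] cd] bounded_linear_Re]
    by (simp only: comp_def)
  moreover have "Re (of_nat (Suc n) * of_real (A x) ^ n * of_real (a x)) = real (Suc n) * (A x ^ n * a x)" for x
  proof -
    have "of_nat (Suc n) * of_real (A x) ^ n * of_real (a x) = (of_real (real (Suc n) * (A x ^ n * a x)) :: complex)"
      by simp
    then show ?thesis by (simp only: Re_complex_of_real)
  qed
  moreover have "Re (of_real (A d) ^ Suc n - of_real (A c) ^ Suc n) = A d ^ Suc n - A c ^ Suc n"
    by (simp only: Re_complex_of_real flip: of_real_power of_real_diff)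
  ultimately have "((\<lambda>x. real (Suc n) * (A x ^ n * a x)) has_integral (A d ^ Suc n - A c ^ Suc n)) {c..d}"
    by (simp only:)
  from has_integral_mult_right[OF this, of "1 / real (Suc n)"] show ?thesis by simp
qed

text \<open>One Picard iteration. Here \<open>A\<close> is the primitive of the bound \<open>a\<close> that vanishes at \<open>c\<close>; the gain of
  one power and of the factor \<open>n + 1\<close> comes from integrating \<open>A\<^sup>n A'\<close>.\<close>

lemma volterra_step:
  fixes A a :: "real \<Rightarrow> real" and g G :: "real \<Rightarrow> complex"
  assumes I: "open I" and A: "loc_primitive I (\<lambda>x. of_real (A x)) (\<lambda>x. of_real (a x))"
    and a: "\<And>x. 0 \<le> a x" and A0: "A c = 0"
    and J: "c \<in> {c1..c2}" "{c1..c2} \<subseteq> I" and ga: "\<And>x. cmod (g x) \<le> a x"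
    and G: "\<And>x. x \<in> {c1..c2} \<Longrightarrow> cmod (G x) \<le> C * \<bar>A x\<bar> ^ n / fact n"
    and gG: "loc_abs_integrable I (\<lambda>x. g x * G x)" and x: "x \<in> {c1..c2}"
  shows "cmod (prim c (\<lambda>t. g t * G t) x) \<le> C * \<bar>A x\<bar> ^ Suc n / fact (Suc n)"
proof -
  have mono: "A u \<le> A v" if "u \<le> v" "u \<in> {c1..c2}" "v \<in> {c1..c2}" for u v
  proof -
    have sub: "{u..v} \<subseteq> I" using that J by auto
    have "((\<lambda>x. a x) has_integral (A v - A u)) {u..v}"
      using has_integral_power_primitive[OF I A that(1) sub, of 0] by simp
    then have "0 \<le> A v - A u" by (rule has_integral_nonneg) (rule a)
    then show ?thesis by simp
  qed
  have bnd: "cmod (integral {u..v} (\<lambda>t. g t * G t)) \<le> integral {u..v} (\<lambda>t. C / fact n * (\<bar>A t\<bar> ^ n * a t))"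
    if "u \<le> v" "{u..v} \<subseteq> {c1..c2}" "(\<lambda>t. \<bar>A t\<bar> ^ n * a t) integrable_on {u..v}" for u v
  proof (rule integral_norm_bound_integral)
    have "(\<lambda>t. g t * G t) absolutely_integrable_on {u..v}"
      using gG that(1) order_trans[OF that(2) J(2)] by (simp add: loc_abs_integrable_def)
    then show "(\<lambda>t. g t * G t) integrable_on {u..v}" by (rule set_lebesgue_integral_eq_integral(1))
    show "(\<lambda>t. C / fact n * (\<bar>A t\<bar> ^ n * a t)) integrable_on {u..v}"
      using has_integral_mult_right[OF integrable_integral[OF that(3)]] by blast
    fix t assume "t \<in> {u..v}"
    then have t: "t \<in> {c1..c2}" using that by auto
    have "cmod (g t * G t) \<le> a t * (C * \<bar>A t\<bar> ^ n / fact n)"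
      unfolding norm_mult by (rule mult_mono[OF ga G[OF t] a norm_ge_zero])
    then show "cmod (g t * G t) \<le> C / fact n * (\<bar>A t\<bar> ^ n * a t)" by (simp add: mult_ac)
  qed
  have fin: "C / fact n * (\<bar>A x\<bar> ^ Suc n / real (Suc n)) = C * \<bar>A x\<bar> ^ Suc n / fact (Suc n)"
    by (simp add: field_simps)
  show ?thesis
  proof (cases "c \<le> x")
    case True
    have sub: "{c..x} \<subseteq> {c1..c2}" using J x by auto
    have Ap: "0 \<le> A t" if "t \<in> {c..x}" for t using mono[of c t] that sub J A0 by auto
    have hi: "((\<lambda>t. \<bar>A t\<bar> ^ n * a t) has_integral \<bar>A x\<bar> ^ Suc n / real (Suc n)) {c..x}"
      using has_integral_power_primitive[OF I A True order_trans[OF sub J(2)], of n] Ap[of x] True A0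
      by (subst has_integral_cong[of _ _ "\<lambda>t. A t ^ n * a t"]) (use Ap in auto)
    have "cmod (prim c (\<lambda>t. g t * G t) x) \<le> integral {c..x} (\<lambda>t. C / fact n * (\<bar>A t\<bar> ^ n * a t))"
      using bnd[OF True sub has_integral_integrable[OF hi]] True by (simp add: prim_def)
    also have "\<dots> = C / fact n * (\<bar>A x\<bar> ^ Suc n / real (Suc n))"
      by (rule integral_unique[OF has_integral_mult_right[OF hi]])
    finally show ?thesis by (simp only: fin)
  next
    case False
    then have xc: "x \<le> c" by simp
    have sub: "{x..c} \<subseteq> {c1..c2}" using J x by auto
    have An: "A t \<le> 0" if "t \<in> {x..c}" for t using mono[of t c] that sub J A0 by auto
    have "loc_primitive I (\<lambda>x. of_real (- A x)) (\<lambda>x. of_real (- a x))"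
      using loc_primitive_linear[OF A bounded_linear_minus[OF bounded_linear_ident]] by simp
    from has_integral_power_primitive[OF I this xc order_trans[OF sub J(2)], of n]
    have "((\<lambda>t. (- A t) ^ n * - a t) has_integral - ((- A x) ^ Suc n / real (Suc n))) {x..c}"
      using A0 by simp
    from has_integral_neg[OF this]
    have "((\<lambda>t. (- A t) ^ n * a t) has_integral (- A x) ^ Suc n / real (Suc n)) {x..c}" by simp
    moreover have "- A t = \<bar>A t\<bar>" if "t \<in> {x..c}" for t using An[OF that] by simp
    ultimately have hi: "((\<lambda>t. \<bar>A t\<bar> ^ n * a t) has_integral \<bar>A x\<bar> ^ Suc n / real (Suc n)) {x..c}"
      using xc by (subst has_integral_cong[of _ _ "\<lambda>t. (- A t) ^ n * a t"]) auto
    have "cmod (prim c (\<lambda>t. g t * G t) x) \<le> integral {x..c} (\<lambda>t. C / fact n * (\<bar>A t\<bar> ^ n * a t))"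
      using bnd[OF xc sub has_integral_integrable[OF hi]] False by (simp add: prim_def)
    also have "\<dots> = C / fact n * (\<bar>A x\<bar> ^ Suc n / real (Suc n))"
      by (rule integral_unique[OF has_integral_mult_right[OF hi]])
    finally show ?thesis by (simp only: fin)
  qed
qed

text \<open>Existence for a linear system with locally integrable coefficients, on the whole interval. The
  Picard iterates are dominated by an exponential series on every compact subinterval.\<close>

theorem volterra_system_exists:
  fixes g m l :: "real \<Rightarrow> complex"
  assumes I: "open I" "\<And>c d. \<lbrakk>c \<in> I; d \<in> I\<rbrakk> \<Longrightarrow> {c..d} \<subseteq> I" and c: "c \<in> I"
    and g: "loc_abs_integrable I g" and m: "loc_abs_integrable I m" and l: "loc_abs_integrable I l"
  shows "\<exists>u w. u c = u0 \<and> w c = w0 \<and> loc_primitive I u (\<lambda>x. g x * w x) \<and>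
    loc_primitive I w (\<lambda>x. m x * u x + l x)"
proof -
  \<comment> \<open>only the zeroth iterate carries the initial values and the forcing term, so the solution is the sum of all iterates\<close>
  define Y where "Y = rec_nat ((\<lambda>x::real. u0), (\<lambda>x. w0 + prim c l x))
    (\<lambda>_ (U, W). (prim c (\<lambda>t. g t * W t), prim c (\<lambda>t. m t * U t)))"
  define U where "U = (\<lambda>n. fst (Y n))"
  define W where "W = (\<lambda>n. snd (Y n))"
  have U0: "U 0 = (\<lambda>x. u0)" and W0: "W 0 = (\<lambda>x. w0 + prim c l x)"
    and US: "\<And>n. U (Suc n) = prim c (\<lambda>t. g t * W n t)" and WS: "\<And>n. W (Suc n) = prim c (\<lambda>t. m t * U n t)"
    by (simp_all add: U_def W_def Y_def case_prod_unfold)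
  have prim: "loc_primitive I (prim c f) f" if "loc_abs_integrable I f" for f
    by (rule loc_primitive_prim[OF I(2) c that])
  have cont: "continuous_on I F" if "loc_primitive I F G" for F G
    by (rule AC_loc_continuous_on[OF I(1) loc_primitive_AC_loc[OF that]])
  have mult: "loc_abs_integrable I (\<lambda>x. f x * F x)" if "loc_abs_integrable I f" "continuous_on I F" for f F
    unfolding loc_abs_integrable_def
  proof (intro allI impI, elim conjE)
    fix a b :: real assume ab: "a \<le> b" "{a..b} \<subseteq> I"
    show "(\<lambda>x. f x * F x) absolutely_integrable_on {a..b}"
      using that(1) ab by (intro absolutely_integrable_mult_continuous continuous_on_subset[OF that(2)])
        (simp_all add: loc_abs_integrable_def)
  qed
  have UW: "continuous_on I (U n)" "continuous_on I (W n)" for n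
  proof (induction n)
    case 0
    show "continuous_on I (U 0)" by (simp add: U0)
    show "continuous_on I (W 0)" unfolding W0 by (intro continuous_on_add continuous_on_const cont[OF prim[OF l]])
  next
    case (Suc n)
    show "continuous_on I (U (Suc n))" unfolding US by (rule cont[OF prim[OF mult[OF g Suc(2)]]])
    show "continuous_on I (W (Suc n))" unfolding WS by (rule cont[OF prim[OF mult[OF m Suc(1)]]])
  qed
  define a where "a = (\<lambda>x. cmod (g x) + cmod (m x))"
  have a0: "0 \<le> a x" "cmod (g x) \<le> a x" "cmod (m x) \<le> a x" for x by (simp_all add: a_def)
  have ac: "loc_abs_integrable I (\<lambda>x. of_real (a x))"
    unfolding loc_abs_integrable_def
  proof (intro allI impI, elim conjE)
    fix s t :: real assume st: "s \<le> t" "{s..t} \<subseteq> I"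
    then have "g absolutely_integrable_on {s..t}" "m absolutely_integrable_on {s..t}"
      using g m by (simp_all add: loc_abs_integrable_def)
    from set_integral_add(1)[OF this[THEN absolutely_integrable_norm]]
    have "a absolutely_integrable_on {s..t}" by (simp add: a_def comp_def)
    from absolutely_integrable_linear[OF this bounded_linear_of_real]
    show "(\<lambda>x. complex_of_real (a x)) absolutely_integrable_on {s..t}" by (simp add: comp_def)
  qed
  define A where "A = (\<lambda>x. Re (prim c (\<lambda>x. of_real (a x)) x))"
  have "bounded_linear (\<lambda>z. complex_of_real (Re z))"
    by (rule bounded_linear_compose[OF bounded_linear_of_real bounded_linear_Re])
  from loc_primitive_linear[OF prim[OF ac] this]
  have A: "loc_primitive I (\<lambda>x. of_real (A x)) (\<lambda>x. of_real (a x))" and A0: "A c = 0"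
    by (simp_all add: A_def)
  have bound: "\<exists>C M. 0 \<le> C \<and> 0 \<le> M \<and> (\<forall>n. \<forall>x\<in>{c1..c2}. cmod (U n x) \<le> C * M ^ n / fact n \<and> cmod (W n x) \<le> C * M ^ n / fact n)"
    if J: "c \<in> {c1..c2}" "{c1..c2} \<subseteq> I" for c1 c2
  proof -
    have bdd: "\<exists>B. \<forall>x\<in>{c1..c2}. cmod (F x) \<le> B" if "continuous_on I F" for F
    proof -
      have "bounded (F ` {c1..c2})"
        by (intro compact_imp_bounded compact_continuous_image continuous_on_subset[OF that J(2)] compact_Icc)
      then show ?thesis unfolding bounded_iff by blast
    qed
    obtain B where B: "\<forall>x\<in>{c1..c2}. cmod (W 0 x) \<le> B" using bdd[OF UW(2)] by blast
    obtain M where M: "\<forall>x\<in>{c1..c2}. cmod (of_real (A x)) \<le> M" using bdd[OF cont[OF A]] by blast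
    define C where "C = max (cmod u0) B"
    have C: "0 \<le> C" by (simp add: C_def le_max_iff_disj)
    have M0: "0 \<le> M" using M J(1) A0 by force
    have *: "\<forall>x\<in>{c1..c2}. cmod (U n x) \<le> C * \<bar>A x\<bar> ^ n / fact n \<and> cmod (W n x) \<le> C * \<bar>A x\<bar> ^ n / fact n"
      for n
    proof (induction n)
      case 0
      show ?case using B by (auto simp: U0 C_def le_max_iff_disj)
    next
      case (Suc n)
      then have IH: "\<And>x. x \<in> {c1..c2} \<Longrightarrow> cmod (U n x) \<le> C * \<bar>A x\<bar> ^ n / fact n"
        "\<And>x. x \<in> {c1..c2} \<Longrightarrow> cmod (W n x) \<le> C * \<bar>A x\<bar> ^ n / fact n" by simp_all
      show ?case
      proof (intro ballI conjI)
        fix x assume x: "x \<in> {c1..c2}"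
        show "cmod (U (Suc n) x) \<le> C * \<bar>A x\<bar> ^ Suc n / fact (Suc n)"
          unfolding US by (rule volterra_step[OF I(1) A a0(1) A0 J a0(2) IH(2) mult[OF g UW(2)] x])
        show "cmod (W (Suc n) x) \<le> C * \<bar>A x\<bar> ^ Suc n / fact (Suc n)"
          unfolding WS by (rule volterra_step[OF I(1) A a0(1) A0 J a0(3) IH(1) mult[OF m UW(1)] x])
      qed
    qed
    have "C * \<bar>A x\<bar> ^ n / fact n \<le> C * M ^ n / fact n" if "x \<in> {c1..c2}" for x n
      using M that C by (intro divide_right_mono mult_left_mono power_mono) simp_all
    then have "\<forall>n. \<forall>x\<in>{c1..c2}. cmod (U n x) \<le> C * M ^ n / fact n \<and> cmod (W n x) \<le> C * M ^ n / fact n"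
      using order_trans[OF conjunct1[OF bspec[OF *]]] order_trans[OF conjunct2[OF bspec[OF *]]] by simp
    then show ?thesis using C M0 by (intro exI[of _ C] exI[of _ M] conjI)
  qed
  define u where "u = (\<lambda>x. \<Sum>n. U n x)"
  define w where "w = (\<lambda>x. \<Sum>n. W n x)"
  have summ: "summable (\<lambda>n. C * M ^ n / fact n)" for C M :: real
    using summable_mult[OF summable_exp[of M], of C] by (simp add: field_simps)
  have limit: "loc_primitive I f (\<lambda>x. h x * F x + k x)"
    if h: "loc_abs_integrable I h" and k: "loc_abs_integrable I k"
      and V: "\<And>n. continuous_on I (V n)"
      and VF: "\<And>x. x \<in> I \<Longrightarrow> (\<lambda>n. V n x) \<longlonglongrightarrow> F x"
      and fn: "\<And>n. loc_primitive I (fn n) (\<lambda>x. h x * V n x + k x)"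
      and ff: "\<And>x. x \<in> I \<Longrightarrow> (\<lambda>n. fn n x) \<longlonglongrightarrow> f x"
      and bd: "\<And>c1 c2. \<lbrakk>c1 \<le> c2; {c1..c2} \<subseteq> I\<rbrakk> \<Longrightarrow> \<exists>B. \<forall>n. \<forall>x\<in>{c1..c2}. cmod (V n x) \<le> B"
    for f F h k V fn
    unfolding loc_primitive_def
  proof (intro allI impI, elim conjE)
    fix s t :: real assume st: "s \<le> t" "{s..t} \<subseteq> I"
    have stI: "s \<in> I" "t \<in> I" using st by auto
    obtain B where B: "\<And>n x. x \<in> {s..t} \<Longrightarrow> cmod (V n x) \<le> B" using bd[OF st] by blast
    have h': "h absolutely_integrable_on {s..t}" and k': "k absolutely_integrable_on {s..t}"
      using h k st by (simp_all add: loc_abs_integrable_def)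
    define D where "D = (\<lambda>x. cmod (h x) * B + cmod (k x))"
    have "(\<lambda>x. cmod (h x) * B) absolutely_integrable_on {s..t}"
      using set_integrable_mult_left[of B, OF absolutely_integrable_norm[OF h']] by (simp add: comp_def)
    from set_integral_add(1)[OF this absolutely_integrable_norm[OF k', unfolded comp_def]]
    have D: "D integrable_on {s..t}"
      unfolding D_def by (rule set_lebesgue_integral_eq_integral(1))
    have abs: "(\<lambda>x. h x * V n x + k x) absolutely_integrable_on {s..t}" for n
      by (rule loc_primitiveD(1)[OF fn st])
    have dom: "norm (h x * V n x + k x) \<le> D x" if "x \<in> {s..t}" for n x
    proof -
      have "norm (h x * V n x + k x) \<le> cmod (h x) * cmod (V n x) + cmod (k x)"
        using norm_triangle_ineq[of "h x * V n x" "k x"] by (simp add: norm_mult)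
      also have "\<dots> \<le> D x" unfolding D_def using B[OF that] by (intro add_mono mult_left_mono) simp_all
      finally show ?thesis .
    qed
    have lim: "(\<lambda>n. h x * V n x + k x) \<longlonglongrightarrow> h x * F x + k x" if "x \<in> {s..t}" for x
      using that st by (intro tendsto_intros VF) auto
    have dom': "norm (h x * F x + k x) \<le> D x" if "x \<in> {s..t}" for x
      by (rule LIMSEQ_le_const2[OF tendsto_norm[OF lim[OF that]]]) (use dom[OF that] in blast)
    have int: "(\<lambda>x. h x * V n x + k x) integrable_on {s..t}" for n
      by (rule set_lebesgue_integral_eq_integral(1)[OF abs])
    have 1: "(\<lambda>x. h x * F x + k x) absolutely_integrable_on {s..t}"
      by (rule dominated_convergence_absolutely_integrable[OF abs D dom' lim])
    have "(\<lambda>n. integral {s..t} (\<lambda>x. h x * V n x + k x)) \<longlonglongrightarrow> integral {s..t} (\<lambda>x. h x * F x + k x)"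
      by (rule dominated_convergence(2)[OF int D dom lim])
    moreover have "integral {s..t} (\<lambda>x. h x * V n x + k x) = fn n t - fn n s" for n
      by (rule loc_primitiveD(3)[OF fn st])
    ultimately have "(\<lambda>n. fn n t - fn n s) \<longlonglongrightarrow> integral {s..t} (\<lambda>x. h x * F x + k x)" by simp
    moreover have "(\<lambda>n. fn n t - fn n s) \<longlonglongrightarrow> f t - f s" by (intro tendsto_diff ff stI)
    ultimately have "integral {s..t} (\<lambda>x. h x * F x + k x) = f t - f s" by (rule LIMSEQ_unique)
    with integrable_integral[OF set_lebesgue_integral_eq_integral(1)[OF 1]]
    have "((\<lambda>x. h x * F x + k x) has_integral (f t - f s)) {s..t}" by simp
    with 1 show "(\<lambda>x. h x * F x + k x) absolutely_integrable_on {s..t} \<and>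
        ((\<lambda>x. h x * F x + k x) has_integral (f t - f s)) {s..t}" by (rule conjI)
  qed
  have big: "\<exists>C M. 0 \<le> C \<and> 0 \<le> M \<and> (\<forall>n. \<forall>x\<in>{c1..c2}. cmod (U n x) \<le> C * M ^ n / fact n \<and> cmod (W n x) \<le> C * M ^ n / fact n)"
    if "c1 \<le> c2" "{c1..c2} \<subseteq> I" for c1 c2
  proof -
    have "c1 \<in> I" "c2 \<in> I" using that by auto
    then have "min c1 c \<in> I" "max c2 c \<in> I" using c by (auto simp: min_def max_def)
    then have "{min c1 c..max c2 c} \<subseteq> I" by (rule I(2))
    from bound[OF _ this] obtain C M where "0 \<le> C" "0 \<le> M"
      "\<forall>n. \<forall>x\<in>{min c1 c..max c2 c}. cmod (U n x) \<le> C * M ^ n / fact n \<and> cmod (W n x) \<le> C * M ^ n / fact n"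
      by auto
    moreover have "{c1..c2} \<subseteq> {min c1 c..max c2 c}" by auto
    ultimately show ?thesis by (intro exI[of _ C] exI[of _ M]) blast
  qed
  have sums: "(\<lambda>N. \<Sum>n<N. U n x) \<longlonglongrightarrow> u x" "(\<lambda>N. \<Sum>n<N. W n x) \<longlonglongrightarrow> w x" if xI: "x \<in> I" for x
  proof -
    obtain C M where CM: "\<And>n. cmod (U n x) \<le> C * M ^ n / fact n" "\<And>n. cmod (W n x) \<le> C * M ^ n / fact n"
      using big[of x x] xI by auto
    have "summable (\<lambda>n. U n x)" by (rule summable_comparison_test'[OF summ, of 0]) (rule CM(1))
    then show "(\<lambda>N. \<Sum>n<N. U n x) \<longlonglongrightarrow> u x" unfolding u_def by (rule summable_LIMSEQ)
    have "summable (\<lambda>n. W n x)" by (rule summable_comparison_test'[OF summ, of 0]) (rule CM(2))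
    then show "(\<lambda>N. \<Sum>n<N. W n x) \<longlonglongrightarrow> w x" unfolding w_def by (rule summable_LIMSEQ)
  qed
  have sumbd: "\<exists>B. \<forall>N. \<forall>x\<in>{c1..c2}. cmod (\<Sum>n<N. U n x) \<le> B \<and> cmod (\<Sum>n<N. W n x) \<le> B"
    if cc: "c1 \<le> c2" "{c1..c2} \<subseteq> I" for c1 c2
  proof -
    obtain C M where CM: "0 \<le> C" "0 \<le> M" "\<And>n x. x \<in> {c1..c2} \<Longrightarrow> cmod (U n x) \<le> C * M ^ n / fact n"
      "\<And>n x. x \<in> {c1..c2} \<Longrightarrow> cmod (W n x) \<le> C * M ^ n / fact n"
      using big[OF cc] by blast
    have "(\<Sum>n<N. C * M ^ n / fact n) \<le> (\<Sum>n. C * M ^ n / fact n)" for N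
      by (rule sum_le_suminf[OF summ]) (use CM(1,2) in auto)
    moreover have "cmod (\<Sum>n<N. U n x) \<le> (\<Sum>n<N. C * M ^ n / fact n)"
      "cmod (\<Sum>n<N. W n x) \<le> (\<Sum>n<N. C * M ^ n / fact n)" if "x \<in> {c1..c2}" for N x
      using CM(3,4)[OF that] by (auto intro!: sum_norm_le)
    ultimately have "cmod (\<Sum>n<N. U n x) \<le> (\<Sum>n. C * M ^ n / fact n) \<and>
        cmod (\<Sum>n<N. W n x) \<le> (\<Sum>n. C * M ^ n / fact n)" if "x \<in> {c1..c2}" for N x
      using that order_trans by meson
    then show ?thesis by blast
  qed
  have zero: "loc_abs_integrable I (\<lambda>_. 0)"
    by (simp add: loc_abs_integrable_def)
  have "loc_primitive I u (\<lambda>x. g x * w x + 0)"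
  proof (rule limit[OF g zero])
    show "continuous_on I (\<lambda>x. \<Sum>n<N. W n x)" for N by (intro continuous_on_sum UW)
    show "(\<lambda>N. \<Sum>n<Suc N. U n x) \<longlonglongrightarrow> u x" if "x \<in> I" for x
      by (rule LIMSEQ_Suc[OF sums(1)[OF that]])
    show "loc_primitive I (\<lambda>x. \<Sum>n<Suc N. U n x) (\<lambda>x. g x * (\<Sum>n<N. W n x) + 0)" for N
    proof (induction N)
      case 0
      show ?case by (simp add: loc_primitive_def U0)
    next
      case (Suc N)
      from loc_primitive_add[OF this prim[OF mult[OF g UW(2)[of N]]]]
      show ?case by (rule loc_primitive_cong) (simp_all add: US distrib_left)
    qed
    show "\<exists>B. \<forall>N. \<forall>x\<in>{c1..c2}. cmod (\<Sum>n<N. W n x) \<le> B" if "c1 \<le> c2" "{c1..c2} \<subseteq> I" for c1 c2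
      using sumbd[OF that] by blast
  qed (rule sums(2))
  moreover have "loc_primitive I w (\<lambda>x. m x * u x + l x)"
  proof (rule limit[OF m l])
    show "continuous_on I (\<lambda>x. \<Sum>n<N. U n x)" for N by (intro continuous_on_sum UW)
    show "(\<lambda>N. \<Sum>n<Suc N. W n x) \<longlonglongrightarrow> w x" if "x \<in> I" for x
      by (rule LIMSEQ_Suc[OF sums(2)[OF that]])
    show "loc_primitive I (\<lambda>x. \<Sum>n<Suc N. W n x) (\<lambda>x. m x * (\<Sum>n<N. U n x) + l x)" for N
    proof (induction N)
      case 0
      have "loc_primitive I (\<lambda>x. w0) (\<lambda>x. 0)" by (simp add: loc_primitive_def)
      from loc_primitive_add[OF this prim[OF l]] show ?case
        by (rule loc_primitive_cong) (simp_all add: W0)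
    next
      case (Suc N)
      from loc_primitive_add[OF this prim[OF mult[OF m UW(1)[of N]]]]
      show ?case by (rule loc_primitive_cong) (simp_all add: WS distrib_left)
    qed
    show "\<exists>B. \<forall>N. \<forall>x\<in>{c1..c2}. cmod (\<Sum>n<N. U n x) \<le> B" if "c1 \<le> c2" "{c1..c2} \<subseteq> I" for c1 c2
      using sumbd[OF that] by blast
  qed (rule sums(1))
  moreover have "U n c = (if n = 0 then u0 else 0)" "W n c = (if n = 0 then w0 else 0)" for n
    by (cases n; simp add: U0 W0 US WS)+
  then have "u c = u0" "w c = w0"
    using suminf_finite[of "{0::nat}" "\<lambda>n. U n c"] suminf_finite[of "{0::nat}" "\<lambda>n. W n c"]
    by (simp_all add: u_def w_def)
  ultimately show ?thesis by auto
qed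

section \<open>The weighted Hilbert space\<close>

lemma space_r_measure [simp]: "space (r_measure S) = dom_int S"
  by (simp add: r_measure_def)

lemma borel_measurable_r_measure:
  "borel_measurable (r_measure S) = borel_measurable (lebesgue_on (dom_int S))"
  by (rule measurable_cong_sets) (simp_all add: r_measure_def)

context
  fixes S :: sl_data
  assumes S: "sturm_liouville S"
begin

lemma coef_r_measurable: "coef_r S \<in> borel_measurable (lebesgue_on (dom_int S))"
  using S by (simp add: sturm_liouville_def)

lemma coef_r_pos_AE: "AE x in lebesgue_on (dom_int S). 0 < coef_r S x"
  using S by (simp add: sturm_liouville_def)

lemma AE_r_measure_iff:
  "(AE x in r_measure S. P x) \<longleftrightarrow> (AE x in lebesgue_on (dom_int S). P x)"
proof -
  have "(\<lambda>x. ennreal (coef_r S x)) \<in> borel_measurable (lebesgue_on (dom_int S))"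
    using coef_r_measurable by measurable
  then have "(AE x in r_measure S. P x) \<longleftrightarrow> (AE x in lebesgue_on (dom_int S). 0 < ennreal (coef_r S x) \<longrightarrow> P x)"
    unfolding r_measure_def by (rule AE_density)
  also have "\<dots> \<longleftrightarrow> (AE x in lebesgue_on (dom_int S). P x)"
  proof
    assume "AE x in lebesgue_on (dom_int S). 0 < ennreal (coef_r S x) \<longrightarrow> P x"
    with coef_r_pos_AE show "AE x in lebesgue_on (dom_int S). P x" by eventually_elim simp
  next
    assume "AE x in lebesgue_on (dom_int S). P x"
    then show "AE x in lebesgue_on (dom_int S). 0 < ennreal (coef_r S x) \<longrightarrow> P x"
      by eventually_elim simp
  qed
  finally show ?thesis .
qed

text \<open>Integrals over \<open>r_measure\<close> are gauge integrals with weight \<open>r\<close>. This connects the Hilbert space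
  with primitives.\<close>

lemma r_measure_integrable_iff:
  fixes k :: "real \<Rightarrow> complex"
  assumes "k \<in> borel_measurable (r_measure S)"
  shows "integrable (r_measure S) k \<longleftrightarrow> (\<lambda>x. of_real (coef_r S x) * k x) absolutely_integrable_on dom_int S"
    and "integrable (r_measure S) k \<Longrightarrow>
      integral (dom_int S) (\<lambda>x. of_real (coef_r S x) * k x) = (LINT x|r_measure S. k x)"
proof -
  have k: "k \<in> borel_measurable (lebesgue_on (dom_int S))"
    using assms by (simp add: borel_measurable_r_measure)
  have nn: "AE x in lebesgue_on (dom_int S). 0 \<le> coef_r S x"
    using coef_r_pos_AE by eventually_elim simp
  have 1: "integrable (r_measure S) k \<longleftrightarrow>
      integrable (lebesgue_on (dom_int S)) (\<lambda>x. of_real (coef_r S x) * k x)"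
    unfolding r_measure_def using integrable_density[OF k coef_r_measurable nn] by (simp add: scaleR_conv_of_real)
  then show "integrable (r_measure S) k \<longleftrightarrow> (\<lambda>x. of_real (coef_r S x) * k x) absolutely_integrable_on dom_int S"
    unfolding set_integrable_def by (subst (asm) integrable_restrict_space) (simp_all add: dom_int_sets_lebesgue)
  assume "integrable (r_measure S) k"
  then have "integrable (lebesgue_on (dom_int S)) (\<lambda>x. of_real (coef_r S x) * k x)" by (simp only: 1)
  from lebesgue_integral_eq_integral[OF this dom_int_sets_lebesgue]
  show "integral (dom_int S) (\<lambda>x. of_real (coef_r S x) * k x) = (LINT x|r_measure S. k x)"
    unfolding r_measure_def using integral_density[OF k coef_r_measurable nn] by (simp add: scaleR_conv_of_real)
qed

lemma L2r_iff: "f \<in> L2r S \<longleftrightarrow>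
  f \<in> borel_measurable (r_measure S) \<and> integrable (r_measure S) (\<lambda>x. (cmod (f x))\<^sup>2)"
  by (simp add: L2r_def)

lemma L2r_bound:
  assumes f: "f \<in> L2r S" and g: "g \<in> L2r S" and h: "h \<in> borel_measurable (r_measure S)"
    and le: "\<And>x. x \<in> dom_int S \<Longrightarrow> cmod (h x) \<le> K * (cmod (f x) + cmod (g x))"
  shows "h \<in> L2r S"
proof -
  have "integrable (r_measure S) (\<lambda>x. 2 * K\<^sup>2 * ((cmod (f x))\<^sup>2 + (cmod (g x))\<^sup>2))"
    using f g by (intro integrable_mult_right Bochner_Integration.integrable_add) (auto simp: L2r_iff)
  moreover have "(\<lambda>x. (cmod (h x))\<^sup>2) \<in> borel_measurable (r_measure S)" using h by measurable
  moreover have "AE x in r_measure S. norm ((cmod (h x))\<^sup>2) \<le> norm (2 * K\<^sup>2 * ((cmod (f x))\<^sup>2 + (cmod (g x))\<^sup>2))"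
  proof (rule AE_I2)
    fix x assume "x \<in> space (r_measure S)"
    then have "(cmod (h x))\<^sup>2 \<le> (K * (cmod (f x) + cmod (g x)))\<^sup>2"
      using le by (intro power_mono) simp_all
    also have "\<dots> \<le> 2 * K\<^sup>2 * ((cmod (f x))\<^sup>2 + (cmod (g x))\<^sup>2)"
    proof -
      have "(cmod (f x) + cmod (g x))\<^sup>2 \<le> 2 * ((cmod (f x))\<^sup>2 + (cmod (g x))\<^sup>2)"
        using sum_squares_bound[of "cmod (f x)" "cmod (g x)"] by (simp add: power2_sum)
      from mult_left_mono[OF this zero_le_power2[of K]] show ?thesis
        by (simp only: power_mult_distrib mult_ac)
    qed
    finally show "norm ((cmod (h x))\<^sup>2) \<le> norm (2 * K\<^sup>2 * ((cmod (f x))\<^sup>2 + (cmod (g x))\<^sup>2))" by simp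
  qed
  ultimately have "integrable (r_measure S) (\<lambda>x. (cmod (h x))\<^sup>2)" by (rule Bochner_Integration.integrable_bound)
  then show ?thesis using h by (simp add: L2r_iff)
qed

lemma L2r_add: "f \<in> L2r S \<Longrightarrow> g \<in> L2r S \<Longrightarrow> (\<lambda>x. f x + g x) \<in> L2r S"
  by (rule L2r_bound[of f g _ 1]) (auto simp: L2r_iff norm_triangle_ineq)

lemma L2r_scale: "f \<in> L2r S \<Longrightarrow> (\<lambda>x. c * f x) \<in> L2r S"
  by (rule L2r_bound[of f f _ "cmod c"]) (auto simp: L2r_iff norm_mult mult_left_mono)

lemma L2r_cnj: "f \<in> L2r S \<Longrightarrow> (\<lambda>x. cnj (f x)) \<in> L2r S"
proof (rule L2r_bound[of f f _ 1])
  assume "f \<in> L2r S"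
  then have "f \<in> borel_measurable (r_measure S)" by (simp add: L2r_iff)
  moreover have "cnj \<in> borel_measurable borel"
    by (intro borel_measurable_continuous_onI continuous_on_cnj continuous_on_id)
  ultimately show "(\<lambda>x. cnj (f x)) \<in> borel_measurable (r_measure S)" by (rule measurable_compose)
qed auto

lemma L2r_diff: "f \<in> L2r S \<Longrightarrow> g \<in> L2r S \<Longrightarrow> (\<lambda>x. f x - g x) \<in> L2r S"
  using L2r_add[OF _ L2r_scale[of g "-1"], of f] by simp

lemma L2r_cong_ae:
  assumes f: "f \<in> L2r S" and ae: "AE x in lebesgue_on (dom_int S). f x = g x"
  shows "g \<in> L2r S"
proof -
  let ?I = "dom_int S"
  obtain N where N: "negligible N" "\<And>x. x \<in> ?I - N \<Longrightarrow> f x = g x"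
    using ae unfolding AE_dom_int_iff by blast
  have "f \<in> borel_measurable (lebesgue_on ?I)" using f by (simp add: L2r_iff borel_measurable_r_measure)
  then have "(\<lambda>x. if x \<in> ?I then f x else 0) \<in> borel_measurable lebesgue"
    by (simp add: borel_measurable_if[OF dom_int_sets_lebesgue])
  moreover have "AE x in lebesgue. (if x \<in> ?I then f x else 0) = (if x \<in> ?I then g x else 0)"
  proof (rule AE_I'[of N])
    show "N \<in> null_sets lebesgue" using N(1) by (simp add: negligible_iff_null_sets)
  qed (use N(2) in auto)
  ultimately have "(\<lambda>x. if x \<in> ?I then g x else 0) \<in> borel_measurable lebesgue"
    by (rule borel_measurable_AE)
  then have g: "g \<in> borel_measurable (r_measure S)"
    by (simp add: borel_measurable_if[OF dom_int_sets_lebesgue] borel_measurable_r_measure)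
  have "integrable (r_measure S) (\<lambda>x. (cmod (g x))\<^sup>2) \<longleftrightarrow> integrable (r_measure S) (\<lambda>x. (cmod (f x))\<^sup>2)"
  proof (rule integrable_cong_AE)
    show "(\<lambda>x. (cmod (g x))\<^sup>2) \<in> borel_measurable (r_measure S)"
      "(\<lambda>x. (cmod (f x))\<^sup>2) \<in> borel_measurable (r_measure S)"
      using g f by (auto simp: L2r_iff)
    show "AE x in r_measure S. (cmod (g x))\<^sup>2 = (cmod (f x))\<^sup>2"
      unfolding AE_r_measure_iff using ae by eventually_elim simp
  qed
  then show ?thesis using f g by (simp add: L2r_iff)
qed

text \<open>The bilinear pairing \<open>\<integral> f g r dx\<close>. It is used in place of the inner product because solutions
  of \<open>\<tau>u = zu\<close> for different \<open>z\<close> are paired without conjugation in Green's formula.\<close>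

definition pairing :: "(real \<Rightarrow> complex) \<Rightarrow> (real \<Rightarrow> complex) \<Rightarrow> complex" where
  "pairing f g = (LINT x|r_measure S. f x * g x)"

lemma L2r_inner_eq_ip: "L2r_inner S f g = pairing (\<lambda>x. cnj (f x)) g"
  by (simp add: L2r_inner_def pairing_def)

lemma L2r_mult_integrable:
  assumes f: "f \<in> L2r S" and g: "g \<in> L2r S"
  shows "integrable (r_measure S) (\<lambda>x. f x * g x)"
proof (rule Bochner_Integration.integrable_bound)
  show "integrable (r_measure S) (\<lambda>x. (cmod (f x))\<^sup>2 + (cmod (g x))\<^sup>2)"
    using f g by (intro Bochner_Integration.integrable_add) (auto simp: L2r_iff)
  show "(\<lambda>x. f x * g x) \<in> borel_measurable (r_measure S)"
    using f g by (intro borel_measurable_times) (auto simp: L2r_iff)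
  have "norm (f x * g x) \<le> (cmod (f x))\<^sup>2 + (cmod (g x))\<^sup>2" for x
  proof -
    have "2 * (cmod (f x) * cmod (g x)) \<le> (cmod (f x))\<^sup>2 + (cmod (g x))\<^sup>2"
      using sum_squares_bound[of "cmod (f x)" "cmod (g x)"] by simp
    moreover have "0 \<le> cmod (f x) * cmod (g x)" by simp
    ultimately show ?thesis unfolding norm_mult by linarith
  qed
  then show "AE x in r_measure S. norm (f x * g x) \<le> norm ((cmod (f x))\<^sup>2 + (cmod (g x))\<^sup>2)"
    by (intro AE_I2) simp
qed

lemma pairing_commute: "pairing f g = pairing g f"
  by (simp add: pairing_def mult.commute)

lemma pairing_add_right: "\<lbrakk>f \<in> L2r S; g \<in> L2r S; h \<in> L2r S\<rbrakk> \<Longrightarrow> pairing f (\<lambda>x. g x + h x) = pairing f g + pairing f h"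
  unfolding pairing_def by (simp add: distrib_left L2r_mult_integrable)

lemma pairing_scale_right: "pairing f (\<lambda>x. c * g x) = c * pairing f g"
  unfolding pairing_def by (simp add: mult.left_commute)

lemma pairing_cong_ae:
  assumes "f \<in> L2r S" "g \<in> L2r S" "AE x in lebesgue_on (dom_int S). g x = g' x"
  shows "pairing f g' = pairing f g"
  unfolding pairing_def
proof (rule integral_cong_AE)
  have g': "g' \<in> L2r S" by (rule L2r_cong_ae[OF assms(2,3)])
  show "(\<lambda>x. f x * g' x) \<in> borel_measurable (r_measure S)" "(\<lambda>x. f x * g x) \<in> borel_measurable (r_measure S)"
    using L2r_mult_integrable[OF assms(1) g'] L2r_mult_integrable[OF assms(1,2)] by auto
  show "AE x in r_measure S. f x * g' x = f x * g x"
    unfolding AE_r_measure_iff using assms(3) by eventually_elim simp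
qed

lemma pairing_cnj: "pairing (\<lambda>x. cnj (f x)) (\<lambda>x. cnj (g x)) = cnj (pairing f g)"
  unfolding pairing_def by (simp flip: complex_cnj_mult)

lemma pairing_cnj_self:
  assumes "f \<in> L2r S"
  shows "pairing (\<lambda>x. cnj (f x)) f = of_real ((L2r_norm S f)\<^sup>2)"
proof -
  have "pairing (\<lambda>x. cnj (f x)) f = (LINT x|r_measure S. of_real ((cmod (f x))\<^sup>2))"
    unfolding pairing_def by (simp add: complex_norm_square mult.commute flip: of_real_power)
  also have "\<dots> = of_real (LINT x|r_measure S. (cmod (f x))\<^sup>2)" by (rule integral_complex_of_real)
  also have "(LINT x|r_measure S. (cmod (f x))\<^sup>2) = (L2r_norm S f)\<^sup>2"
    unfolding L2r_norm_def by simp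
  finally show ?thesis .
qed

lemma L2r_norm_nonneg: "0 \<le> L2r_norm S f"
  by (simp add: L2r_norm_def)

lemma L2r_norm_square: "(L2r_norm S f)\<^sup>2 = (LINT x|r_measure S. (cmod (f x))\<^sup>2)"
  by (simp add: L2r_norm_def)

lemma L2r_norm_zero_ae:
  assumes "f \<in> L2r S" "L2r_norm S f = 0"
  shows "AE x in lebesgue_on (dom_int S). f x = 0"
proof -
  have "(LINT x|r_measure S. (cmod (f x))\<^sup>2) = 0" using assms(2) L2r_norm_square[of f] by simp
  then have "AE x in r_measure S. (cmod (f x))\<^sup>2 = 0"
    using assms(1) by (subst (asm) integral_nonneg_eq_0_iff_AE) (auto simp: L2r_iff)
  then show ?thesis unfolding AE_r_measure_iff by eventually_elim simp
qed

text \<open>The inequality between arithmetic and geometric means in place of the Cauchy-Schwarz inequality;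
  the weight \<open>t\<close> allows an optimal choice where it is needed.\<close>

lemma cmod_pairing_le:
  assumes f: "f \<in> L2r S" and g: "g \<in> L2r S" and t: "0 < t"
  shows "2 * cmod (pairing f g) \<le> t * (L2r_norm S f)\<^sup>2 + (L2r_norm S g)\<^sup>2 / t"
proof -
  have i: "integrable (r_measure S) (\<lambda>x. (cmod (f x))\<^sup>2)" "integrable (r_measure S) (\<lambda>x. (cmod (g x))\<^sup>2)"
    using f g by (auto simp: L2r_iff)
  have "2 * cmod (pairing f g) \<le> 2 * (LINT x|r_measure S. cmod (f x * g x))"
    unfolding pairing_def using integral_norm_bound[of "r_measure S" "\<lambda>x. f x * g x"] by simp
  also have "\<dots> = (LINT x|r_measure S. 2 * cmod (f x * g x))" by simp
  also have "\<dots> \<le> (LINT x|r_measure S. t * (cmod (f x))\<^sup>2 + (cmod (g x))\<^sup>2 / t)"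
  proof (rule integral_mono)
    show "integrable (r_measure S) (\<lambda>x. 2 * cmod (f x * g x))"
      by (intro integrable_mult_right integrable_norm L2r_mult_integrable f g)
    show "integrable (r_measure S) (\<lambda>x. t * (cmod (f x))\<^sup>2 + (cmod (g x))\<^sup>2 / t)"
      using i by simp
    fix x
    have "0 \<le> (t * cmod (f x) - cmod (g x))\<^sup>2 / t" using t by simp
    also have "\<dots> = t * (cmod (f x))\<^sup>2 + (cmod (g x))\<^sup>2 / t - 2 * (cmod (f x) * cmod (g x))"
      using t by (simp add: power2_eq_square field_simps)
    finally show "2 * cmod (f x * g x) \<le> t * (cmod (f x))\<^sup>2 + (cmod (g x))\<^sup>2 / t"
      by (simp add: norm_mult)
  qed
  also have "\<dots> = t * (L2r_norm S f)\<^sup>2 + (L2r_norm S g)\<^sup>2 / t"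
    unfolding L2r_norm_square using i by simp
  finally show ?thesis .
qed

lemma L2r_norm_scale: "L2r_norm S (\<lambda>x. c * f x) = cmod c * L2r_norm S f"
  unfolding L2r_norm_def by (simp add: norm_mult power_mult_distrib real_sqrt_mult)

text \<open>A triangle inequality with the crude constant \<open>2\<close>, enough for boundedness of operators.\<close>

lemma L2r_norm_add_le:
  assumes f: "f \<in> L2r S" and g: "g \<in> L2r S"
  shows "L2r_norm S (\<lambda>x. f x + g x) \<le> 2 * (L2r_norm S f + L2r_norm S g)"
proof -
  have i: "integrable (r_measure S) (\<lambda>x. (cmod (f x))\<^sup>2)" "integrable (r_measure S) (\<lambda>x. (cmod (g x))\<^sup>2)"
    using f g by (auto simp: L2r_iff)
  have "(L2r_norm S (\<lambda>x. f x + g x))\<^sup>2 \<le> (LINT x|r_measure S. 2 * (cmod (f x))\<^sup>2 + 2 * (cmod (g x))\<^sup>2)"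
    unfolding L2r_norm_square
  proof (rule integral_mono)
    show "integrable (r_measure S) (\<lambda>x. (cmod (f x + g x))\<^sup>2)"
      using L2r_add[OF f g] by (simp add: L2r_iff)
    show "integrable (r_measure S) (\<lambda>x. 2 * (cmod (f x))\<^sup>2 + 2 * (cmod (g x))\<^sup>2)" using i by simp
    fix x
    have "(cmod (f x + g x))\<^sup>2 \<le> (cmod (f x) + cmod (g x))\<^sup>2"
      by (intro power_mono norm_triangle_ineq) simp
    also have "\<dots> \<le> 2 * (cmod (f x))\<^sup>2 + 2 * (cmod (g x))\<^sup>2"
      using sum_squares_bound[of "cmod (f x)" "cmod (g x)"] by (simp add: power2_sum)
    finally show "(cmod (f x + g x))\<^sup>2 \<le> 2 * (cmod (f x))\<^sup>2 + 2 * (cmod (g x))\<^sup>2" .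
  qed
  also have "\<dots> = 2 * (L2r_norm S f)\<^sup>2 + 2 * (L2r_norm S g)\<^sup>2"
    unfolding L2r_norm_square using i by simp
  also have "\<dots> \<le> (2 * (L2r_norm S f + L2r_norm S g))\<^sup>2"
    using L2r_norm_nonneg[of f] L2r_norm_nonneg[of g] by (simp add: power2_eq_square algebra_simps)
  finally show ?thesis
    by (rule power2_le_imp_le) (use L2r_norm_nonneg[of f] L2r_norm_nonneg[of g] in simp)
qed

end

section \<open>Wronskians and generalized boundary values\<close>

lemma eventually_dom_int_end_filter:
  assumes "lo S < hi S"
  shows "eventually (\<lambda>x. x \<in> dom_int S) (end_filter S d)"
proof (cases d)
  case Left_End
  have "eventually (\<lambda>y. real_of_ereal y \<in> dom_int S) (at_right (lo S))"
    using eventually_at_right[OF assms] assms real_of_ereal_in_dom_int by blast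
  then show ?thesis using Left_End by (simp add: eventually_filtermap)
next
  case Right_End
  have "eventually (\<lambda>y. real_of_ereal y \<in> dom_int S) (at_left (hi S))"
    using eventually_at_left[OF assms] assms real_of_ereal_in_dom_int by blast
  then show ?thesis using Right_End by (simp add: eventually_filtermap)
qed

context
  fixes S :: sl_data
  assumes S: "sturm_liouville S"
begin

lemma lo_less_hi: "lo S < hi S"
  using S by (simp add: sturm_liouville_def)

lemma sl_sys_imp_dom_max:
  assumes sys: "sl_sys S f h k" and f: "f \<in> L2r S" and k: "k \<in> L2r S"
  shows "f \<in> dom_max S" and "\<And>x. x \<in> dom_int S \<Longrightarrow> quasi_deriv S f x = h x"
    and "AE x in lebesgue_on (dom_int S). sl_tau S f x = k x"
proof -
  note 1 = sl_sys_imp_regular[OF S sys]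
  show "quasi_deriv S f x = h x" if "x \<in> dom_int S" for x by (rule 1(3)[OF that])
  show ae: "AE x in lebesgue_on (dom_int S). sl_tau S f x = k x" by (rule 1(4))
  then have "AE x in lebesgue_on (dom_int S). k x = sl_tau S f x" by eventually_elim simp
  from L2r_cong_ae[OF S k this] show "f \<in> dom_max S" using f 1(2) by (simp add: dom_max_def)
qed

lemma dom_max_sl_sys:
  assumes "f \<in> dom_max S"
  shows "sl_sys S f (quasi_deriv S f) (sl_tau S f)" "f \<in> L2r S" "sl_tau S f \<in> L2r S"
  using assms sl_regular_sl_sys[OF S] by (auto simp: dom_max_def)

lemma dom_max_add:
  assumes f: "f \<in> dom_max S" and g: "g \<in> dom_max S"
  shows "(\<lambda>x. f x + g x) \<in> dom_max S"
    and "\<And>x. x \<in> dom_int S \<Longrightarrow> quasi_deriv S (\<lambda>x. f x + g x) x = quasi_deriv S f x + quasi_deriv S g x"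
    and "AE x in lebesgue_on (dom_int S). sl_tau S (\<lambda>x. f x + g x) x = sl_tau S f x + sl_tau S g x"
  using sl_sys_imp_dom_max[OF sl_sys_add[OF dom_max_sl_sys(1)[OF f] dom_max_sl_sys(1)[OF g]]
      L2r_add[OF S dom_max_sl_sys(2)[OF f] dom_max_sl_sys(2)[OF g]]
      L2r_add[OF S dom_max_sl_sys(3)[OF f] dom_max_sl_sys(3)[OF g]]]
  by blast+

lemma dom_max_scale:
  assumes f: "f \<in> dom_max S"
  shows "(\<lambda>x. c * f x) \<in> dom_max S"
    and "\<And>x. x \<in> dom_int S \<Longrightarrow> quasi_deriv S (\<lambda>x. c * f x) x = c * quasi_deriv S f x"
    and "AE x in lebesgue_on (dom_int S). sl_tau S (\<lambda>x. c * f x) x = c * sl_tau S f x"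
  using sl_sys_imp_dom_max[OF sl_sys_scale[OF dom_max_sl_sys(1)[OF f]]
      L2r_scale[OF S dom_max_sl_sys(2)[OF f]] L2r_scale[OF S dom_max_sl_sys(3)[OF f]]]
  by blast+

lemma dom_max_cnj:
  assumes f: "f \<in> dom_max S"
  shows "(\<lambda>x. cnj (f x)) \<in> dom_max S"
    and "\<And>x. x \<in> dom_int S \<Longrightarrow> quasi_deriv S (\<lambda>x. cnj (f x)) x = cnj (quasi_deriv S f x)"
    and "AE x in lebesgue_on (dom_int S). sl_tau S (\<lambda>x. cnj (f x)) x = cnj (sl_tau S f x)"
  using sl_sys_imp_dom_max[OF sl_sys_cnj[OF dom_max_sl_sys(1)[OF f]]
      L2r_cnj[OF S dom_max_sl_sys(2)[OF f]] L2r_cnj[OF S dom_max_sl_sys(3)[OF f]]]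
  by blast+

text \<open>Existence of the boundary values of the Wronskian, and Green's formula.\<close>

lemma wronskian_limits:
  assumes f: "f \<in> dom_max S" and g: "g \<in> dom_max S"
  shows "(wronskian S f g \<longlongrightarrow> wronskian_at S f g d) (end_filter S d)"
    and "wronskian_at S f g Right_End - wronskian_at S f g Left_End =
         pairing S (sl_tau S f) g - pairing S f (sl_tau S g)"
proof -
  let ?G = "\<lambda>x. sl_tau S f x * g x - f x * sl_tau S g x"
  note fs = dom_max_sl_sys[OF f] and gs = dom_max_sl_sys[OF g]
  have lp: "loc_primitive (dom_int S) (wronskian S f g) (\<lambda>x. of_real (coef_r S x) * ?G x)"
    by (rule loc_primitive_cong[OF sl_sys_wronskian[OF fs(1) gs(1)]]) (simp_all add: wronskian_def)
  have int: "integrable (r_measure S) (\<lambda>x. sl_tau S f x * g x)" "integrable (r_measure S) (\<lambda>x. f x * sl_tau S g x)"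
    using L2r_mult_integrable[OF S] fs gs by auto
  then have G: "integrable (r_measure S) ?G" by (rule Bochner_Integration.integrable_diff)
  then have meas: "?G \<in> borel_measurable (r_measure S)" by simp
  have ab: "(\<lambda>x. of_real (coef_r S x) * ?G x) absolutely_integrable_on dom_int S"
    using G r_measure_integrable_iff(1)[OF S meas] by simp
  have "integral (dom_int S) (\<lambda>x. of_real (coef_r S x) * ?G x) = (LINT x|r_measure S. ?G x)"
    by (rule r_measure_integrable_iff(2)[OF S meas G])
  also have "\<dots> = pairing S (sl_tau S f) g - pairing S f (sl_tau S g)"
    unfolding pairing_def[OF S] by (rule Bochner_Integration.integral_diff[OF int])
  finally obtain A B where AB: "(wronskian S f g \<longlongrightarrow> A) (end_filter S Left_End)"
    "(wronskian S f g \<longlongrightarrow> B) (end_filter S Right_End)"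
    "B - A = pairing S (sl_tau S f) g - pairing S f (sl_tau S g)"
    using loc_primitive_end_limits[OF lo_less_hi lp ab] by auto
  have nt: "end_filter S e \<noteq> bot" for e by (rule end_filter_neq_bot[OF lo_less_hi])
  have eq: "wronskian_at S f g Left_End = A" "wronskian_at S f g Right_End = B"
    unfolding wronskian_at_def by (rule tendsto_Lim[OF nt AB(1)], rule tendsto_Lim[OF nt AB(2)])
  show "(wronskian S f g \<longlongrightarrow> wronskian_at S f g d) (end_filter S d)"
    using AB(1,2) eq by (cases d) auto
  show "wronskian_at S f g Right_End - wronskian_at S f g Left_End =
         pairing S (sl_tau S f) g - pairing S f (sl_tau S g)"
    using AB(3) eq by simp
qed

lemma wronskian_at_eqI:
  assumes "(F \<longlongrightarrow> L) (end_filter S d)" "\<And>x. x \<in> dom_int S \<Longrightarrow> wronskian S f g x = F x"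
  shows "wronskian_at S f g d = L"
proof -
  have "(wronskian S f g \<longlongrightarrow> L) (end_filter S d)"
    using assms(1)
    by (rule Lim_transform_eventually)
      (use eventually_dom_int_end_filter[OF lo_less_hi] in \<open>eventually_elim, simp add: assms(2)\<close>)
  then show ?thesis
    unfolding wronskian_at_def by (rule tendsto_Lim[OF end_filter_neq_bot[OF lo_less_hi]])
qed

lemma wronskian_at_add_right:
  assumes "u \<in> dom_max S" "f \<in> dom_max S" "g \<in> dom_max S"
  shows "wronskian_at S u (\<lambda>x. f x + g x) d = wronskian_at S u f d + wronskian_at S u g d"
  by (rule wronskian_at_eqI[OF tendsto_add[OF wronskian_limits(1)[OF assms(1,2)] wronskian_limits(1)[OF assms(1,3)]]])
    (simp add: wronskian_def dom_max_add(2)[OF assms(2,3)] algebra_simps)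

lemma wronskian_at_scale_right:
  assumes "u \<in> dom_max S" "f \<in> dom_max S"
  shows "wronskian_at S u (\<lambda>x. c * f x) d = c * wronskian_at S u f d"
  by (rule wronskian_at_eqI[OF tendsto_mult_left[OF wronskian_limits(1)[OF assms]]])
    (simp add: wronskian_def dom_max_scale(2)[OF assms(2)] algebra_simps)

lemma wronskian_at_cnj_right:
  assumes u: "u \<in> dom_max S" "\<And>x. u x \<in> \<real>" and f: "f \<in> dom_max S"
  shows "wronskian_at S u (\<lambda>x. cnj (f x)) d = cnj (wronskian_at S u f d)"
proof (rule wronskian_at_eqI[OF tendsto_cnj[OF wronskian_limits(1)[OF u(1) f]]])
  fix x assume x: "x \<in> dom_int S"
  have "(\<lambda>x. cnj (u x)) = u" using u(2) by (simp add: Reals_cnj_iff)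
  then have "cnj (quasi_deriv S u x) = quasi_deriv S u x"
    using dom_max_cnj(2)[OF u(1) x] by simp
  moreover have "cnj (u x) = u x" using u(2) by (simp add: Reals_cnj_iff)
  ultimately show "wronskian S u (\<lambda>x. cnj (f x)) x = cnj (wronskian S u f x)"
    by (simp add: wronskian_def dom_max_cnj(2)[OF f x])
qed

context
  fixes v :: ref_pair
  assumes v: "boundary_reference S v"
begin

lemma reference_dom_max: "fst v \<in> dom_max S" "snd v \<in> dom_max S"
  and reference_real: "fst v x \<in> \<real>" "snd v x \<in> \<real>"
  and reference_wronskian: "wronskian_at S (fst v) (snd v) d = 1"
  using v by (simp_all add: boundary_reference_def)

lemma bval_linear:
  assumes "f \<in> dom_max S" "g \<in> dom_max S"
  shows "bval S v (\<lambda>x. f x + g x) d = bval S v f d + bval S v g d"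
    and "bval' S v (\<lambda>x. f x + g x) d = bval' S v f d + bval' S v g d"
    and "bval S v (\<lambda>x. c * f x) d = c * bval S v f d"
    and "bval' S v (\<lambda>x. c * f x) d = c * bval' S v f d"
    and "bval S v (\<lambda>x. cnj (f x)) d = cnj (bval S v f d)"
    and "bval' S v (\<lambda>x. cnj (f x)) d = cnj (bval' S v f d)"
  using assms reference_dom_max reference_real
  by (simp_all add: bval_def bval'_def wronskian_at_add_right wronskian_at_scale_right wronskian_at_cnj_right)

text \<open>The Pluecker identity among the four functions \<open>v\<^sub>1, v\<^sub>2, f, g\<close>, in the limit at an endpoint.\<close>

lemma wronskian_at_bval:
  assumes f: "f \<in> dom_max S" and g: "g \<in> dom_max S"
  shows "wronskian_at S f g d = bval S v f d * bval' S v g d - bval' S v f d * bval S v g d"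
proof -
  note W = wronskian_limits(1)
  have "((\<lambda>x. wronskian S (fst v) f x * wronskian S (snd v) g x - wronskian S (fst v) g x * wronskian S (snd v) f x)
      \<longlongrightarrow> bval S v f d * bval' S v g d - bval' S v f d * bval S v g d) (end_filter S d)"
    unfolding bval_def bval'_def
    by (rule tendsto_eq_intros W f g reference_dom_max refl | simp)+
  moreover have "((\<lambda>x. wronskian S (fst v) (snd v) x * wronskian S f g x)
      \<longlongrightarrow> 1 * wronskian_at S f g d) (end_filter S d)"
    by (rule tendsto_mult[OF W[OF reference_dom_max, unfolded reference_wronskian] W[OF f g]])
  moreover have "wronskian S (fst v) (snd v) x * wronskian S f g x =
      wronskian S (fst v) f x * wronskian S (snd v) g x - wronskian S (fst v) g x * wronskian S (snd v) f x" for x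
    by (simp add: wronskian_def algebra_simps)
  ultimately show ?thesis
    using tendsto_unique[OF end_filter_neq_bot[OF lo_less_hi]] by fastforce
qed

end

end

section \<open>Solutions in the limit circle case\<close>

context
  fixes S :: sl_data
  assumes S: "sturm_liouville S"
begin

lemma coef_loc_abs_integrable:
  shows "loc_abs_integrable (dom_int S) (\<lambda>x. of_real (coef_r S x))"
    and "loc_abs_integrable (dom_int S) (\<lambda>x. of_real (coef_q S x))"
    and "loc_abs_integrable (dom_int S) (\<lambda>x. 1 / of_real (coef_p S x))"
proof -
  have *: "loc_abs_integrable (dom_int S) (\<lambda>x. of_real (f x))" if "L1_loc (dom_int S) f" for f
    unfolding loc_abs_integrable_def
  proof (intro allI impI, elim conjE)
    fix c d :: real assume "{c..d} \<subseteq> dom_int S"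
    then have "f absolutely_integrable_on {c..d}" using that by (simp add: L1_loc_def)
    from absolutely_integrable_linear[OF this bounded_linear_of_real]
    show "(\<lambda>x. complex_of_real (f x)) absolutely_integrable_on {c..d}" by (simp add: comp_def)
  qed
  show "loc_abs_integrable (dom_int S) (\<lambda>x. of_real (coef_r S x))"
    "loc_abs_integrable (dom_int S) (\<lambda>x. of_real (coef_q S x))"
    using S * by (simp_all add: sturm_liouville_def)
  have "L1_loc (dom_int S) (\<lambda>x. 1 / coef_p S x)" using S by (simp add: sturm_liouville_def)
  from *[OF this] show "loc_abs_integrable (dom_int S) (\<lambda>x. 1 / of_real (coef_p S x))" by simp
qed

lemma continuous_borel_measurable_r_measure:
  assumes "continuous_on (dom_int S) f"
  shows "f \<in> borel_measurable (r_measure S)"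
  unfolding borel_measurable_r_measure
  by (rule continuous_imp_measurable_on_sets_lebesgue[OF assms dom_int_sets_lebesgue])

lemma indicator_L2r:
  assumes cd: "{c..d} \<subseteq> dom_int S"
  shows "(\<lambda>x. indicator {c..d} x :: complex) \<in> L2r S"
proof -
  let ?f = "\<lambda>x. indicator {c..d} x :: complex"
  have "?f \<in> borel_measurable lebesgue" by (rule borel_measurable_indicator) simp
  then have meas: "?f \<in> borel_measurable (r_measure S)"
    unfolding borel_measurable_r_measure by (rule measurable_restrict_space1)
  have "(\<lambda>x. of_real (coef_r S x) * ?f x) absolutely_integrable_on dom_int S"
  proof (cases "c \<le> d")
    case True
    then have "(\<lambda>x. complex_of_real (coef_r S x)) absolutely_integrable_on {c..d}"
      using coef_loc_abs_integrable(1) cd by (simp add: loc_abs_integrable_def)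
    moreover have "(\<lambda>x. indicat_real (dom_int S) x *\<^sub>R (of_real (coef_r S x) * ?f x))
        = (\<lambda>x. indicat_real {c..d} x *\<^sub>R complex_of_real (coef_r S x))"
      using cd by (auto simp: indicator_def fun_eq_iff)
    ultimately show ?thesis by (simp add: set_integrable_def)
  next
    case False
    then show ?thesis by (simp add: indicator_def)
  qed
  then have "integrable (r_measure S) ?f" using r_measure_integrable_iff(1)[OF S meas] by simp
  then have "integrable (r_measure S) (\<lambda>x. Re (?f x))" by (rule integrable_Re)
  moreover have "(\<lambda>x. Re (?f x)) = (\<lambda>x. (cmod (?f x))\<^sup>2)" by (auto simp: indicator_def)
  ultimately show ?thesis using meas by (simp add: L2r_iff[OF S])
qed

lemma continuous_indicator_L2r:
  assumes cd: "{c..d} \<subseteq> dom_int S" and F: "continuous_on (dom_int S) F"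
  shows "(\<lambda>x. indicator {c..d} x * F x) \<in> L2r S"
proof -
  have "bounded (F ` {c..d})"
    by (intro compact_imp_bounded compact_continuous_image continuous_on_subset[OF F cd] compact_Icc)
  then obtain B where B: "\<And>x. x \<in> {c..d} \<Longrightarrow> cmod (F x) \<le> B" unfolding bounded_iff by blast
  note i = indicator_L2r[OF cd]
  show ?thesis
  proof (rule L2r_bound[OF S i i, of _ "max B 0"])
    show "(\<lambda>x. indicator {c..d} x * F x) \<in> borel_measurable (r_measure S)"
      using i continuous_borel_measurable_r_measure[OF F] by (intro borel_measurable_times) (simp_all add: L2r_iff[OF S])
    fix x
    show "cmod (indicator {c..d} x * F x) \<le> max B 0 * (cmod (indicator {c..d} x) + cmod (indicator {c..d} x))"
    proof (cases "x \<in> {c..d}")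
      case True
      have "cmod (F x) \<le> max B 0" "0 \<le> max B 0" using B[OF True] by (simp_all add: le_max_iff_disj)
      then have "cmod (F x) \<le> max B 0 * 2" by linarith
      then show ?thesis using True by simp
    qed simp
  qed
qed

lemma L2r_coef_r_loc_abs_integrable:
  assumes h: "h \<in> L2r S"
  shows "loc_abs_integrable (dom_int S) (\<lambda>x. of_real (coef_r S x) * h x)"
  unfolding loc_abs_integrable_def
proof (intro allI impI, elim conjE)
  fix c d :: real assume cd: "c \<le> d" "{c..d} \<subseteq> dom_int S"
  have int: "integrable (r_measure S) (\<lambda>x. h x * indicator {c..d} x)"
    by (rule L2r_mult_integrable[OF S h indicator_L2r[OF cd(2)]])
  have "(\<lambda>x. of_real (coef_r S x) * (h x * indicator {c..d} x)) absolutely_integrable_on dom_int S"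
    using r_measure_integrable_iff(1)[OF S borel_measurable_integrable[OF int]] int by simp
  then have "(\<lambda>x. of_real (coef_r S x) * (h x * indicator {c..d} x)) absolutely_integrable_on {c..d}"
    by (rule absolutely_integrable_on_subinterval[OF _ cd(2)])
  then show "(\<lambda>x. of_real (coef_r S x) * h x) absolutely_integrable_on {c..d}"
    by (rule absolutely_integrable_spike[OF _ negligible_empty]) simp
qed

text \<open>The initial value problem for \<open>\<tau>f = zf + h\<close>; the solution is set to zero off the interval.\<close>

lemma sl_sys_initial_value:
  assumes c: "c \<in> dom_int S" and h: "h \<in> L2r S"
  shows "\<exists>f g. sl_sys S f g (\<lambda>x. z * f x + h x) \<and> f c = \<alpha> \<and> g c = \<beta>"
proof -
  have add: "loc_abs_integrable (dom_int S) (\<lambda>x. f x + g x)"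
    if "loc_abs_integrable (dom_int S) f" "loc_abs_integrable (dom_int S) g" for f g
    using that set_integral_add(1) unfolding loc_abs_integrable_def by blast
  have mul: "loc_abs_integrable (dom_int S) (\<lambda>x. k * f x)"
    if "loc_abs_integrable (dom_int S) f" for f k
    using that set_integrable_mult_right[of k] unfolding loc_abs_integrable_def by blast
  have m: "loc_abs_integrable (dom_int S) (\<lambda>x. of_real (coef_q S x) + (- z) * of_real (coef_r S x))"
    by (intro add mul coef_loc_abs_integrable)
  have l: "loc_abs_integrable (dom_int S) (\<lambda>x. (- 1) * (of_real (coef_r S x) * h x))"
    by (intro mul L2r_coef_r_loc_abs_integrable h)
  obtain u w where uw: "u c = \<alpha>" "w c = \<beta>"
    "loc_primitive (dom_int S) u (\<lambda>x. 1 / of_real (coef_p S x) * w x)"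
    "loc_primitive (dom_int S) w (\<lambda>x. (of_real (coef_q S x) + (- z) * of_real (coef_r S x)) * u x
       + (- 1) * (of_real (coef_r S x) * h x))"
    using volterra_system_exists[OF open_dom_int dom_int_Icc_subset c coef_loc_abs_integrable(3) m l] by blast
  define f where "f = (\<lambda>x. if x \<in> dom_int S then u x else 0)"
  have 1: "loc_primitive (dom_int S) f (\<lambda>x. w x / of_real (coef_p S x))"
    by (rule loc_primitive_cong[OF uw(3)]) (simp_all add: f_def)
  have 2: "loc_primitive (dom_int S) w
      (\<lambda>x. of_real (coef_q S x) * f x - of_real (coef_r S x) * (z * f x + h x))"
    by (rule loc_primitive_cong[OF uw(4)]) (simp_all add: f_def algebra_simps)
  have "sl_sys S f w (\<lambda>x. z * f x + h x)"
    unfolding sl_sys_def using 1 2 by (simp add: f_def)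
  moreover have "f c = \<alpha>" using c uw(1) by (simp add: f_def)
  ultimately show ?thesis using uw(2) by blast
qed

lemma zero_L2r: "(\<lambda>x. 0) \<in> L2r S"
  by (simp add: L2r_iff[OF S])

lemma dom_max_continuous_on:
  assumes "f \<in> dom_max S"
  shows "continuous_on (dom_int S) f"
  using assms AC_loc_continuous_on[OF open_dom_int] by (auto simp: dom_max_def sl_regular_def)

lemma dom_max_eq_zero:
  assumes f: "f \<in> dom_max S" and 0: "L2r_norm S f = 0"
  shows "f = (\<lambda>x. 0)"
proof
  fix x
  have van: "f x = 0" if "x \<notin> dom_int S"
    using f that by (auto simp: dom_max_def sl_regular_def)
  obtain N where N: "negligible N" "\<And>x. x \<in> dom_int S - N \<Longrightarrow> f x = 0"
    using L2r_norm_zero_ae[OF S dom_max_sl_sys(2)[OF S f] 0] unfolding AE_dom_int_iff by blast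
  show "f x = 0"
    using van continuous_ae_eq_on_open[OF open_dom_int dom_max_continuous_on[OF f] continuous_on_const N]
    by blast
qed

lemma sl_sys_quasi_deriv_continuous:
  assumes "sl_sys S f h k"
  shows "continuous_on (dom_int S) h" "continuous_on (dom_int S) f"
  using assms AC_loc_continuous_on[OF open_dom_int loc_primitive_AC_loc] by (auto simp: sl_sys_def)

context
  assumes LC: "limit_circle S Left_End" "limit_circle S Right_End"
begin

text \<open>The two neighbourhoods of the endpoints may overlap or leave a compact gap; on the gap \<open>u\<close> is
  bounded.\<close>

lemma sl_solution_L2r:
  assumes u: "sl_solution S z u"
  shows "u \<in> L2r S"
proof -
  let ?I = "dom_int S" and ?M = "r_measure S" and ?g = "\<lambda>x. (cmod (u x))\<^sup>2"
  obtain c1 where c1: "c1 \<in> ?I" "set_integrable ?M {x \<in> ?I. x < c1} ?g"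
    using LC(1) u unfolding limit_circle_def by fastforce
  obtain c2 where c2: "c2 \<in> ?I" "set_integrable ?M {x \<in> ?I. c2 < x} ?g"
    using LC(2) u unfolding limit_circle_def by fastforce
  have cu: "continuous_on ?I u"
    using u AC_loc_continuous_on[OF open_dom_int] by (auto simp: sl_solution_def sl_regular_def)
  note meas = continuous_borel_measurable_r_measure[OF cu]
  have "(\<lambda>x. indicator {c1..c2} x * u x) \<in> L2r S"
    by (rule continuous_indicator_L2r[OF dom_int_Icc_subset[OF c1(1) c2(1)] cu])
  then have "integrable ?M (\<lambda>x. (cmod (indicator {c1..c2} x * u x))\<^sup>2)" by (simp add: L2r_iff[OF S])
  moreover have "(\<lambda>x. (cmod (indicator {c1..c2} x * u x))\<^sup>2) = (\<lambda>x. indicat_real {c1..c2} x *\<^sub>R ?g x)"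
    by (auto simp: indicator_def)
  ultimately have mid: "integrable ?M (\<lambda>x. indicat_real {c1..c2} x *\<^sub>R ?g x)" by simp
  have "integrable ?M (\<lambda>x. indicat_real {x \<in> ?I. x < c1} x *\<^sub>R ?g x + indicat_real {x \<in> ?I. c2 < x} x *\<^sub>R ?g x
      + indicat_real {c1..c2} x *\<^sub>R ?g x)"
    using c1(2) c2(2) mid unfolding set_integrable_def by (intro Bochner_Integration.integrable_add)
  then have "integrable ?M ?g"
  proof (rule Bochner_Integration.integrable_bound)
    show "?g \<in> borel_measurable ?M" using meas by measurable
    show "AE x in ?M. norm (?g x) \<le> norm (indicat_real {x \<in> ?I. x < c1} x *\<^sub>R ?g x
        + indicat_real {x \<in> ?I. c2 < x} x *\<^sub>R ?g x + indicat_real {c1..c2} x *\<^sub>R ?g x)"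
      by (rule AE_I2) (auto simp: indicator_def)
  qed
  then show ?thesis using meas by (simp add: L2r_iff[OF S])
qed

lemma sl_solution_ker_max:
  assumes u: "sl_solution S z u"
  shows "u \<in> ker_max S z"
proof -
  have L: "u \<in> L2r S" by (rule sl_solution_L2r[OF u])
  have ae: "AE x in lebesgue_on (dom_int S). sl_tau S u x = z * u x" using u by (simp add: sl_solution_def)
  then have "AE x in lebesgue_on (dom_int S). z * u x = sl_tau S u x" by eventually_elim simp
  then have "sl_tau S u \<in> L2r S" by (rule L2r_cong_ae[OF S L2r_scale[OF S L]])
  moreover have "AE x in lebesgue_on (dom_int S). sl_tau S u x - z * u x = 0"
    using ae by eventually_elim simp
  ultimately show ?thesis using u L by (simp add: ker_max_def dom_max_def sl_solution_def)
qed

text \<open>A fundamental system of \<open>\<tau>u = zu\<close> with Wronskian one.\<close>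

lemma fundamental_system:
  "\<exists>f1 g1 f2 g2. sl_sys S f1 g1 (\<lambda>x. z * f1 x) \<and> sl_sys S f2 g2 (\<lambda>x. z * f2 x) \<and>
     f1 \<in> ker_max S z \<and> f2 \<in> ker_max S z \<and> (\<forall>x\<in>dom_int S. f1 x * g2 x - g1 x * f2 x = 1)"
proof -
  let ?I = "dom_int S"
  obtain c where c: "c \<in> ?I" using einterval_nonempty[OF lo_less_hi[OF S]] by (auto simp: dom_int_def)
  obtain f1 g1 where 1: "sl_sys S f1 g1 (\<lambda>x. z * f1 x)" "f1 c = 1" "g1 c = 0"
    using sl_sys_initial_value[OF c zero_L2r, of z 1 0] by auto
  obtain f2 g2 where 2: "sl_sys S f2 g2 (\<lambda>x. z * f2 x)" "f2 c = 0" "g2 c = 1"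
    using sl_sys_initial_value[OF c zero_L2r, of z 0 1] by auto
  have ker: "f \<in> ker_max S z" if "sl_sys S f g (\<lambda>x. z * f x)" for f g
    using sl_sys_imp_regular[OF S that] by (intro sl_solution_ker_max) (simp add: sl_solution_def)
  have W: "loc_primitive ?I (\<lambda>x. f1 x * g2 x - g1 x * f2 x) (\<lambda>x. 0)"
    by (rule loc_primitive_cong[OF sl_sys_wronskian[OF 1(1) 2(1)]]) simp_all
  have "f1 x * g2 x - g1 x * f2 x = 1" if x: "x \<in> ?I" for x
  proof -
    have eq: "f1 t * g2 t - g1 t * f2 t = f1 s * g2 s - g1 s * f2 s" if "s \<le> t" "s \<in> ?I" "t \<in> ?I" for s t
      using loc_primitiveD(3)[OF W that(1) dom_int_Icc_subset[OF that(2,3)]] by simp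
    show ?thesis using eq[of c x] eq[of x c] x c 1 2 by (cases "c \<le> x") auto
  qed
  then show ?thesis using 1(1) 2(1) ker by blast
qed

text \<open>In the limit circle case every solution of the inhomogeneous equation is square integrable:
  its coordinates with respect to a fundamental system are Wronskians, which stay bounded.\<close>

lemma inhomogeneous_solution_L2r:
  assumes f: "sl_sys S f g (\<lambda>x. z * f x + h x)" and h: "h \<in> L2r S"
  shows "f \<in> L2r S"
proof -
  let ?I = "dom_int S"
  obtain f1 g1 f2 g2 where 1: "sl_sys S f1 g1 (\<lambda>x. z * f1 x)" and 2: "sl_sys S f2 g2 (\<lambda>x. z * f2 x)"
    and ker: "f1 \<in> ker_max S z" "f2 \<in> ker_max S z"
    and W: "\<And>x. x \<in> ?I \<Longrightarrow> f1 x * g2 x - g1 x * f2 x = 1"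
    using fundamental_system[of z] by blast
  have L: "f1 \<in> L2r S" "f2 \<in> L2r S" using ker by (auto simp: ker_max_def dom_max_def)
  obtain c where c: "c \<in> ?I" using einterval_nonempty[OF lo_less_hi[OF S]] by (auto simp: dom_int_def)
  have bound: "\<exists>K. \<forall>x\<in>?I. cmod (f x * g' x - g x * f' x) \<le> K"
    if sys': "sl_sys S f' g' (\<lambda>x. z * f' x)" and L': "f' \<in> L2r S" for f' g'
  proof -
    let ?G = "\<lambda>x. of_real (coef_r S x) * (h x * f' x)" and ?w = "\<lambda>x. f x * g' x - g x * f' x"
    have lp: "loc_primitive ?I ?w ?G"
      by (rule loc_primitive_cong[OF sl_sys_wronskian[OF f sys']]) (simp_all add: algebra_simps)
    have int: "integrable (r_measure S) (\<lambda>x. h x * f' x)" by (rule L2r_mult_integrable[OF S h L'])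
    then have G: "?G absolutely_integrable_on ?I"
      using r_measure_integrable_iff(1)[OF S borel_measurable_integrable[OF int]] by simp
    have nG: "(\<lambda>x. cmod (?G x)) absolutely_integrable_on ?I"
      using absolutely_integrable_norm[OF G] by (simp add: comp_def)
    define B where "B = integral ?I (\<lambda>x. cmod (?G x))"
    have inc: "cmod (?w t - ?w s) \<le> B" if "s \<le> t" "s \<in> ?I" "t \<in> ?I" for s t
    proof -
      have sub: "{s..t} \<subseteq> ?I" by (rule dom_int_Icc_subset[OF that(2,3)])
      have i: "(\<lambda>x. cmod (?G x)) integrable_on {s..t}" "(\<lambda>x. cmod (?G x)) integrable_on ?I"
        using set_lebesgue_integral_eq_integral(1) absolutely_integrable_on_subinterval[OF nG sub] nG by blast+
      have "?w t - ?w s = integral {s..t} ?G" by (rule loc_primitiveD(3)[OF lp that(1) sub, symmetric])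
      also have "cmod \<dots> \<le> integral {s..t} (\<lambda>x. cmod (?G x))"
        by (rule integral_norm_bound_integral[OF set_lebesgue_integral_eq_integral(1)[OF loc_primitiveD(1)[OF lp that(1) sub]] i(1)]) simp
      also have "\<dots> \<le> B" unfolding B_def by (rule integral_subset_le[OF sub i]) simp
      finally show ?thesis .
    qed
    have "cmod (?w x) \<le> cmod (?w c) + B" if x: "x \<in> ?I" for x
    proof -
      have "cmod (?w x - ?w c) \<le> B"
        using inc[of c x] inc[of x c] x c by (cases "c \<le> x") (simp_all add: norm_minus_commute)
      then show ?thesis using norm_triangle_sub[of "?w x" "?w c"] by linarith
    qed
    then show ?thesis by blast
  qed
  obtain K1 where K1: "\<forall>x\<in>?I. cmod (f x * g1 x - g x * f1 x) \<le> K1" using bound[OF 1 L(1)] by blast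
  obtain K2 where K2: "\<forall>x\<in>?I. cmod (f x * g2 x - g x * f2 x) \<le> K2" using bound[OF 2 L(2)] by blast
  show ?thesis
  proof (rule L2r_bound[OF S L, of _ "max K1 K2"])
    show "f \<in> borel_measurable (r_measure S)"
      by (rule continuous_borel_measurable_r_measure[OF sl_sys_quasi_deriv_continuous(2)[OF f]])
    fix x assume x: "x \<in> ?I"
    have "f x = f x * (f1 x * g2 x - g1 x * f2 x)" by (simp add: W[OF x])
    also have "\<dots> = f1 x * (f x * g2 x - g x * f2 x) - f2 x * (f x * g1 x - g x * f1 x)"
      by (simp add: algebra_simps)
    finally have "cmod (f x) = cmod (f1 x * (f x * g2 x - g x * f2 x) - f2 x * (f x * g1 x - g x * f1 x))"
      by (rule arg_cong)
    also have "\<dots> \<le> cmod (f1 x) * cmod (f x * g2 x - g x * f2 x) + cmod (f2 x) * cmod (f x * g1 x - g x * f1 x)"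
      using norm_triangle_ineq4[of "f1 x * (f x * g2 x - g x * f2 x)" "f2 x * (f x * g1 x - g x * f1 x)"]
      by (simp only: norm_mult)
    also have "\<dots> \<le> cmod (f1 x) * max K1 K2 + cmod (f2 x) * max K1 K2"
      using K1 K2 x by (intro add_mono mult_left_mono) (simp_all add: le_max_iff_disj)
    finally show "cmod (f x) \<le> max K1 K2 * (cmod (f1 x) + cmod (f2 x))"
      by (simp only: distrib_left mult.commute)
  qed
qed

end

end

section \<open>Resolvents of symmetric boundary conditions\<close>

text \<open>The restriction of the maximal operator by two boundary conditions \<open>b1 f = 0\<close> and \<open>b2 f = 0\<close>.\<close>

definition bc_domain ::
  "sl_data \<Rightarrow> ((real \<Rightarrow> complex) \<Rightarrow> complex) \<Rightarrow> ((real \<Rightarrow> complex) \<Rightarrow> complex) \<Rightarrow> (real \<Rightarrow> complex) set" where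
  "bc_domain S b1 b2 = {f \<in> dom_max S. b1 f = 0 \<and> b2 f = 0}"

text \<open>The boundary conditions are linear, and they make the boundary terms in Green's formula for \<open>f\<close>
  and its conjugate cancel. The second property makes the restricted operator symmetric.\<close>

definition symmetric_bc ::
  "sl_data \<Rightarrow> ((real \<Rightarrow> complex) \<Rightarrow> complex) \<Rightarrow> ((real \<Rightarrow> complex) \<Rightarrow> complex) \<Rightarrow> bool" where
  "symmetric_bc S b1 b2 \<longleftrightarrow>
     (\<forall>b\<in>{b1, b2}. (\<forall>f\<in>dom_max S. \<forall>g\<in>dom_max S. b (\<lambda>x. f x + g x) = b f + b g) \<and>
        (\<forall>c. \<forall>f\<in>dom_max S. b (\<lambda>x. c * f x) = c * b f)) \<and>
     (\<forall>f\<in>bc_domain S b1 b2.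
        wronskian_at S (\<lambda>x. cnj (f x)) f Right_End = wronskian_at S (\<lambda>x. cnj (f x)) f Left_End)"

context
  fixes S :: sl_data
  assumes S: "sturm_liouville S"
begin

lemma tau_shift_L2r:
  assumes "f \<in> dom_max S"
  shows "(\<lambda>x. sl_tau S f x - z * f x) \<in> L2r S"
  using dom_max_sl_sys[OF S assms] by (intro L2r_diff[OF S] L2r_scale[OF S])

lemma bc_domain_add_scale:
  assumes bc: "symmetric_bc S b1 b2"
  shows "f \<in> bc_domain S b1 b2 \<Longrightarrow> g \<in> bc_domain S b1 b2 \<Longrightarrow> (\<lambda>x. f x + g x) \<in> bc_domain S b1 b2"
    and "f \<in> bc_domain S b1 b2 \<Longrightarrow> (\<lambda>x. c * f x) \<in> bc_domain S b1 b2"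
  using bc dom_max_add(1)[OF S] dom_max_scale(1)[OF S] by (auto simp: bc_domain_def symmetric_bc_def)

text \<open>The quadratic form of a symmetric operator is real, so \<open>Im z\<close> controls the imaginary part of
  \<open>(f, (T - z) f)\<close>.\<close>

lemma symmetric_bc_norm_bound:
  assumes bc: "symmetric_bc S b1 b2" and f: "f \<in> bc_domain S b1 b2"
  shows "\<bar>Im z\<bar> * L2r_norm S f \<le> L2r_norm S (\<lambda>x. sl_tau S f x - z * f x)"
proof (cases "Im z = 0")
  case True
  then show ?thesis using L2r_norm_nonneg[OF S] by simp
next
  case False
  then have t: "0 < \<bar>Im z\<bar>" by simp
  have fm: "f \<in> dom_max S" using f by (simp add: bc_domain_def)
  let ?k = "\<lambda>x. sl_tau S f x - z * f x" and ?c = "\<lambda>x. cnj (f x)"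
  note fL = dom_max_sl_sys(2,3)[OF S fm] and k = tau_shift_L2r[OF fm, of z]
  have cm: "?c \<in> dom_max S" and ctau: "AE x in lebesgue_on (dom_int S). sl_tau S ?c x = cnj (sl_tau S f x)"
    using dom_max_cnj[OF S fm] by auto
  have cL: "?c \<in> L2r S" by (rule L2r_cnj[OF S fL(1)])
  define A where "A = pairing S ?c (sl_tau S f)"
  have "0 = pairing S (sl_tau S ?c) f - pairing S ?c (sl_tau S f)"
    using wronskian_limits(2)[OF S cm fm] bc f by (simp add: symmetric_bc_def)
  also have "pairing S (sl_tau S ?c) f = pairing S f (sl_tau S ?c)" by (rule pairing_commute[OF S])
  also have "\<dots> = pairing S f (\<lambda>x. cnj (sl_tau S f x))"
    by (rule pairing_cong_ae[OF S fL(1) dom_max_sl_sys(3)[OF S cm] ctau, symmetric])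
  also have "\<dots> = cnj A" unfolding A_def using pairing_cnj[OF S, of ?c "sl_tau S f"] by simp
  finally have "Im A = 0" unfolding A_def[symmetric] by (simp add: complex_eq_iff)
  have "pairing S ?c ?k = pairing S ?c (\<lambda>x. sl_tau S f x + (- z) * f x)" by simp
  also have "\<dots> = A + pairing S ?c (\<lambda>x. (- z) * f x)"
    unfolding A_def by (rule pairing_add_right[OF S cL fL(2) L2r_scale[OF S fL(1)]])
  also have "pairing S ?c (\<lambda>x. (- z) * f x) = (- z) * of_real ((L2r_norm S f)\<^sup>2)"
    unfolding pairing_scale_right[OF S] pairing_cnj_self[OF S fL(1)] by simp
  finally have "Im (pairing S ?c ?k) = - (Im z * (L2r_norm S f)\<^sup>2)" using \<open>Im A = 0\<close> by simp
  then have "\<bar>Im z\<bar> * (L2r_norm S f)\<^sup>2 = \<bar>Im (pairing S ?c ?k)\<bar>" by (simp add: abs_mult)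
  also have "\<dots> \<le> cmod (pairing S ?c ?k)" by (rule abs_Im_le_cmod)
  finally have 1: "\<bar>Im z\<bar> * (L2r_norm S f)\<^sup>2 \<le> cmod (pairing S ?c ?k)" .
  have "L2r_norm S ?c = L2r_norm S f" by (simp add: L2r_norm_def)
  then have "2 * cmod (pairing S ?c ?k) \<le> \<bar>Im z\<bar> * (L2r_norm S f)\<^sup>2 + (L2r_norm S ?k)\<^sup>2 / \<bar>Im z\<bar>"
    using cmod_pairing_le[OF S cL k t] by simp
  with 1 have "\<bar>Im z\<bar> * (L2r_norm S f)\<^sup>2 \<le> (L2r_norm S ?k)\<^sup>2 / \<bar>Im z\<bar>" by linarith
  then have "(\<bar>Im z\<bar> * L2r_norm S f)\<^sup>2 \<le> (L2r_norm S ?k)\<^sup>2"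
    using t by (simp add: pos_le_divide_eq power_mult_distrib power2_eq_square mult_ac)
  then show ?thesis by (rule power2_le_imp_le) (rule L2r_norm_nonneg[OF S])
qed

lemma symmetric_bc_kernel:
  assumes bc: "symmetric_bc S b1 b2" and z: "z \<notin> \<real>"
    and f: "f \<in> ker_max S z" "b1 f = 0" "b2 f = 0"
  shows "f = (\<lambda>x. 0)"
proof -
  have fm: "f \<in> dom_max S" and ae: "AE x in lebesgue_on (dom_int S). sl_tau S f x - z * f x = 0"
    using f by (simp_all add: ker_max_def)
  have "pairing S (\<lambda>x. cnj (sl_tau S f x - z * f x)) (\<lambda>x. sl_tau S f x - z * f x) = pairing S (\<lambda>x. cnj (sl_tau S f x - z * f x)) (\<lambda>x. 0)"
    by (rule pairing_cong_ae[OF S L2r_cnj[OF S] _ ae, symmetric]) (rule tau_shift_L2r[OF fm])+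
  also have "\<dots> = 0" by (simp add: pairing_def[OF S])
  finally have "complex_of_real ((L2r_norm S (\<lambda>x. sl_tau S f x - z * f x))\<^sup>2) = 0"
    by (simp only: pairing_cnj_self[OF S tau_shift_L2r[OF fm]])
  then have "L2r_norm S (\<lambda>x. sl_tau S f x - z * f x) = 0" by simp
  moreover have "\<bar>Im z\<bar> * L2r_norm S f \<le> L2r_norm S (\<lambda>x. sl_tau S f x - z * f x)"
    by (rule symmetric_bc_norm_bound[OF bc]) (use fm f in \<open>simp add: bc_domain_def\<close>)
  moreover have "0 < \<bar>Im z\<bar>" using z by (simp add: complex_is_Real_iff)
  ultimately have "L2r_norm S f \<le> 0" by (simp add: mult_le_0_iff)
  then have "L2r_norm S f = 0" using L2r_norm_nonneg[OF S, of f] by linarith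
  then show ?thesis by (rule dom_max_eq_zero[OF S fm])
qed

lemma ker_max_add_scale:
  shows "f \<in> ker_max S z \<Longrightarrow> g \<in> ker_max S z \<Longrightarrow> (\<lambda>x. f x + g x) \<in> ker_max S z"
    and "f \<in> ker_max S z \<Longrightarrow> (\<lambda>x. c * f x) \<in> ker_max S z"
proof -
  show "(\<lambda>x. f x + g x) \<in> ker_max S z" if fg: "f \<in> ker_max S z" "g \<in> ker_max S z"
  proof -
    have m: "f \<in> dom_max S" "g \<in> dom_max S" using fg by (simp_all add: ker_max_def)
    have "AE x in lebesgue_on (dom_int S). sl_tau S f x - z * f x = 0"
      "AE x in lebesgue_on (dom_int S). sl_tau S g x - z * g x = 0" using fg by (simp_all add: ker_max_def)
    with dom_max_add(3)[OF S m]
    have "AE x in lebesgue_on (dom_int S). sl_tau S (\<lambda>x. f x + g x) x - z * (f x + g x) = 0"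
      by eventually_elim (simp add: algebra_simps)
    then show ?thesis using dom_max_add(1)[OF S m] by (simp add: ker_max_def)
  qed
  show "(\<lambda>x. c * f x) \<in> ker_max S z" if f: "f \<in> ker_max S z"
  proof -
    have m: "f \<in> dom_max S" using f by (simp add: ker_max_def)
    have "AE x in lebesgue_on (dom_int S). sl_tau S f x - z * f x = 0" using f by (simp add: ker_max_def)
    with dom_max_scale(3)[OF S m, of c]
    have "AE x in lebesgue_on (dom_int S). sl_tau S (\<lambda>x. c * f x) x - z * (c * f x) = 0"
      by eventually_elim (simp add: algebra_simps)
    then show ?thesis using dom_max_scale(1)[OF S m] by (simp add: ker_max_def)
  qed
qed

lemma ker_max_cnj:
  assumes f: "f \<in> ker_max S z"
  shows "(\<lambda>x. cnj (f x)) \<in> ker_max S (cnj z)"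
proof -
  have m: "f \<in> dom_max S" using f by (simp add: ker_max_def)
  have "AE x in lebesgue_on (dom_int S). sl_tau S f x - z * f x = 0" using f by (simp add: ker_max_def)
  with dom_max_cnj(3)[OF S m]
  have "AE x in lebesgue_on (dom_int S). sl_tau S (\<lambda>x. cnj (f x)) x - cnj z * cnj (f x) = 0"
    by eventually_elim (simp flip: complex_cnj_mult)
  then show ?thesis using dom_max_cnj(1)[OF S m] by (simp add: ker_max_def)
qed

lemma ker_max_L2r: "f \<in> ker_max S z \<Longrightarrow> f \<in> L2r S"
  by (simp add: ker_max_def dom_max_def)

lemma ker_max_dom_max: "f \<in> ker_max S z \<Longrightarrow> f \<in> dom_max S"
  by (simp add: ker_max_def)

lemma resolvent_unique:
  assumes bc: "symmetric_bc S b1 b2" and z: "z \<notin> \<real>"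
    and f: "f \<in> bc_domain S b1 b2" "AE x in lebesgue_on (dom_int S). sl_tau S f x - z * f x = h x"
    and g: "g \<in> bc_domain S b1 b2" "AE x in lebesgue_on (dom_int S). sl_tau S g x - z * g x = h x"
  shows "f = g"
proof -
  have fg: "f \<in> dom_max S" "g \<in> dom_max S" using f(1) g(1) by (simp_all add: bc_domain_def)
  note m = fg(1) dom_max_scale(1)[OF S fg(2), of "- 1"] fg(2)
  let ?d = "\<lambda>x. f x + (- 1) * g x"
  have d: "?d \<in> bc_domain S b1 b2"
    by (rule bc_domain_add_scale(1)[OF bc f(1) bc_domain_add_scale(2)[OF bc g(1)]])
  have "AE x in lebesgue_on (dom_int S). sl_tau S ?d x - z * ?d x = 0"
    using f(2) g(2) dom_max_add(3)[OF S m(1,2)] dom_max_scale(3)[OF S m(3), of "- 1"]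
    by eventually_elim (simp add: algebra_simps)
  then have "?d \<in> ker_max S z" using d by (simp add: ker_max_def bc_domain_def)
  then have "?d = (\<lambda>x. 0)"
    by (rule symmetric_bc_kernel[OF bc z]) (use d in \<open>simp_all add: bc_domain_def\<close>)
  then have "?d x = 0" for x by (rule fun_cong)
  then show ?thesis by (simp add: fun_eq_iff)
qed

context
  assumes LC: "limit_circle S Left_End" "limit_circle S Right_End"
begin

text \<open>A particular solution is corrected by a combination of the fundamental system. The determinant
  \<open>\<Delta>\<close> of the boundary conditions on the fundamental system is nonzero, because a solution of the
  homogeneous equation that satisfies both conditions vanishes.\<close>

lemma resolvent_exists:
  assumes bc: "symmetric_bc S b1 b2" and z: "z \<notin> \<real>" and h: "h \<in> L2r S"
  shows "\<exists>f\<in>bc_domain S b1 b2. AE x in lebesgue_on (dom_int S). sl_tau S f x - z * f x = h x"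
proof -
  obtain f1 g1 f2 g2 where sys: "sl_sys S f1 g1 (\<lambda>x. z * f1 x)" "sl_sys S f2 g2 (\<lambda>x. z * f2 x)"
    and ker: "f1 \<in> ker_max S z" "f2 \<in> ker_max S z"
    and W: "\<And>x. x \<in> dom_int S \<Longrightarrow> f1 x * g2 x - g1 x * f2 x = 1"
    using fundamental_system[OF S LC, of z] by blast
  obtain c where c: "c \<in> dom_int S" using einterval_nonempty[OF lo_less_hi[OF S]] by (auto simp: dom_int_def)
  obtain f0 g0 where sys0: "sl_sys S f0 g0 (\<lambda>x. z * f0 x + h x)"
    using sl_sys_initial_value[OF S c h] by blast
  have L0: "f0 \<in> L2r S" by (rule inhomogeneous_solution_L2r[OF S LC sys0 h])
  note 0 = sl_sys_imp_dom_max[OF S sys0 L0 L2r_add[OF S L2r_scale[OF S L0] h]]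
  have m: "f1 \<in> dom_max S" "f2 \<in> dom_max S" using ker by (simp_all add: ker_max_def)
  have lin: "b (\<lambda>x. f x + g x) = b f + b g" "b (\<lambda>x. k * f x) = k * b f"
    if "b \<in> {b1, b2}" "f \<in> dom_max S" "g \<in> dom_max S" for b f g k
    using bc that by (auto simp: symmetric_bc_def)
  define comb where "comb = (\<lambda>k l x. k * f1 x + l * f2 x)"
  have comb: "comb k l \<in> ker_max S z" for k l
    unfolding comb_def by (intro ker_max_add_scale ker)
  have bcomb: "b (comb k l) = k * b f1 + l * b f2" if "b \<in> {b1, b2}" for b k l
    unfolding comb_def using lin[OF that] m dom_max_scale(1)[OF S] by simp
  have inj: "k = 0 \<and> l = 0" if "k * b1 f1 + l * b1 f2 = 0" "k * b2 f1 + l * b2 f2 = 0" for k l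
  proof -
    have z0: "comb k l = (\<lambda>x. 0)"
      by (rule symmetric_bc_kernel[OF bc z comb]) (use that in \<open>simp_all add: bcomb\<close>)
    have "sl_sys S (comb k l) (\<lambda>x. k * g1 x + l * g2 x) (\<lambda>x. k * (z * f1 x) + l * (z * f2 x))"
      unfolding comb_def by (intro sl_sys_add sl_sys_scale sys)
    from sl_sys_imp_regular(3)[OF S this]
    have q1: "quasi_deriv S (\<lambda>x. 0) c = k * g1 c + l * g2 c" using c z0 by simp
    have "sl_sys S (\<lambda>x. 0 * f1 x) (\<lambda>x. 0 * g1 x) (\<lambda>x. 0 * (z * f1 x))"
      by (intro sl_sys_scale sys)
    from sl_sys_imp_regular(3)[OF S this] have "quasi_deriv S (\<lambda>x. 0) c = 0" using c by simp
    with q1 have G: "k * g1 c + l * g2 c = 0" by simp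
    have F: "k * f1 c + l * f2 c = 0" using fun_cong[OF z0, of c] by (simp add: comb_def)
    have "k = k * (f1 c * g2 c - g1 c * f2 c)" using W[OF c] by simp
    also have "\<dots> = (k * f1 c + l * f2 c) * g2 c - (k * g1 c + l * g2 c) * f2 c"
      by (simp add: algebra_simps)
    finally have "k = 0" using F G by simp
    have "l = l * (f1 c * g2 c - g1 c * f2 c)" using W[OF c] by simp
    also have "\<dots> = (k * g1 c + l * g2 c) * f1 c - (k * f1 c + l * f2 c) * g1 c"
      by (simp add: algebra_simps)
    finally have "l = 0" using F G by simp
    with \<open>k = 0\<close> show ?thesis by simp
  qed
  define \<Delta> where "\<Delta> = b1 f1 * b2 f2 - b1 f2 * b2 f1"
  have \<Delta>: "\<Delta> \<noteq> 0"
  proof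
    assume "\<Delta> = 0"
    then have "b1 f2 = 0 \<and> - b1 f1 = 0" "b2 f2 = 0 \<and> - b2 f1 = 0"
      by (intro inj; simp add: \<Delta>_def algebra_simps)+
    then show False using inj[of 1 0] by simp
  qed
  \<comment> \<open>Cramer's rule\<close>
  define k where "k = (b1 f2 * b2 f0 - b2 f2 * b1 f0) / \<Delta>"
  define l where "l = (b2 f1 * b1 f0 - b1 f1 * b2 f0) / \<Delta>"
  let ?f = "\<lambda>x. f0 x + comb k l x"
  have cm: "comb k l \<in> dom_max S" using comb by (simp add: ker_max_def)
  have bf: "b ?f = b f0 + (k * b f1 + l * b f2)" if "b \<in> {b1, b2}" for b
    using lin(1)[OF that 0(1) cm] bcomb[OF that] by simp
  have kl: "\<Delta> * k = b1 f2 * b2 f0 - b2 f2 * b1 f0" "\<Delta> * l = b2 f1 * b1 f0 - b1 f1 * b2 f0"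
    using \<Delta> by (simp_all add: k_def l_def)
  have "\<Delta> * b1 ?f = \<Delta> * b1 f0 + (\<Delta> * k) * b1 f1 + (\<Delta> * l) * b1 f2"
    using bf[of b1] by (simp add: distrib_left mult.assoc)
  also have "\<dots> = 0" unfolding kl by (simp add: \<Delta>_def algebra_simps)
  finally have "b1 ?f = 0" using \<Delta> by simp
  have "\<Delta> * b2 ?f = \<Delta> * b2 f0 + (\<Delta> * k) * b2 f1 + (\<Delta> * l) * b2 f2"
    using bf[of b2] by (simp add: distrib_left mult.assoc)
  also have "\<dots> = 0" unfolding kl by (simp add: \<Delta>_def algebra_simps)
  finally have "b2 ?f = 0" using \<Delta> by simp
  note \<open>b1 ?f = 0\<close> this
  moreover have "?f \<in> dom_max S" by (rule dom_max_add(1)[OF S 0(1) cm])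
  moreover have "AE x in lebesgue_on (dom_int S). sl_tau S ?f x - z * ?f x = h x"
  proof -
    have "AE x in lebesgue_on (dom_int S). sl_tau S (comb k l) x - z * comb k l x = 0"
      using comb by (simp add: ker_max_def)
    with dom_max_add(3)[OF S 0(1) cm] 0(3) show ?thesis
      by eventually_elim (simp add: algebra_simps)
  qed
  ultimately show ?thesis by (intro bexI[of _ ?f]) (simp_all add: bc_domain_def)
qed

lemma nonreal_in_resolvent_set:
  assumes bc: "symmetric_bc S b1 b2" and z: "z \<notin> \<real>"
  shows "z \<in> resolvent_set S (bc_domain S b1 b2)"
  unfolding resolvent_set_def
proof (intro CollectI conjI ballI)
  fix h assume h: "h \<in> L2r S"
  show "\<exists>!f. f \<in> bc_domain S b1 b2 \<and> (AE x in lebesgue_on (dom_int S). sl_tau S f x - z * f x = h x)"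
    using resolvent_exists[OF bc z h] resolvent_unique[OF bc z, of _ h] by blast
next
  have t: "0 < \<bar>Im z\<bar>" using z by (simp add: complex_is_Real_iff)
  show "\<exists>C. \<forall>f\<in>bc_domain S b1 b2. L2r_norm S f \<le> C * L2r_norm S (\<lambda>x. sl_tau S f x - z * f x)"
  proof (intro exI[of _ "1 / \<bar>Im z\<bar>"] ballI)
    fix f assume "f \<in> bc_domain S b1 b2"
    from symmetric_bc_norm_bound[OF bc this, of z] t
    show "L2r_norm S f \<le> 1 / \<bar>Im z\<bar> * L2r_norm S (\<lambda>x. sl_tau S f x - z * f x)"
      by (simp add: field_simps)
  qed
qed

lemma resolvent_eqI:
  assumes bc: "symmetric_bc S b1 b2" and z: "z \<notin> \<real>"
    and f: "f \<in> bc_domain S b1 b2" "AE x in lebesgue_on (dom_int S). sl_tau S f x - z * f x = h x"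
  shows "resolvent S (bc_domain S b1 b2) z h = f"
  unfolding resolvent_def
  by (rule the_equality) (use f resolvent_unique[OF bc z, of _ h] in blast)+

lemma resolvent_props:
  assumes bc: "symmetric_bc S b1 b2" and z: "z \<notin> \<real>" and h: "h \<in> L2r S"
  shows "resolvent S (bc_domain S b1 b2) z h \<in> bc_domain S b1 b2"
    and "AE x in lebesgue_on (dom_int S).
      sl_tau S (resolvent S (bc_domain S b1 b2) z h) x - z * resolvent S (bc_domain S b1 b2) z h x = h x"
    and "\<bar>Im z\<bar> * L2r_norm S (resolvent S (bc_domain S b1 b2) z h) \<le> L2r_norm S h"
proof -
  obtain f where f: "f \<in> bc_domain S b1 b2" "AE x in lebesgue_on (dom_int S). sl_tau S f x - z * f x = h x"
    using resolvent_exists[OF assms] by blast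
  note eq = resolvent_eqI[OF bc z f]
  show "resolvent S (bc_domain S b1 b2) z h \<in> bc_domain S b1 b2"
    "AE x in lebesgue_on (dom_int S).
      sl_tau S (resolvent S (bc_domain S b1 b2) z h) x - z * resolvent S (bc_domain S b1 b2) z h x = h x"
    unfolding eq by (rule f)+
  have fm: "f \<in> dom_max S" using f by (simp add: bc_domain_def)
  have k: "(\<lambda>x. sl_tau S f x - z * f x) \<in> L2r S" by (rule tau_shift_L2r[OF fm])
  have "L2r_norm S (\<lambda>x. sl_tau S f x - z * f x) = L2r_norm S h"
  proof -
    have "(LINT x|r_measure S. (cmod (sl_tau S f x - z * f x))\<^sup>2) = (LINT x|r_measure S. (cmod (h x))\<^sup>2)"
    proof (rule integral_cong_AE)
      show "(\<lambda>x. (cmod (sl_tau S f x - z * f x))\<^sup>2) \<in> borel_measurable (r_measure S)"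
        "(\<lambda>x. (cmod (h x))\<^sup>2) \<in> borel_measurable (r_measure S)"
        using borel_measurable_integrable k h by (auto simp: L2r_iff[OF S])
      show "AE x in r_measure S. (cmod (sl_tau S f x - z * f x))\<^sup>2 = (cmod (h x))\<^sup>2"
        unfolding AE_r_measure_iff[OF S] using f(2) by eventually_elim simp
    qed
    then show ?thesis by (simp add: L2r_norm_def)
  qed
  then show "\<bar>Im z\<bar> * L2r_norm S (resolvent S (bc_domain S b1 b2) z h) \<le> L2r_norm S h"
    using symmetric_bc_norm_bound[OF bc f(1), of z] unfolding eq by simp
qed

end

end

section \<open>Projection onto the deficiency space\<close>

context
  fixes S :: sl_data
  assumes S: "sturm_liouville S"
    and LC: "limit_circle S Left_End" "limit_circle S Right_End"
begin

context
  fixes e1 e2 :: "real \<Rightarrow> complex"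
  assumes ker: "e1 \<in> ker_max S \<i>" "e2 \<in> ker_max S \<i>"
    and norm: "pairing S (\<lambda>x. cnj (e1 x)) e1 = 1" "pairing S (\<lambda>x. cnj (e2 x)) e2 = 1"
    and orth: "pairing S (\<lambda>x. cnj (e1 x)) e2 = 0" "pairing S (\<lambda>x. cnj (e2 x)) e1 = 0"
    and span: "\<forall>g\<in>ker_max S \<i>. \<exists>a b. g = (\<lambda>x. a * e1 x + b * e2 x)"
begin

lemma basis_L2r: "e1 \<in> L2r S" "e2 \<in> L2r S"
  "(\<lambda>x. cnj (e1 x)) \<in> L2r S" "(\<lambda>x. cnj (e2 x)) \<in> L2r S"
  using ker ker_max_L2r[OF S] L2r_cnj[OF S] by blast+

lemma pairing_combination:
  assumes "f \<in> L2r S"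
  shows "pairing S f (\<lambda>x. a * e1 x + b * e2 x) = a * pairing S f e1 + b * pairing S f e2"
  using pairing_add_right[OF S assms L2r_scale[OF S basis_L2r(1)] L2r_scale[OF S basis_L2r(2)]]
  by (simp add: pairing_scale_right[OF S])

lemma pairing_diff_right:
  assumes "f \<in> L2r S" "g \<in> L2r S" "h \<in> L2r S"
  shows "pairing S f (\<lambda>x. g x - h x) = pairing S f g - pairing S f h"
  using pairing_add_right[OF S assms(1,2) L2r_scale[OF S assms(3)], of "- 1"] pairing_scale_right[OF S, of f "- 1" h]
  by simp

lemma orth_proj_unique:
  assumes h: "h \<in> L2r S"
    and g: "g \<in> ker_max S \<i>" "\<forall>k\<in>ker_max S \<i>. L2r_inner S k (\<lambda>x. h x - g x) = 0"
    and g': "g' \<in> ker_max S \<i>" "\<forall>k\<in>ker_max S \<i>. L2r_inner S k (\<lambda>x. h x - g' x) = 0"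
  shows "g = g'"
proof -
  let ?d = "\<lambda>x. g x + (- 1) * g' x"
  have d: "?d \<in> ker_max S \<i>" by (intro ker_max_add_scale[OF S] g g')
  note L = ker_max_L2r[OF S d] L2r_cnj[OF S ker_max_L2r[OF S d]] ker_max_L2r[OF S g(1)] ker_max_L2r[OF S g'(1)]
  have "pairing S (\<lambda>x. cnj (?d x)) (\<lambda>x. h x - g x) = 0" "pairing S (\<lambda>x. cnj (?d x)) (\<lambda>x. h x - g' x) = 0"
    using bspec[OF g(2) d] bspec[OF g'(2) d] unfolding L2r_inner_eq_ip[OF S] .
  then have "pairing S (\<lambda>x. cnj (?d x)) g = pairing S (\<lambda>x. cnj (?d x)) g'"
    unfolding pairing_diff_right[OF L(2) h L(3)] pairing_diff_right[OF L(2) h L(4)] by simp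
  then have "pairing S (\<lambda>x. cnj (?d x)) ?d = 0"
    using pairing_add_right[OF S L(2,3) L2r_scale[OF S L(4)], of "- 1"] pairing_scale_right[OF S, of _ "- 1" g']
    by simp
  then have "complex_of_real ((L2r_norm S ?d)\<^sup>2) = 0" by (simp only: pairing_cnj_self[OF S L(1)])
  then have "L2r_norm S ?d = 0" by simp
  then have "?d = (\<lambda>x. 0)" by (rule dom_max_eq_zero[OF S ker_max_dom_max[OF S d]])
  then have "?d x = 0" for x by (rule fun_cong)
  then show ?thesis by (simp add: fun_eq_iff)
qed

text \<open>Existence, uniqueness and a formula for the orthogonal projection onto \<open>\<N>\<^sub>i\<close>, for a given
  orthonormal basis.\<close>

lemma orth_proj_eq:
  assumes h: "h \<in> L2r S"
  shows "orth_proj S (ker_max S \<i>) h =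
    (\<lambda>x. pairing S (\<lambda>x. cnj (e1 x)) h * e1 x + pairing S (\<lambda>x. cnj (e2 x)) h * e2 x)" 
    and "(\<lambda>x. pairing S (\<lambda>x. cnj (e1 x)) h * e1 x + pairing S (\<lambda>x. cnj (e2 x)) h * e2 x) \<in> ker_max S \<i>"
    and "k \<in> ker_max S \<i> \<Longrightarrow> L2r_inner S k (\<lambda>x. h x - (pairing S (\<lambda>x. cnj (e1 x)) h * e1 x + pairing S (\<lambda>x. cnj (e2 x)) h * e2 x)) = 0"
proof -
  let ?g = "(\<lambda>x. pairing S (\<lambda>x. cnj (e1 x)) h * e1 x + pairing S (\<lambda>x. cnj (e2 x)) h * e2 x)"
  show g: "?g \<in> ker_max S \<i>" by (intro ker_max_add_scale[OF S] ker)
  have gL: "?g \<in> L2r S" by (rule ker_max_L2r[OF S g])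
  have orthg: "L2r_inner S k (\<lambda>x. h x - ?g x) = 0" if k: "k \<in> ker_max S \<i>" for k
  proof -
    obtain a b where ab: "k = (\<lambda>x. a * e1 x + b * e2 x)" using bspec[OF span k] by blast
    have r: "pairing S (\<lambda>x. cnj (e1 x)) (\<lambda>x. h x - ?g x) = 0" "pairing S (\<lambda>x. cnj (e2 x)) (\<lambda>x. h x - ?g x) = 0"
      unfolding pairing_diff_right[OF basis_L2r(3) h gL] pairing_diff_right[OF basis_L2r(4) h gL]
        pairing_combination[OF basis_L2r(3)] pairing_combination[OF basis_L2r(4)] norm orth by simp_all
    have dL: "(\<lambda>x. h x - ?g x) \<in> L2r S" by (rule L2r_diff[OF S h gL])
    have "L2r_inner S k (\<lambda>x. h x - ?g x) = pairing S (\<lambda>x. h x - ?g x) (\<lambda>x. cnj a * cnj (e1 x) + cnj b * cnj (e2 x))"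
      unfolding L2r_inner_eq_ip[OF S] ab by (subst pairing_commute[OF S]) simp
    also have "\<dots> = cnj a * pairing S (\<lambda>x. h x - ?g x) (\<lambda>x. cnj (e1 x)) + cnj b * pairing S (\<lambda>x. h x - ?g x) (\<lambda>x. cnj (e2 x))"
      using pairing_add_right[OF S dL L2r_scale[OF S basis_L2r(3)] L2r_scale[OF S basis_L2r(4)]]
      by (simp only: pairing_scale_right[OF S])
    also have "\<dots> = 0"
      using r by (simp only: pairing_commute[OF S, of "\<lambda>x. h x - ?g x"] mult_zero_right add_0_right)
    finally show ?thesis .
  qed
  then show "k \<in> ker_max S \<i> \<Longrightarrow> L2r_inner S k (\<lambda>x. h x - ?g x) = 0" .
  show "orth_proj S (ker_max S \<i>) h = ?g"
    unfolding orth_proj_def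
  proof (rule the_equality)
    show "?g \<in> ker_max S \<i> \<and> (\<forall>k\<in>ker_max S \<i>. L2r_inner S k (\<lambda>x. h x - ?g x) = 0)"
      using g orthg by blast
    fix g' assume "g' \<in> ker_max S \<i> \<and> (\<forall>k\<in>ker_max S \<i>. L2r_inner S k (\<lambda>x. h x - g' x) = 0)"
    then show "g' = ?g" using g orthg by (intro orth_proj_unique[OF h]) blast+
  qed
qed

lemma orth_proj_ker_max:
  assumes f: "f \<in> ker_max S \<i>"
  shows "orth_proj S (ker_max S \<i>) f = f"
proof -
  have fL: "f \<in> L2r S" by (rule ker_max_L2r[OF S f])
  show ?thesis
    unfolding orth_proj_def
  proof (rule the_equality)
    show "f \<in> ker_max S \<i> \<and> (\<forall>k\<in>ker_max S \<i>. L2r_inner S k (\<lambda>x. f x - f x) = 0)"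
      using f by (simp add: L2r_inner_def)
    fix g assume "g \<in> ker_max S \<i> \<and> (\<forall>k\<in>ker_max S \<i>. L2r_inner S k (\<lambda>x. f x - g x) = 0)"
    then show "g = f" using f by (intro orth_proj_unique[OF fL]) (simp_all add: L2r_inner_def)
  qed
qed

lemma orth_proj_norm_le:
  assumes h: "h \<in> L2r S"
  shows "L2r_norm S (orth_proj S (ker_max S \<i>) h) \<le> L2r_norm S h"
proof -
  let ?g = "orth_proj S (ker_max S \<i>) h"
  have g: "?g \<in> ker_max S \<i>" unfolding orth_proj_eq(1)[OF h] by (rule orth_proj_eq(2)[OF h])
  have gL: "?g \<in> L2r S" and cL: "(\<lambda>x. cnj (?g x)) \<in> L2r S"
    using ker_max_L2r[OF S g] L2r_cnj[OF S] by blast+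
  have "pairing S (\<lambda>x. cnj (?g x)) (\<lambda>x. h x - ?g x) = 0"
    using orth_proj_eq(3)[OF h g] unfolding L2r_inner_eq_ip[OF S] orth_proj_eq(1)[OF h] .
  then have "pairing S (\<lambda>x. cnj (?g x)) h = of_real ((L2r_norm S ?g)\<^sup>2)"
    unfolding pairing_diff_right[OF cL h gL] pairing_cnj_self[OF S gL] by simp
  then have "cmod (pairing S (\<lambda>x. cnj (?g x)) h) = (L2r_norm S ?g)\<^sup>2"
    by (simp only: norm_of_real abs_power2)
  moreover have "L2r_norm S (\<lambda>x. cnj (?g x)) = L2r_norm S ?g" by (simp add: L2r_norm_def)
  ultimately have "(L2r_norm S ?g)\<^sup>2 \<le> (L2r_norm S h)\<^sup>2"
    using cmod_pairing_le[OF S cL h zero_less_one] by simp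
  then show ?thesis by (rule power2_le_imp_le) (rule L2r_norm_nonneg[OF S])
qed

lemma donoghue_eq:
  assumes f: "f \<in> ker_max S \<i>"
  shows "donoghue S D z f = (\<lambda>x. z * f x + (z\<^sup>2 + 1) * orth_proj S (ker_max S \<i>) (resolvent S D z f) x)"
  unfolding donoghue_def orth_proj_ker_max[OF f] ..

text \<open>At \<open>z = i\<close> and \<open>z = -i\<close> the factor \<open>z\<^sup>2 + 1\<close> vanishes, whatever the domain.\<close>

lemma donoghue_at_i:
  assumes f: "f \<in> ker_max S \<i>"
  shows "donoghue S D \<i> f = (\<lambda>x. \<i> * f x)" "donoghue S D (- \<i>) f = (\<lambda>x. - \<i> * f x)"
  unfolding donoghue_eq[OF f] by simp_all

text \<open>If the resolvents of two extensions, applied to \<open>f\<close>, differ by a multiple of \<open>u\<close>, then the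
  \<open>m\<close>-functions differ by \<open>z\<^sup>2 + 1\<close> times the projection of that multiple.\<close>

lemma donoghue_resolvent_difference:
  assumes f: "f \<in> ker_max S \<i>" and u: "u \<in> L2r S" and R0: "resolvent S D0 z f \<in> L2r S"
    and R: "resolvent S D z f = (\<lambda>x. resolvent S D0 z f x + k * u x)"
  shows "donoghue S D z f = (\<lambda>x. donoghue S D0 z f x +
    k * ((z\<^sup>2 + 1) * pairing S (\<lambda>x. cnj (e1 x)) u * e1 x + (z\<^sup>2 + 1) * pairing S (\<lambda>x. cnj (e2 x)) u * e2 x))"
proof -
  have RL: "(\<lambda>x. resolvent S D0 z f x + k * u x) \<in> L2r S" by (rule L2r_add[OF S R0 L2r_scale[OF S u]])
  have *: "pairing S e (\<lambda>x. resolvent S D0 z f x + k * u x) = pairing S e (resolvent S D0 z f) + k * pairing S e u"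
    if "e \<in> L2r S" for e
    using pairing_add_right[OF S that R0 L2r_scale[OF S u]] by (simp only: pairing_scale_right[OF S])
  show ?thesis
    unfolding donoghue_eq[OF f] R orth_proj_eq(1)[OF RL] orth_proj_eq(1)[OF R0]
      *[OF basis_L2r(3)] *[OF basis_L2r(4)]
    by (simp add: algebra_simps)
qed

lemma bounded_op_on_donoghue:
  assumes bc: "symmetric_bc S b1 b2" and z: "z \<notin> \<real>"
  shows "bounded_op_on S (ker_max S \<i>) (donoghue S (bc_domain S b1 b2) z)"
proof -
  let ?N = "ker_max S \<i>" and ?R = "resolvent S (bc_domain S b1 b2) z" and ?P = "orth_proj S (ker_max S \<i>)"
  have RD: "?R f \<in> dom_max S" if "f \<in> ?N" for f
    using resolvent_props(1)[OF S LC bc z ker_max_L2r[OF S that]] by (simp add: bc_domain_def)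
  have RL: "?R f \<in> L2r S" if "f \<in> ?N" for f using dom_max_sl_sys(2)[OF S RD[OF that]] .
  have PN: "?P h \<in> ?N" if "h \<in> L2r S" for h
    unfolding orth_proj_eq(1)[OF that] by (rule orth_proj_eq(2)[OF that])
  have Radd: "?R (\<lambda>x. f x + g x) = (\<lambda>x. ?R f x + ?R g x)" if fg: "f \<in> ?N" "g \<in> ?N" for f g
  proof (rule resolvent_eqI[OF S LC bc z])
    note f = resolvent_props[OF S LC bc z ker_max_L2r[OF S fg(1)]]
      and g = resolvent_props[OF S LC bc z ker_max_L2r[OF S fg(2)]]
    show "(\<lambda>x. ?R f x + ?R g x) \<in> bc_domain S b1 b2" by (rule bc_domain_add_scale(1)[OF S bc f(1) g(1)])
    show "AE x in lebesgue_on (dom_int S). sl_tau S (\<lambda>x. ?R f x + ?R g x) x - z * (?R f x + ?R g x) = f x + g x"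
      using f(2) g(2) dom_max_add(3)[OF S RD[OF fg(1)] RD[OF fg(2)]]
      by eventually_elim (simp add: algebra_simps)
  qed
  have Rscale: "?R (\<lambda>x. c * f x) = (\<lambda>x. c * ?R f x)" if f': "f \<in> ?N" for c f
  proof (rule resolvent_eqI[OF S LC bc z])
    note f = resolvent_props[OF S LC bc z ker_max_L2r[OF S f']]
    show "(\<lambda>x. c * ?R f x) \<in> bc_domain S b1 b2" by (rule bc_domain_add_scale(2)[OF S bc f(1)])
    show "AE x in lebesgue_on (dom_int S). sl_tau S (\<lambda>x. c * ?R f x) x - z * (c * ?R f x) = c * f x"
      using f(2) dom_max_scale(3)[OF S RD[OF f'], of c]
    proof eventually_elim
      case (elim x)
      have "c * sl_tau S (?R f) x - z * (c * ?R f x) = c * (sl_tau S (?R f) x - z * ?R f x)"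
        by (simp add: algebra_simps)
      then show ?case using elim by simp
    qed
  qed
  show ?thesis
    unfolding bounded_op_on_def
  proof (intro conjI ballI allI)
    fix f assume f: "f \<in> ?N"
    show "donoghue S (bc_domain S b1 b2) z f \<in> ?N"
      unfolding donoghue_eq[OF f] by (intro ker_max_add_scale[OF S] f PN RL)
  next
    fix f g assume fg: "f \<in> ?N" "g \<in> ?N"
    have fg': "(\<lambda>x. f x + g x) \<in> ?N" by (rule ker_max_add_scale(1)[OF S fg])
    have "?P (\<lambda>x. ?R f x + ?R g x) = (\<lambda>x. ?P (?R f) x + ?P (?R g) x)"
      unfolding orth_proj_eq(1)[OF L2r_add[OF S RL[OF fg(1)] RL[OF fg(2)]]] orth_proj_eq(1)[OF RL[OF fg(1)]]
        orth_proj_eq(1)[OF RL[OF fg(2)]] pairing_add_right[OF S basis_L2r(3) RL[OF fg(1)] RL[OF fg(2)]]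
        pairing_add_right[OF S basis_L2r(4) RL[OF fg(1)] RL[OF fg(2)]]
      by (simp add: algebra_simps)
    then show "donoghue S (bc_domain S b1 b2) z (\<lambda>x. f x + g x) =
        (\<lambda>x. donoghue S (bc_domain S b1 b2) z f x + donoghue S (bc_domain S b1 b2) z g x)"
      unfolding donoghue_eq[OF fg'] donoghue_eq[OF fg(1)] donoghue_eq[OF fg(2)] Radd[OF fg]
      by (simp add: algebra_simps)
  next
    fix c f assume f: "f \<in> ?N"
    have f': "(\<lambda>x. c * f x) \<in> ?N" by (rule ker_max_add_scale(2)[OF S f])
    have "?P (\<lambda>x. c * ?R f x) = (\<lambda>x. c * ?P (?R f) x)"
      unfolding orth_proj_eq(1)[OF L2r_scale[OF S RL[OF f]]] orth_proj_eq(1)[OF RL[OF f]] pairing_scale_right[OF S]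
      by (simp add: algebra_simps)
    then show "donoghue S (bc_domain S b1 b2) z (\<lambda>x. c * f x) = (\<lambda>x. c * donoghue S (bc_domain S b1 b2) z f x)"
      unfolding donoghue_eq[OF f'] donoghue_eq[OF f] Rscale[OF f] by (simp add: algebra_simps)
  next
    have t: "0 < \<bar>Im z\<bar>" using z by (simp add: complex_is_Real_iff)
    show "\<exists>C. \<forall>f\<in>?N. L2r_norm S (donoghue S (bc_domain S b1 b2) z f) \<le> C * L2r_norm S f"
    proof (intro exI[of _ "2 * (cmod z + cmod (z\<^sup>2 + 1) / \<bar>Im z\<bar>)"] ballI)
      fix f assume f: "f \<in> ?N"
      have fL: "f \<in> L2r S" by (rule ker_max_L2r[OF S f])
      have PL: "?P (?R f) \<in> L2r S" by (rule ker_max_L2r[OF S PN[OF RL[OF f]]])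
      have "L2r_norm S (?R f) \<le> L2r_norm S f / \<bar>Im z\<bar>"
        using resolvent_props(3)[OF S LC bc z fL] t by (simp add: pos_le_divide_eq mult.commute)
      with orth_proj_norm_le[OF RL[OF f]] have P: "L2r_norm S (?P (?R f)) \<le> L2r_norm S f / \<bar>Im z\<bar>" by linarith
      have "L2r_norm S (donoghue S (bc_domain S b1 b2) z f)
          \<le> 2 * (L2r_norm S (\<lambda>x. z * f x) + L2r_norm S (\<lambda>x. (z\<^sup>2 + 1) * ?P (?R f) x))"
        unfolding donoghue_eq[OF f] by (intro L2r_norm_add_le[OF S] L2r_scale[OF S] fL PL)
      also have "\<dots> = 2 * (cmod z * L2r_norm S f + cmod (z\<^sup>2 + 1) * L2r_norm S (?P (?R f)))"
        by (simp only: L2r_norm_scale[OF S])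
      also have "\<dots> \<le> 2 * (cmod z * L2r_norm S f + cmod (z\<^sup>2 + 1) * (L2r_norm S f / \<bar>Im z\<bar>))"
        using P by (intro mult_left_mono add_left_mono) simp_all
      also have "\<dots> = 2 * (cmod z + cmod (z\<^sup>2 + 1) / \<bar>Im z\<bar>) * L2r_norm S f"
        by (simp add: algebra_simps)
      finally show "L2r_norm S (donoghue S (bc_domain S b1 b2) z f)
          \<le> 2 * (cmod z + cmod (z\<^sup>2 + 1) / \<bar>Im z\<bar>) * L2r_norm S f" .
    qed
  qed
qed

end

end

section \<open>Self-adjoint boundary conditions and Krein formulas\<close>

text \<open>A real separated boundary condition \<open>c x + s y = 0\<close> makes the boundary values \<open>x, y\<close> proportional
  to real numbers.\<close>

lemma separated_bc_symmetric_form: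
  fixes c s :: real and x y :: complex
  assumes cs: "c\<^sup>2 + s\<^sup>2 = 1" and 0: "of_real c * x + of_real s * y = 0"
  shows "cnj x * y = cnj y * x"
proof -
  have 1: "of_real c * x = - (of_real s * y)" using 0 by (simp add: eq_neg_iff_add_eq_0)
  have 2: "of_real c * cnj x = - (of_real s * cnj y)" using arg_cong[OF 1, of cnj] by simp
  have u: "of_real c * of_real c + of_real s * of_real s = (1 :: complex)"
    using arg_cong[OF cs, of complex_of_real] by (simp add: power2_eq_square)
  have "cnj x * y = (of_real c * of_real c + of_real s * of_real s) * (cnj x * y)" by (simp add: u)
  also have "\<dots> = of_real c * (of_real c * cnj x) * y + of_real s * cnj x * (of_real s * y)"
    by (simp add: algebra_simps)
  also have "\<dots> = of_real c * (- (of_real s * cnj y)) * y + of_real s * cnj x * (- (of_real c * x))"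
    unfolding 2 using 1 by simp
  also have "\<dots> = of_real c * cnj y * (- (of_real s * y)) + of_real s * (- (of_real c * cnj x)) * x"
    by (simp add: algebra_simps)
  also have "\<dots> = of_real c * cnj y * (of_real c * x) + of_real s * (of_real s * cnj y) * x"
    unfolding 1 2 by simp
  also have "\<dots> = (of_real c * of_real c + of_real s * of_real s) * (cnj y * x)"
    by (simp add: algebra_simps)
  finally show ?thesis by (simp add: u)
qed

context
  fixes S :: sl_data and v :: ref_pair
  assumes S: "sturm_liouville S" and v: "boundary_reference S v"
begin

lemma wronskian_at_cnj_self:
  assumes "f \<in> dom_max S"
  shows "wronskian_at S (\<lambda>x. cnj (f x)) f d = cnj (bval S v f d) * bval' S v f d - cnj (bval' S v f d) * bval S v f d"
  using wronskian_at_bval[OF S v dom_max_cnj(1)[OF S assms] assms] bval_linear(5,6)[OF S v assms assms]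
  by simp

lemma dom_sep_bc_domain:
  "dom_sep S v \<alpha> \<beta> = bc_domain S
     (\<lambda>g. of_real (cos \<alpha>) * bval S v g Left_End + of_real (sin \<alpha>) * bval' S v g Left_End)
     (\<lambda>g. of_real (cos \<beta>) * bval S v g Right_End + of_real (sin \<beta>) * bval' S v g Right_End)"
  by (simp add: dom_sep_def bc_domain_def)

lemma symmetric_bc_sep:
  "symmetric_bc S
     (\<lambda>g. of_real (cos \<alpha>) * bval S v g Left_End + of_real (sin \<alpha>) * bval' S v g Left_End)
     (\<lambda>g. of_real (cos \<beta>) * bval S v g Right_End + of_real (sin \<beta>) * bval' S v g Right_End)"
proof -
  have "wronskian_at S (\<lambda>x. cnj (f x)) f Left_End = 0" "wronskian_at S (\<lambda>x. cnj (f x)) f Right_End = 0"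
    if f: "f \<in> dom_sep S v \<alpha> \<beta>" for f
  proof -
    have m: "f \<in> dom_max S" using f by (simp add: dom_sep_def)
    have "cnj (bval S v f Left_End) * bval' S v f Left_End = cnj (bval' S v f Left_End) * bval S v f Left_End"
      by (rule separated_bc_symmetric_form[of "cos \<alpha>" "sin \<alpha>"]) (use f in \<open>simp_all add: dom_sep_def\<close>)
    moreover have "cnj (bval S v f Right_End) * bval' S v f Right_End = cnj (bval' S v f Right_End) * bval S v f Right_End"
      by (rule separated_bc_symmetric_form[of "cos \<beta>" "sin \<beta>"]) (use f in \<open>simp_all add: dom_sep_def\<close>)
    ultimately show "wronskian_at S (\<lambda>x. cnj (f x)) f Left_End = 0" "wronskian_at S (\<lambda>x. cnj (f x)) f Right_End = 0"
      unfolding wronskian_at_cnj_self[OF m] by simp_all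
  qed
  then show ?thesis
    unfolding symmetric_bc_def dom_sep_bc_domain
    by (auto simp: bval_linear[OF S v] algebra_simps)
qed

lemma dom_coupled_bc_domain:
  fixes R :: "real^2^2"
  shows "dom_coupled S v \<phi> R = bc_domain S
     (\<lambda>g. bval S v g Right_End -
       cis \<phi> * (of_real (R$1$1) * bval S v g Left_End + of_real (R$1$2) * bval' S v g Left_End))
     (\<lambda>g. bval' S v g Right_End -
       cis \<phi> * (of_real (R$2$1) * bval S v g Left_End + of_real (R$2$2) * bval' S v g Left_End))"
  by (simp add: dom_coupled_def bc_domain_def)

text \<open>The boundary form is multiplied by \<open>\<bar>e\<^sup>i\<^sup>\<phi>\<bar>\<^sup>2 det R = 1\<close> in passing from one endpoint to the other.\<close>

lemma symmetric_bc_coupled: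
  fixes R :: "real^2^2"
  assumes R: "det R = 1"
  shows "symmetric_bc S
     (\<lambda>g. bval S v g Right_End -
       cis \<phi> * (of_real (R$1$1) * bval S v g Left_End + of_real (R$1$2) * bval' S v g Left_End))
     (\<lambda>g. bval' S v g Right_End -
       cis \<phi> * (of_real (R$2$1) * bval S v g Left_End + of_real (R$2$2) * bval' S v g Left_End))"
proof -
  have "wronskian_at S (\<lambda>x. cnj (f x)) f Right_End = wronskian_at S (\<lambda>x. cnj (f x)) f Left_End"
    if f: "f \<in> dom_coupled S v \<phi> R" for f
  proof -
    have m: "f \<in> dom_max S" using f by (simp add: dom_coupled_def)
    define x where "x = bval S v f Left_End"
    define y where "y = bval' S v f Left_End"
    define w where "w = cis \<phi>"
    have w: "cnj w * w = 1" by (simp add: w_def cis_cnj cis_mult)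
    have "of_real (R$1$1 * R$2$2 - R$1$2 * R$2$1) = (1 :: complex)" using R by (simp add: det_2)
    then have d: "of_real (R$1$1) * of_real (R$2$2) - of_real (R$1$2) * of_real (R$2$1) = (1 :: complex)" by simp
    have X: "bval S v f Right_End = w * (of_real (R$1$1) * x + of_real (R$1$2) * y)"
      and Y: "bval' S v f Right_End = w * (of_real (R$2$1) * x + of_real (R$2$2) * y)"
      using f by (simp_all add: dom_coupled_def x_def y_def w_def)
    have "cnj (bval S v f Right_End) * bval' S v f Right_End - cnj (bval' S v f Right_End) * bval S v f Right_End
      = (cnj w * w) * ((of_real (R$1$1) * of_real (R$2$2) - of_real (R$1$2) * of_real (R$2$1)) * (cnj x * y - cnj y * x))"
      unfolding X Y by (simp add: algebra_simps)
    also have "\<dots> = cnj x * y - cnj y * x" by (simp add: w d)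
    finally show ?thesis unfolding wronskian_at_cnj_self[OF m] x_def y_def .
  qed
  then show ?thesis
    unfolding symmetric_bc_def dom_coupled_bc_domain
    by (auto simp: bval_linear[OF S v] algebra_simps)
qed

end

text \<open>The limit circle case at both endpoints, with the solutions \<open>u\<^sub>1, u\<^sub>2\<close> normalized by their first
  generalized boundary values.\<close>

locale donoghue_setting =
  fixes S :: sl_data and v :: ref_pair and u1 u2 :: "complex \<Rightarrow> real \<Rightarrow> complex"
  assumes S: "sturm_liouville S"
    and LC: "limit_circle S Left_End" "limit_circle S Right_End"
    and v: "boundary_reference S v"
    and u1: "\<And>z. z \<in> resolvent_set S (dom_sep S v 0 0) \<Longrightarrow>
           sl_solution S z (u1 z) \<and> bval S v (u1 z) Left_End = 0 \<and> bval S v (u1 z) Right_End = 1"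
    and u2: "\<And>z. z \<in> resolvent_set S (dom_sep S v 0 0) \<Longrightarrow>
           sl_solution S z (u2 z) \<and> bval S v (u2 z) Left_End = 1 \<and> bval S v (u2 z) Right_End = 0"
begin

lemma nonreal_resolvent_set: "z \<notin> \<real> \<Longrightarrow> z \<in> resolvent_set S (dom_sep S v 0 0)"
  unfolding dom_sep_bc_domain[OF S v] by (rule nonreal_in_resolvent_set[OF S LC symmetric_bc_sep[OF S v]])

lemma u_ker_max:
  assumes "z \<notin> \<real>"
  shows "u1 z \<in> ker_max S z" "u2 z \<in> ker_max S z"
    and "bval S v (u1 z) Left_End = 0" "bval S v (u1 z) Right_End = 1"
    and "bval S v (u2 z) Left_End = 1" "bval S v (u2 z) Right_End = 0"
  using u1[OF nonreal_resolvent_set[OF assms]] u2[OF nonreal_resolvent_set[OF assms]]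
    sl_solution_ker_max[OF S LC] by blast+

lemma u_dom_max:
  assumes "z \<notin> \<real>"
  shows "u1 z \<in> dom_max S" "u2 z \<in> dom_max S" "u1 z \<in> L2r S" "u2 z \<in> L2r S"
  using u_ker_max(1,2)[OF assms] ker_max_dom_max[OF S] ker_max_L2r[OF S] by blast+

lemma ker_max_zero_boundary:
  assumes z: "z \<notin> \<real>" and g: "g \<in> ker_max S z" "bval S v g Left_End = 0" "bval S v g Right_End = 0"
  shows "g = (\<lambda>x. 0)"
  by (rule symmetric_bc_kernel[OF S symmetric_bc_sep[OF S v, of 0 0] z g(1)]) (simp_all add: g)

text \<open>For nonreal \<open>z\<close> a solution is determined by its first generalized boundary values, as \<open>T\<^sub>0\<^sub>,\<^sub>0\<close> has no
  nonreal eigenvalues.\<close>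

lemma ker_max_expand:
  assumes z: "z \<notin> \<real>" and g: "g \<in> ker_max S z"
  shows "g = (\<lambda>x. bval S v g Right_End * u1 z x + bval S v g Left_End * u2 z x)"
proof -
  note u = u_ker_max[OF z]
  define w where "w = (\<lambda>x. (- bval S v g Right_End) * u1 z x + (- bval S v g Left_End) * u2 z x)"
  have w: "w \<in> ker_max S z" unfolding w_def by (intro ker_max_add_scale[OF S] u)
  note m = ker_max_dom_max[OF S g] ker_max_dom_max[OF S w]
  have bw: "bval S v w d = (- bval S v g Right_End) * bval S v (u1 z) d + (- bval S v g Left_End) * bval S v (u2 z) d" for d
    unfolding w_def using u_dom_max[OF z] dom_max_scale(1)[OF S]
    by (simp only: bval_linear[OF S v])
  have "(\<lambda>x. g x + w x) = (\<lambda>x. 0)"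
  proof (rule ker_max_zero_boundary[OF z ker_max_add_scale(1)[OF S g w]])
    show "bval S v (\<lambda>x. g x + w x) Left_End = 0" "bval S v (\<lambda>x. g x + w x) Right_End = 0"
      using u by (simp_all add: bval_linear(1)[OF S v m] bw)
  qed
  then have "g x + w x = 0" for x by (rule fun_cong)
  then show ?thesis by (simp add: fun_eq_iff w_def eq_neg_iff_add_eq_0 algebra_simps)
qed

lemma u_cnj:
  assumes z: "z \<notin> \<real>"
  shows "(\<lambda>x. cnj (u1 (cnj z) x)) = u1 z" "(\<lambda>x. cnj (u2 (cnj z) x)) = u2 z"
proof -
  have z': "cnj z \<notin> \<real>" using z by (simp add: complex_is_Real_iff)
  note u = u_ker_max[OF z'] and m = u_dom_max[OF z']
  have k: "(\<lambda>x. cnj (u1 (cnj z) x)) \<in> ker_max S z" "(\<lambda>x. cnj (u2 (cnj z) x)) \<in> ker_max S z"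
    using ker_max_cnj[OF S u(1)] ker_max_cnj[OF S u(2)] by simp_all
  show "(\<lambda>x. cnj (u1 (cnj z) x)) = u1 z"
    using ker_max_expand[OF z k(1)] u by (simp add: bval_linear(5)[OF S v m(1) m(1)])
  show "(\<lambda>x. cnj (u2 (cnj z) x)) = u2 z"
    using ker_max_expand[OF z k(2)] u by (simp add: bval_linear(5)[OF S v m(2) m(2)])
qed

text \<open>Green's formula, with both boundary terms written in generalized boundary values.\<close>

lemma green_ker_max:
  assumes f: "f \<in> ker_max S w" and g: "g \<in> dom_max S"
    and h: "h \<in> L2r S" and ae: "AE x in lebesgue_on (dom_int S). sl_tau S g x - z * g x = h x"
  shows "(bval S v f Right_End * bval' S v g Right_End - bval' S v f Right_End * bval S v g Right_End)
       - (bval S v f Left_End * bval' S v g Left_End - bval' S v f Left_End * bval S v g Left_End)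
       = (w - z) * pairing S f g - pairing S f h"
proof -
  have fm: "f \<in> dom_max S" by (rule ker_max_dom_max[OF S f])
  note fL = dom_max_sl_sys(2)[OF S fm] and gL = dom_max_sl_sys(2)[OF S g]
  have fae: "AE x in lebesgue_on (dom_int S). w * f x = sl_tau S f x"
  proof -
    have "AE x in lebesgue_on (dom_int S). sl_tau S f x - w * f x = 0" using f by (simp add: ker_max_def)
    then show ?thesis by eventually_elim simp
  qed
  have gae: "AE x in lebesgue_on (dom_int S). z * g x + h x = sl_tau S g x"
    using ae by eventually_elim (simp add: algebra_simps)
  have "pairing S (sl_tau S f) g = pairing S g (sl_tau S f)" by (rule pairing_commute[OF S])
  also have "\<dots> = pairing S g (\<lambda>x. w * f x)" by (rule pairing_cong_ae[OF S gL L2r_scale[OF S fL] fae])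
  also have "\<dots> = w * pairing S f g" unfolding pairing_scale_right[OF S] by (simp only: pairing_commute[OF S, of g f])
  finally have 1: "pairing S (sl_tau S f) g = w * pairing S f g" .
  have "pairing S f (sl_tau S g) = pairing S f (\<lambda>x. z * g x + h x)"
    by (rule pairing_cong_ae[OF S fL L2r_add[OF S L2r_scale[OF S gL] h] gae])
  also have "\<dots> = z * pairing S f g + pairing S f h"
    unfolding pairing_add_right[OF S fL L2r_scale[OF S gL] h] pairing_scale_right[OF S] ..
  finally have 2: "pairing S f (sl_tau S g) = z * pairing S f g + pairing S f h" .
  show ?thesis
    using wronskian_limits(2)[OF S fm g] unfolding wronskian_at_bval[OF S v fm g] 1 2
    by (simp add: algebra_simps)
qed

lemma green_ker_max_ker_max:
  assumes f: "f \<in> ker_max S w" and g: "g \<in> ker_max S z"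
  shows "(bval S v f Right_End * bval' S v g Right_End - bval' S v f Right_End * bval S v g Right_End)
       - (bval S v f Left_End * bval' S v g Left_End - bval' S v f Left_End * bval S v g Left_End)
       = (w - z) * pairing S f g"
proof -
  have "AE x in lebesgue_on (dom_int S). sl_tau S g x - z * g x = 0" using g by (simp add: ker_max_def)
  from green_ker_max[OF f ker_max_dom_max[OF S g] zero_L2r[OF S] this] show ?thesis
    by (simp add: pairing_def[OF S])
qed

text \<open>The Wronskian of \<open>u\<^sub>1(z, \<cdot>)\<close> and \<open>u\<^sub>2(z, \<cdot>)\<close> has the same value at both endpoints.\<close>

lemma u_symmetry:
  assumes z: "z \<notin> \<real>"
  shows "bval' S v (u1 z) Left_End = - bval' S v (u2 z) Right_End"
  using green_ker_max_ker_max[OF u_ker_max(1,2)[OF z]] u_ker_max[OF z]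
  by (simp add: eq_neg_iff_add_eq_0 add.commute)

text \<open>The boundary values of \<open>(T\<^sub>0\<^sub>,\<^sub>0 - z)\<^sup>-\<^sup>1 f\<close>. The second ones come from Green's formula, applied to
  \<open>u\<^sub>j(z, \<cdot>)\<close>, which is the conjugate of \<open>u\<^sub>j\<close> at the conjugate of \<open>z\<close>.\<close>

lemma resolvent_reference:
  assumes z: "z \<notin> \<real>" and f: "f \<in> L2r S"
  defines "g \<equiv> resolvent S (dom_sep S v 0 0) z f"
  shows "g \<in> dom_max S" "AE x in lebesgue_on (dom_int S). sl_tau S g x - z * g x = f x"
    and "bval S v g Left_End = 0" "bval S v g Right_End = 0"
    and "bval' S v g Left_End = L2r_inner S (u2 (cnj z)) f"
    and "bval' S v g Right_End = - L2r_inner S (u1 (cnj z)) f"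
proof -
  note r = resolvent_props[OF S LC symmetric_bc_sep[OF S v, of 0 0] z f,
      folded dom_sep_bc_domain[OF S v] g_def]
  show m: "g \<in> dom_max S" and b: "bval S v g Left_End = 0" "bval S v g Right_End = 0"
    using r(1) by (simp_all add: dom_sep_def)
  show ae: "AE x in lebesgue_on (dom_int S). sl_tau S g x - z * g x = f x" by (rule r(2))
  note u = u_ker_max[OF z]
  have "pairing S (u2 z) f = bval' S v g Left_End"
    using green_ker_max[OF u(2) m f ae] u b by simp
  then show "bval' S v g Left_End = L2r_inner S (u2 (cnj z)) f"
    unfolding L2r_inner_eq_ip[OF S] u_cnj[OF z] by simp
  have "pairing S (u1 z) f = - bval' S v g Right_End"
    using green_ker_max[OF u(1) m f ae] u b by (simp add: eq_neg_iff_add_eq_0 add.commute)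
  then show "bval' S v g Right_End = - L2r_inner S (u1 (cnj z)) f"
    unfolding L2r_inner_eq_ip[OF S] u_cnj[OF z] by simp
qed

text \<open>Krein's formula: the resolvents of two extensions differ by an element of the kernel, which
  the boundary conditions determine.\<close>

lemma resolvent_eq_reference_plus:
  assumes bc: "symmetric_bc S b1 b2" and z: "z \<notin> \<real>" and f: "f \<in> L2r S" and w: "w \<in> ker_max S z"
  defines "g \<equiv> resolvent S (dom_sep S v 0 0) z f"
  assumes b: "b1 (\<lambda>x. g x + w x) = 0" "b2 (\<lambda>x. g x + w x) = 0"
  shows "resolvent S (bc_domain S b1 b2) z f = (\<lambda>x. g x + w x)"
proof (rule resolvent_eqI[OF S LC bc z])
  note g = resolvent_reference[OF z f, folded g_def] and wm = ker_max_dom_max[OF S w]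
  show "(\<lambda>x. g x + w x) \<in> bc_domain S b1 b2"
    using dom_max_add(1)[OF S g(1) wm] b by (simp add: bc_domain_def)
  have "AE x in lebesgue_on (dom_int S). sl_tau S w x - z * w x = 0" using w by (simp add: ker_max_def)
  with g(2) dom_max_add(3)[OF S g(1) wm]
  show "AE x in lebesgue_on (dom_int S). sl_tau S (\<lambda>x. g x + w x) x - z * (g x + w x) = f x"
    by eventually_elim (simp add: algebra_simps)
qed

lemma bval_reference_plus_scale:
  assumes "g \<in> dom_max S" "u \<in> dom_max S"
  shows "bval S v (\<lambda>x. g x + k * u x) d = bval S v g d + k * bval S v u d"
    and "bval' S v (\<lambda>x. g x + k * u x) d = bval' S v g d + k * bval' S v u d"
  using bval_linear(1,2)[OF S v assms(1) dom_max_scale(1)[OF S assms(2), of k]]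
    bval_linear(3,4)[OF S v assms(2) assms(2), of k] by simp_all

lemma resolvent_sep_left:
  assumes \<alpha>: "0 < \<alpha>" "\<alpha> < pi" and z: "z \<notin> \<real>" and f: "f \<in> L2r S"
  shows "resolvent S (dom_sep S v \<alpha> 0) z f = (\<lambda>x. resolvent S (dom_sep S v 0 0) z f x +
    (- L2r_inner S (u2 (cnj z)) f / (of_real (cot \<alpha>) + bval' S v (u2 z) Left_End)) * u2 z x)"
proof -
  note u = u_ker_max[OF z] and m = u_dom_max[OF z] and g = resolvent_reference[OF z f]
  note bc = symmetric_bc_sep[OF S v, of \<alpha> 0]
  have s: "sin \<alpha> \<noteq> 0" using sin_gt_zero[OF \<alpha>] by simp
  have cs: "complex_of_real (cos \<alpha>) = of_real (sin \<alpha>) * of_real (cot \<alpha>)"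
    using s by (simp add: cot_def)
  define D where "D = of_real (cot \<alpha>) + bval' S v (u2 z) Left_End"
  have D: "D \<noteq> 0"
  proof
    assume "D = 0"
    then have "complex_of_real (cos \<alpha>) * bval S v (u2 z) Left_End + of_real (sin \<alpha>) * bval' S v (u2 z) Left_End = 0"
      unfolding u cs D_def by (simp flip: distrib_left)
    then have "u2 z = (\<lambda>x. 0)"
      by (intro symmetric_bc_kernel[OF S bc z u(2)]) (simp_all add: u)
    then show False using u(3,5) bval_linear(3)[OF S v m(1) m(1), of 0] by simp
  qed
  define k where "k = - L2r_inner S (u2 (cnj z)) f / D"
  have "resolvent S (dom_sep S v \<alpha> 0) z f = (\<lambda>x. resolvent S (dom_sep S v 0 0) z f x + k * u2 z x)"
    unfolding dom_sep_bc_domain[OF S v, of \<alpha>]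
  proof (rule resolvent_eq_reference_plus[OF bc z f ker_max_add_scale(2)[OF S u(2)]])
    have "k * D = - L2r_inner S (u2 (cnj z)) f" using D by (simp add: k_def)
    then have kD: "k * of_real (cot \<alpha>) + k * bval' S v (u2 z) Left_End + L2r_inner S (u2 (cnj z)) f = 0"
      by (simp add: D_def distrib_left)
    have "of_real (sin \<alpha>) * of_real (cot \<alpha>) * k +
        of_real (sin \<alpha>) * (L2r_inner S (u2 (cnj z)) f + k * bval' S v (u2 z) Left_End)
        = of_real (sin \<alpha>) * (k * of_real (cot \<alpha>) + k * bval' S v (u2 z) Left_End + L2r_inner S (u2 (cnj z)) f)"
      by (simp add: algebra_simps)
    also have "\<dots> = 0" unfolding kD by simp
    finally show "complex_of_real (cos \<alpha>) * bval S v (\<lambda>x. resolvent S (dom_sep S v 0 0) z f x + k * u2 z x) Left_End +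
       of_real (sin \<alpha>) * bval' S v (\<lambda>x. resolvent S (dom_sep S v 0 0) z f x + k * u2 z x) Left_End = 0"
      unfolding bval_reference_plus_scale[OF g(1) m(2)] g(3,5) u(5) cs by simp
    show "complex_of_real (cos 0) * bval S v (\<lambda>x. resolvent S (dom_sep S v 0 0) z f x + k * u2 z x) Right_End +
       of_real (sin 0) * bval' S v (\<lambda>x. resolvent S (dom_sep S v 0 0) z f x + k * u2 z x) Right_End = 0"
      unfolding bval_reference_plus_scale[OF g(1) m(2)] g(4) u(6) by simp
  qed
  then show ?thesis by (simp add: k_def D_def)
qed

lemma resolvent_sep_right:
  assumes \<beta>: "0 < \<beta>" "\<beta> < pi" and z: "z \<notin> \<real>" and f: "f \<in> L2r S"
  shows "resolvent S (dom_sep S v 0 \<beta>) z f = (\<lambda>x. resolvent S (dom_sep S v 0 0) z f x +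
    (L2r_inner S (u1 (cnj z)) f / (of_real (cot \<beta>) + bval' S v (u1 z) Right_End)) * u1 z x)"
proof -
  note u = u_ker_max[OF z] and m = u_dom_max[OF z] and g = resolvent_reference[OF z f]
  note bc = symmetric_bc_sep[OF S v, of 0 \<beta>]
  have s: "sin \<beta> \<noteq> 0" using sin_gt_zero[OF \<beta>] by simp
  have cs: "complex_of_real (cos \<beta>) = of_real (sin \<beta>) * of_real (cot \<beta>)"
    using s by (simp add: cot_def)
  define D where "D = of_real (cot \<beta>) + bval' S v (u1 z) Right_End"
  have D: "D \<noteq> 0"
  proof
    assume "D = 0"
    then have "complex_of_real (cos \<beta>) * bval S v (u1 z) Right_End + of_real (sin \<beta>) * bval' S v (u1 z) Right_End = 0"
      unfolding u cs D_def by (simp flip: distrib_left)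
    then have "u1 z = (\<lambda>x. 0)"
      by (intro symmetric_bc_kernel[OF S bc z u(1)]) (simp_all add: u)
    then show False using u(4,6) bval_linear(3)[OF S v m(2) m(2), of 0] by simp
  qed
  define k where "k = L2r_inner S (u1 (cnj z)) f / D"
  have "resolvent S (dom_sep S v 0 \<beta>) z f = (\<lambda>x. resolvent S (dom_sep S v 0 0) z f x + k * u1 z x)"
    unfolding dom_sep_bc_domain[OF S v, of _ \<beta>]
  proof (rule resolvent_eq_reference_plus[OF bc z f ker_max_add_scale(2)[OF S u(1)]])
    have "k * D = L2r_inner S (u1 (cnj z)) f" using D by (simp add: k_def)
    then have kD: "k * of_real (cot \<beta>) + k * bval' S v (u1 z) Right_End - L2r_inner S (u1 (cnj z)) f = 0"
      by (simp add: D_def distrib_left)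
    have "of_real (sin \<beta>) * of_real (cot \<beta>) * k +
        of_real (sin \<beta>) * (- L2r_inner S (u1 (cnj z)) f + k * bval' S v (u1 z) Right_End)
        = of_real (sin \<beta>) * (k * of_real (cot \<beta>) + k * bval' S v (u1 z) Right_End - L2r_inner S (u1 (cnj z)) f)"
      by (simp add: algebra_simps)
    also have "\<dots> = 0" unfolding kD by simp
    finally show "complex_of_real (cos \<beta>) * bval S v (\<lambda>x. resolvent S (dom_sep S v 0 0) z f x + k * u1 z x) Right_End +
       of_real (sin \<beta>) * bval' S v (\<lambda>x. resolvent S (dom_sep S v 0 0) z f x + k * u1 z x) Right_End = 0"
      unfolding bval_reference_plus_scale[OF g(1) m(1)] g(4,6) u(4) cs by simp
    show "complex_of_real (cos 0) * bval S v (\<lambda>x. resolvent S (dom_sep S v 0 0) z f x + k * u1 z x) Left_End +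
       of_real (sin 0) * bval' S v (\<lambda>x. resolvent S (dom_sep S v 0 0) z f x + k * u1 z x) Left_End = 0"
      unfolding bval_reference_plus_scale[OF g(1) m(1)] g(3) u(3) by simp
  qed
  then show ?thesis by (simp add: k_def D_def)
qed

end

context donoghue_setting
begin

lemma resolvent_coupled:
  fixes R :: "real^2^2"
  assumes R: "det R = 1" "R$1$2 = 0" and z: "z \<notin> \<real>" and f: "f \<in> L2r S"
    and U: "\<And>\<zeta>. U \<zeta> = (\<lambda>x. cis (-\<phi>) * of_real (R$2$2) * u2 \<zeta> x + u1 \<zeta> x)"
    and K: "K = - of_real (R$2$1 * R$2$2) - cis \<phi> * of_real (R$2$2) * bval' S v (U z) Left_End
           + bval' S v (U z) Right_End"
  shows "U z \<in> ker_max S z"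
    and "resolvent S (dom_coupled S v \<phi> R) z f = (\<lambda>x. resolvent S (dom_sep S v 0 0) z f x +
      (L2r_inner S (U (cnj z)) f / K) * U z x)"
proof -
  note u = u_ker_max[OF z] and m = u_dom_max[OF z] and g = resolvent_reference[OF z f]
  note bc = symmetric_bc_coupled[OF S v R(1), of \<phi>]
  have z': "cnj z \<notin> \<real>" using z by (simp add: complex_is_Real_iff)
  define a where "a = complex_of_real (R$2$2)"
  define e where "e = cis \<phi>"
  define e' where "e' = cis (-\<phi>)"
  have ee: "e * e' = 1" "cnj e' = e" by (simp_all add: e_def e'_def cis_mult cis_cnj)
  have "R$1$1 * R$2$2 = 1" using R by (simp add: det_2)
  then have "complex_of_real (R$1$1 * R$2$2) = 1" by (simp only: of_real_1)
  then have Ra: "complex_of_real (R$1$1) * a = 1" by (simp add: a_def)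
  have U': "U \<zeta> = (\<lambda>x. (e' * a) * u2 \<zeta> x + u1 \<zeta> x)" for \<zeta> by (simp add: U e'_def a_def)
  show w: "U z \<in> ker_max S z" unfolding U' by (intro ker_max_add_scale[OF S] u)
  have wm: "U z \<in> dom_max S" by (rule ker_max_dom_max[OF S w])
  have bw: "bval S v (U z) Left_End = e' * a" "bval S v (U z) Right_End = 1"
    unfolding U' bval_linear(1)[OF S v dom_max_scale(1)[OF S m(2)] m(1)] bval_linear(3)[OF S v m(2) m(2)]
    by (simp_all add: u)
  have J: "L2r_inner S (U (cnj z)) f = e * a * L2r_inner S (u2 (cnj z)) f + L2r_inner S (u1 (cnj z)) f"
  proof -
    have "L2r_inner S (U (cnj z)) f = pairing S (\<lambda>x. (e * a) * cnj (u2 (cnj z) x) + cnj (u1 (cnj z) x)) f"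
      unfolding L2r_inner_eq_ip[OF S] U' by (simp add: ee(2) a_def)
    also have "\<dots> = pairing S f (\<lambda>x. (e * a) * cnj (u2 (cnj z) x) + cnj (u1 (cnj z) x))" by (rule pairing_commute[OF S])
    also have "\<dots> = e * a * pairing S f (\<lambda>x. cnj (u2 (cnj z) x)) + pairing S f (\<lambda>x. cnj (u1 (cnj z) x))"
      unfolding pairing_add_right[OF S f L2r_scale[OF S L2r_cnj[OF S u_dom_max(4)[OF z']]] L2r_cnj[OF S u_dom_max(3)[OF z']]]
        pairing_scale_right[OF S] ..
    finally show ?thesis by (simp only: L2r_inner_eq_ip[OF S] pairing_commute[OF S, of f])
  qed
  have K': "K = - (of_real (R$2$1) * a) - e * a * bval' S v (U z) Left_End + bval' S v (U z) Right_End"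
    by (simp add: K e_def a_def)
  have b1: "X - cis \<phi> * (of_real (R$1$1) * (e' * a * X) + of_real (R$1$2) * Y) = 0" for X Y
  proof -
    have "X - cis \<phi> * (of_real (R$1$1) * (e' * a * X) + of_real (R$1$2) * Y)
        = X - (e * e') * (of_real (R$1$1) * a) * X"
      by (simp add: R(2) e_def mult_ac)
    then show ?thesis by (simp add: ee Ra)
  qed
  have b2: "(- I1 + k * bval' S v (U z) Right_End) -
      cis \<phi> * (of_real (R$2$1) * (k * (e' * a)) + of_real (R$2$2) * (I2 + k * bval' S v (U z) Left_End))
      = k * K - (e * a * I2 + I1)" for k I1 I2
  proof -
    have "(- I1 + k * bval' S v (U z) Right_End) -
      cis \<phi> * (of_real (R$2$1) * (k * (e' * a)) + of_real (R$2$2) * (I2 + k * bval' S v (U z) Left_End))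
      = k * (- ((e * e') * of_real (R$2$1) * a) - e * a * bval' S v (U z) Left_End + bval' S v (U z) Right_End)
        - (e * a * I2 + I1)"
      by (simp add: e_def a_def algebra_simps)
    then show ?thesis by (simp add: ee K')
  qed
  have K0: "K \<noteq> 0"
  proof
    assume "K = 0"
    have "U z = (\<lambda>x. 0)"
    proof (rule symmetric_bc_kernel[OF S bc z w])
      show "bval S v (U z) Right_End - cis \<phi> * (of_real (R$1$1) * bval S v (U z) Left_End + of_real (R$1$2) * bval' S v (U z) Left_End) = 0"
        using b1[of 1] by (simp add: bw)
      show "bval' S v (U z) Right_End - cis \<phi> * (of_real (R$2$1) * bval S v (U z) Left_End + of_real (R$2$2) * bval' S v (U z) Left_End) = 0"
        using b2[of 0 1 0] \<open>K = 0\<close> by (simp add: bw)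
    qed
    then show False using bw(2) bval_linear(3)[OF S v wm wm, of 0] by simp
  qed
  define k where "k = L2r_inner S (U (cnj z)) f / K"
  have kK: "k * K = e * a * L2r_inner S (u2 (cnj z)) f + L2r_inner S (u1 (cnj z)) f"
    using K0 by (simp add: k_def J)
  have "resolvent S (dom_coupled S v \<phi> R) z f = (\<lambda>x. resolvent S (dom_sep S v 0 0) z f x + k * U z x)"
    unfolding dom_coupled_bc_domain[OF S v, of \<phi>]
  proof (rule resolvent_eq_reference_plus[OF bc z f ker_max_add_scale(2)[OF S w]])
    let ?g = "\<lambda>x. resolvent S (dom_sep S v 0 0) z f x + k * U z x"
    note bg = bval_reference_plus_scale[OF g(1) wm, of k]
    show "bval S v ?g Right_End - cis \<phi> * (of_real (R$1$1) * bval S v ?g Left_End + of_real (R$1$2) * bval' S v ?g Left_End) = 0"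
      unfolding bg g(3,4) bw using b1[of k 0] R(2) by (simp add: mult_ac)
    show "bval' S v ?g Right_End - cis \<phi> * (of_real (R$2$1) * bval S v ?g Left_End + of_real (R$2$2) * bval' S v ?g Left_End) = 0"
      unfolding bg g(3,5,6) bw using b2[of "L2r_inner S (u1 (cnj z)) f" k "L2r_inner S (u2 (cnj z)) f"] kK by simp
  qed
  then show "resolvent S (dom_coupled S v \<phi> R) z f = (\<lambda>x. resolvent S (dom_sep S v 0 0) z f x +
      (L2r_inner S (U (cnj z)) f / K) * U z x)" by (simp add: k_def)
qed

end

section \<open>The orthonormal basis of the deficiency space\<close>

text \<open>The Gram-Schmidt basis \<open>e 1, e 2\<close> of \<open>\<N>\<^sub>i\<close> and the coefficient functions \<open>W\<close>.\<close>

locale donoghue_basis = donoghue_setting +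
  fixes c1 c2 \<kappa> :: real and e :: "nat \<Rightarrow> real \<Rightarrow> complex" and W :: "nat \<Rightarrow> nat \<Rightarrow> complex \<Rightarrow> complex"
  assumes kappa: "\<kappa> = Im (bval' S v (u2 \<i>) Right_End) / Im (bval' S v (u1 \<i>) Right_End)"
    and c1: "c1 = inverse (L2r_norm S (u1 \<i>))"
    and c2: "c2 = inverse (L2r_norm S (\<lambda>x. u2 \<i> x - of_real \<kappa> * u1 \<i> x))"
    and e1: "e 1 = (\<lambda>x. of_real c1 * u1 \<i> x)"
    and e2: "e 2 = (\<lambda>x. of_real c2 * (u2 \<i> x - of_real \<kappa> * u1 \<i> x))"
    and W11: "\<And>z. W 1 1 z = of_real c1 *
           (bval' S v (u1 z) Right_End - bval' S v (u1 (-\<i>)) Right_End)"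
    and W12: "\<And>z. W 1 2 z = of_real c1 *
           (bval' S v (u2 z) Right_End + bval' S v (u1 (-\<i>)) Left_End)"
    and W21: "\<And>z. W 2 1 z = - of_real c2 *
           (of_real \<kappa> * (bval' S v (u1 z) Right_End - bval' S v (u1 (-\<i>)) Right_End)
            + bval' S v (u2 (-\<i>)) Right_End + bval' S v (u1 z) Left_End)"
    and W22: "\<And>z. W 2 2 z = - of_real c2 *
           (of_real \<kappa> * (bval' S v (u2 z) Right_End + bval' S v (u1 (-\<i>)) Left_End)
            + bval' S v (u2 z) Left_End - bval' S v (u2 (-\<i>)) Left_End)"
begin

lemma i_nonreal: "\<i> \<notin> \<real>" "- \<i> \<notin> \<real>"
  by (simp_all add: complex_is_Real_iff)

lemma cnj_u_i: "(\<lambda>x. cnj (u1 \<i> x)) = u1 (- \<i>)" "(\<lambda>x. cnj (u2 \<i> x)) = u2 (- \<i>)"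
  using u_cnj[OF i_nonreal(2)] by simp_all

lemma pairing_u_minus_i:
  assumes z: "z \<notin> \<real>"
  shows "(z + \<i>) * pairing S (u1 (- \<i>)) (u1 z) = - (bval' S v (u1 z) Right_End - bval' S v (u1 (-\<i>)) Right_End)"
    and "(z + \<i>) * pairing S (u1 (- \<i>)) (u2 z) = - (bval' S v (u2 z) Right_End + bval' S v (u1 (-\<i>)) Left_End)"
    and "(z + \<i>) * pairing S (u2 (- \<i>)) (u1 z) = bval' S v (u2 (-\<i>)) Right_End + bval' S v (u1 z) Left_End"
    and "(z + \<i>) * pairing S (u2 (- \<i>)) (u2 z) = bval' S v (u2 z) Left_End - bval' S v (u2 (-\<i>)) Left_End"
proof -
  note u = u_ker_max[OF z] and w = u_ker_max[OF i_nonreal(2)]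
  have *: "(z + \<i>) * X = - ((- \<i> - z) * X)" for X by (simp add: algebra_simps)
  show "(z + \<i>) * pairing S (u1 (- \<i>)) (u1 z) = - (bval' S v (u1 z) Right_End - bval' S v (u1 (-\<i>)) Right_End)"
    unfolding * green_ker_max_ker_max[OF w(1) u(1), symmetric] u w by simp
  show "(z + \<i>) * pairing S (u1 (- \<i>)) (u2 z) = - (bval' S v (u2 z) Right_End + bval' S v (u1 (-\<i>)) Left_End)"
    unfolding * green_ker_max_ker_max[OF w(1) u(2), symmetric] u w by simp
  show "(z + \<i>) * pairing S (u2 (- \<i>)) (u1 z) = bval' S v (u2 (-\<i>)) Right_End + bval' S v (u1 z) Left_End"
    unfolding * green_ker_max_ker_max[OF w(2) u(1), symmetric] u w by simp
  show "(z + \<i>) * pairing S (u2 (- \<i>)) (u2 z) = bval' S v (u2 z) Left_End - bval' S v (u2 (-\<i>)) Left_End"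
    unfolding * green_ker_max_ker_max[OF w(2) u(2), symmetric] u w by simp
qed

text \<open>These two values identify \<open>\<kappa>\<close> as the Gram-Schmidt coefficient \<open>(u\<^sub>1, u\<^sub>2) / \<parallel>u\<^sub>1\<parallel>\<^sup>2\<close> at \<open>z = i\<close>.\<close>

lemma norm_u1_square: "complex_of_real ((L2r_norm S (u1 \<i>))\<^sup>2) = - of_real (Im (bval' S v (u1 \<i>) Right_End))"
  and pairing_u1_u2: "pairing S (u1 (- \<i>)) (u2 \<i>) = - of_real (Im (bval' S v (u2 \<i>) Right_End))"
proof -
  note m = u_dom_max[OF i_nonreal(1)]
  have cd: "b - cnj b = 2 * \<i> * of_real (Im b)" for b by (simp add: complex_eq_iff)
  have b: "bval' S v (u1 (- \<i>)) Right_End = cnj (bval' S v (u1 \<i>) Right_End)"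
    "bval' S v (u1 (- \<i>)) Left_End = - cnj (bval' S v (u2 \<i>) Right_End)"
    using bval_linear(6)[OF S v m(1) m(1)] bval_linear(6)[OF S v m(2) m(2)] u_symmetry[OF i_nonreal(2)]
    unfolding cnj_u_i by simp_all
  have "2 * \<i> * pairing S (u1 (- \<i>)) (u1 \<i>) = 2 * \<i> * - of_real (Im (bval' S v (u1 \<i>) Right_End))"
    using pairing_u_minus_i(1)[OF i_nonreal(1)] cd[of "bval' S v (u1 \<i>) Right_End"] unfolding b by simp
  then have "pairing S (u1 (- \<i>)) (u1 \<i>) = - of_real (Im (bval' S v (u1 \<i>) Right_End))"
    by (rule mult_left_cancel[THEN iffD1, rotated]) simp
  then show "complex_of_real ((L2r_norm S (u1 \<i>))\<^sup>2) = - of_real (Im (bval' S v (u1 \<i>) Right_End))"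
    using pairing_cnj_self[OF S m(3)] unfolding cnj_u_i by simp
  have "2 * \<i> * pairing S (u1 (- \<i>)) (u2 \<i>) = 2 * \<i> * - of_real (Im (bval' S v (u2 \<i>) Right_End))"
    using pairing_u_minus_i(2)[OF i_nonreal(1)] cd[of "bval' S v (u2 \<i>) Right_End"] unfolding b by simp
  then show "pairing S (u1 (- \<i>)) (u2 \<i>) = - of_real (Im (bval' S v (u2 \<i>) Right_End))"
    by (rule mult_left_cancel[THEN iffD1, rotated]) simp
qed

lemma norm_u1_nonzero: "L2r_norm S (u1 \<i>) \<noteq> 0"
proof
  note u = u_ker_max[OF i_nonreal(1)] and m = u_dom_max[OF i_nonreal(1)]
  assume "L2r_norm S (u1 \<i>) = 0"
  then have "u1 \<i> = (\<lambda>x. 0)" by (rule dom_max_eq_zero[OF S m(1)])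
  then show False using u(4) u(6) bval_linear(3)[OF S v m(2) m(2), of 0] by simp
qed

text \<open>The component of \<open>u\<^sub>2(i, \<cdot>)\<close> orthogonal to \<open>u\<^sub>1(i, \<cdot>)\<close>, before normalization.\<close>

definition w2 :: "real \<Rightarrow> complex" where
  "w2 = (\<lambda>x. u2 \<i> x - of_real \<kappa> * u1 \<i> x)"

lemma w2_alt: "w2 = (\<lambda>x. u2 \<i> x + (- of_real \<kappa>) * u1 \<i> x)"
  by (simp add: w2_def)

lemma w2_ker_max: "w2 \<in> ker_max S \<i>"
  unfolding w2_alt by (intro ker_max_add_scale[OF S] u_ker_max i_nonreal)

lemma norm_w2_nonzero: "L2r_norm S w2 \<noteq> 0"
proof
  note u = u_ker_max[OF i_nonreal(1)] and m = u_dom_max[OF i_nonreal(1)]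
  assume "L2r_norm S w2 = 0"
  then have z: "w2 = (\<lambda>x. 0)" by (rule dom_max_eq_zero[OF S ker_max_dom_max[OF S w2_ker_max]])
  have "bval S v w2 Left_End = 1"
    unfolding w2_alt bval_linear(1)[OF S v m(2) dom_max_scale(1)[OF S m(1)]] bval_linear(3)[OF S v m(1) m(1)]
    by (simp add: u)
  then show False using u(3) bval_linear(3)[OF S v m(1) m(1), of 0] by (simp add: z)
qed

lemma pairing_u1_w2: "pairing S (u1 (- \<i>)) w2 = 0"
proof -
  note m = u_dom_max[OF i_nonreal(1)] and m' = u_dom_max[OF i_nonreal(2)]
  have "pairing S (u1 (- \<i>)) w2 = pairing S (u1 (- \<i>)) (u2 \<i>) - of_real \<kappa> * pairing S (u1 (- \<i>)) (u1 \<i>)"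
    unfolding w2_alt pairing_add_right[OF S m'(3) m(4) L2r_scale[OF S m(3)]] pairing_scale_right[OF S] by simp
  also have "pairing S (u1 (- \<i>)) (u1 \<i>) = - of_real (Im (bval' S v (u1 \<i>) Right_End))"
    using pairing_cnj_self[OF S m(3)] norm_u1_square unfolding cnj_u_i by simp
  also have "pairing S (u1 (- \<i>)) (u2 \<i>) - of_real \<kappa> * - of_real (Im (bval' S v (u1 \<i>) Right_End)) = 0"
  proof -
    have "Im (bval' S v (u1 \<i>) Right_End) \<noteq> 0" using norm_u1_square norm_u1_nonzero by auto
    then show ?thesis unfolding pairing_u1_u2 kappa by simp
  qed
  finally show ?thesis .
qed

lemma e_alt: "e 1 = (\<lambda>x. of_real c1 * u1 \<i> x)" "e 2 = (\<lambda>x. of_real c2 * w2 x)"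
  by (simp_all only: e1 e2 w2_def)

lemma c_nonzero: "c1 \<noteq> 0" "c2 \<noteq> 0"
  using norm_u1_nonzero norm_w2_nonzero unfolding c1 c2 w2_def by simp_all

lemma cnj_e: "(\<lambda>x. cnj (e 1 x)) = (\<lambda>x. of_real c1 * u1 (- \<i>) x)"
  "(\<lambda>x. cnj (e 2 x)) = (\<lambda>x. of_real c2 * cnj (w2 x))"
  unfolding e_alt cnj_u_i[symmetric] by simp_all

lemma cnj_w2: "(\<lambda>x. cnj (w2 x)) = (\<lambda>x. u2 (- \<i>) x + (- of_real \<kappa>) * u1 (- \<i>) x)"
  unfolding w2_def cnj_u_i[symmetric] by simp

lemma pairing_scale_left: "pairing S (\<lambda>x. c * f x) g = c * pairing S f g"
  using pairing_scale_right[OF S, of g c f] by (simp only: pairing_commute[OF S, of _ g])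

lemma orthonormal_basis:
  shows "e 1 \<in> ker_max S \<i>" "e 2 \<in> ker_max S \<i>"
    and "pairing S (\<lambda>x. cnj (e 1 x)) (e 1) = 1" "pairing S (\<lambda>x. cnj (e 2 x)) (e 2) = 1"
    and "pairing S (\<lambda>x. cnj (e 1 x)) (e 2) = 0" "pairing S (\<lambda>x. cnj (e 2 x)) (e 1) = 0"
    and "\<forall>g\<in>ker_max S \<i>. \<exists>a b. g = (\<lambda>x. a * e 1 x + b * e 2 x)"
proof -
  note u = u_ker_max[OF i_nonreal(1)] and m = u_dom_max[OF i_nonreal(1)]
  show k: "e 1 \<in> ker_max S \<i>" "e 2 \<in> ker_max S \<i>"
    unfolding e_alt by (intro ker_max_add_scale[OF S] u w2_ker_max)+
  have n1: "L2r_norm S (e 1) = 1"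
    unfolding e_alt L2r_norm_scale[OF S] using norm_u1_nonzero L2r_norm_nonneg[OF S, of "u1 \<i>"]
    by (simp add: c1 norm_inverse)
  have n2: "L2r_norm S (e 2) = 1"
    unfolding e_alt L2r_norm_scale[OF S] using norm_w2_nonzero L2r_norm_nonneg[OF S, of w2]
    by (simp add: c2 norm_inverse flip: w2_def)
  show "pairing S (\<lambda>x. cnj (e 1 x)) (e 1) = 1" "pairing S (\<lambda>x. cnj (e 2 x)) (e 2) = 1"
    using pairing_cnj_self[OF S ker_max_L2r[OF S k(1)]] pairing_cnj_self[OF S ker_max_L2r[OF S k(2)]]
    unfolding n1 n2 by simp_all
  show o: "pairing S (\<lambda>x. cnj (e 1 x)) (e 2) = 0"
    unfolding cnj_e pairing_scale_left unfolding e_alt pairing_scale_right[OF S] pairing_u1_w2 by simp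
  have "pairing S (\<lambda>x. cnj (e 2 x)) (e 1) = pairing S (e 1) (\<lambda>x. cnj (e 2 x))" by (rule pairing_commute[OF S])
  also have "\<dots> = cnj (pairing S (\<lambda>x. cnj (e 1 x)) (e 2))"
    using pairing_cnj[OF S, of "\<lambda>x. cnj (e 1 x)" "e 2"] by (simp only: complex_cnj_cnj)
  finally show "pairing S (\<lambda>x. cnj (e 2 x)) (e 1) = 0" unfolding o by simp
  show "\<forall>g\<in>ker_max S \<i>. \<exists>a b. g = (\<lambda>x. a * e 1 x + b * e 2 x)"
  proof
    fix g assume "g \<in> ker_max S \<i>"
    then obtain a b where g: "g = (\<lambda>x. a * u1 \<i> x + b * u2 \<i> x)"
      using ker_max_expand[OF i_nonreal(1)] by blast
    have "g = (\<lambda>x. ((a + b * of_real \<kappa>) / of_real c1) * e 1 x + (b / of_real c2) * e 2 x)"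
    proof -
      have cancel: "x / of_real c1 * (of_real c1 * y) = x * y" "x / of_real c2 * (of_real c2 * y) = x * y" for x y :: complex
        using c_nonzero by simp_all
      show ?thesis unfolding g e_alt w2_def cancel by (simp add: algebra_simps)
    qed
    then show "\<exists>a b. g = (\<lambda>x. a * e 1 x + b * e 2 x)" by blast
  qed
qed

text \<open>The functions \<open>W\<close> are, up to the factor \<open>-(z - i)\<close>, the coordinates of the projections of
  \<open>u\<^sub>1(z, \<cdot>)\<close> and \<open>u\<^sub>2(z, \<cdot>)\<close> onto \<open>\<N>\<^sub>i\<close>, multiplied by \<open>z\<^sup>2 + 1\<close>.\<close>

lemma basis_coefficients:
  assumes z: "z \<notin> \<real>"
  shows "(z\<^sup>2 + 1) * pairing S (\<lambda>x. cnj (e 1 x)) (u1 z) = - (z - \<i>) * W 1 1 z"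
    and "(z\<^sup>2 + 1) * pairing S (\<lambda>x. cnj (e 2 x)) (u1 z) = - (z - \<i>) * W 2 1 z"
    and "(z\<^sup>2 + 1) * pairing S (\<lambda>x. cnj (e 1 x)) (u2 z) = - (z - \<i>) * W 1 2 z"
    and "(z\<^sup>2 + 1) * pairing S (\<lambda>x. cnj (e 2 x)) (u2 z) = - (z - \<i>) * W 2 2 z"
proof -
  note m = u_dom_max[OF z] and m' = u_dom_max[OF i_nonreal(2)]
  have zz: "z\<^sup>2 + 1 = (z - \<i>) * (z + \<i>)" by (simp add: algebra_simps power2_eq_square)
  have 1: "(z\<^sup>2 + 1) * pairing S (\<lambda>x. cnj (e 1 x)) f = (z - \<i>) * (of_real c1 * ((z + \<i>) * pairing S (u1 (- \<i>)) f))" for f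
    unfolding cnj_e pairing_scale_left zz by (simp only: mult_ac)
  have 2: "(z\<^sup>2 + 1) * pairing S (\<lambda>x. cnj (e 2 x)) f =
      (z - \<i>) * (of_real c2 * ((z + \<i>) * pairing S (u2 (- \<i>)) f - of_real \<kappa> * ((z + \<i>) * pairing S (u1 (- \<i>)) f)))"
    if f: "f \<in> L2r S" for f
  proof -
    have w: "pairing S (\<lambda>x. cnj (w2 x)) f = pairing S (u2 (- \<i>)) f + (- of_real \<kappa>) * pairing S (u1 (- \<i>)) f"
      unfolding cnj_w2 pairing_commute[OF S, of _ f] pairing_add_right[OF S f m'(4) L2r_scale[OF S m'(3)]] pairing_scale_right[OF S] ..
    show ?thesis unfolding cnj_e pairing_scale_left zz w by (simp add: algebra_simps)
  qed
  note pairing = pairing_u_minus_i[OF z]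
  show "(z\<^sup>2 + 1) * pairing S (\<lambda>x. cnj (e 1 x)) (u1 z) = - (z - \<i>) * W 1 1 z"
    unfolding 1 W11 pairing by (simp only: mult_minus_left mult_minus_right)
  show "(z\<^sup>2 + 1) * pairing S (\<lambda>x. cnj (e 1 x)) (u2 z) = - (z - \<i>) * W 1 2 z"
    unfolding 1 W12 pairing by (simp only: mult_minus_left mult_minus_right)
  show "(z\<^sup>2 + 1) * pairing S (\<lambda>x. cnj (e 2 x)) (u1 z) = - (z - \<i>) * W 2 1 z"
    unfolding 2[OF m(3)] W21 pairing by (simp add: algebra_simps)
  show "(z\<^sup>2 + 1) * pairing S (\<lambda>x. cnj (e 2 x)) (u2 z) = - (z - \<i>) * W 2 2 z"
    unfolding 2[OF m(4)] W22 pairing by (simp add: algebra_simps)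
qed

section \<open>The Donoghue m-functions\<close>

lemmas donoghue_basis_difference = donoghue_resolvent_difference[OF S LC orthonormal_basis]
lemmas donoghue_basis_at_i = donoghue_at_i[OF S LC orthonormal_basis]
lemmas donoghue_basis_bounded = bounded_op_on_donoghue[OF S LC orthonormal_basis]

lemma donoghue_sep_left:
  assumes \<alpha>: "0 < \<alpha>" "\<alpha> < pi" and z: "z \<notin> \<real>" and f: "f \<in> ker_max S \<i>"
  shows "donoghue S (dom_sep S v \<alpha> 0) z f = (\<lambda>x. donoghue S (dom_sep S v 0 0) z f x
     + (z - \<i>) / (of_real (cot \<alpha>) + bval' S v (u2 z) Left_End) * L2r_inner S (u2 (cnj z)) f
       * (\<Sum>l\<in>{1,2}. W l 2 z * e l x))"
proof -
  have fL: "f \<in> L2r S" by (rule ker_max_L2r[OF S f])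
  have R0: "resolvent S (dom_sep S v 0 0) z f \<in> L2r S"
    by (rule dom_max_sl_sys(2)[OF S resolvent_reference(1)[OF z fL]])
  show ?thesis
    unfolding donoghue_basis_difference[OF f u_dom_max(4)[OF z] R0 resolvent_sep_left[OF \<alpha> z fL]]
      basis_coefficients[OF z]
    by (simp add: algebra_simps add_divide_distrib diff_divide_distrib)
qed

lemma donoghue_sep_right:
  assumes \<beta>: "0 < \<beta>" "\<beta> < pi" and z: "z \<notin> \<real>" and f: "f \<in> ker_max S \<i>"
  shows "donoghue S (dom_sep S v 0 \<beta>) z f = (\<lambda>x. donoghue S (dom_sep S v 0 0) z f x
     - (z - \<i>) / (of_real (cot \<beta>) + bval' S v (u1 z) Right_End) * L2r_inner S (u1 (cnj z)) f
       * (\<Sum>l\<in>{1,2}. W l 1 z * e l x))"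
proof -
  have fL: "f \<in> L2r S" by (rule ker_max_L2r[OF S f])
  have R0: "resolvent S (dom_sep S v 0 0) z f \<in> L2r S"
    by (rule dom_max_sl_sys(2)[OF S resolvent_reference(1)[OF z fL]])
  show ?thesis
    unfolding donoghue_basis_difference[OF f u_dom_max(3)[OF z] R0 resolvent_sep_right[OF \<beta> z fL]]
      basis_coefficients[OF z]
    by (simp add: algebra_simps add_divide_distrib diff_divide_distrib)
qed

lemma donoghue_coupled:
  fixes R :: "real^2^2"
  assumes R: "det R = 1" "R$1$2 = 0" and z: "z \<notin> \<real>" and f: "f \<in> ker_max S \<i>"
    and U: "\<And>\<zeta>. U \<zeta> = (\<lambda>x. cis (-\<phi>) * of_real (R$2$2) * u2 \<zeta> x + u1 \<zeta> x)"
    and K: "K = - of_real (R$2$1 * R$2$2) - cis \<phi> * of_real (R$2$2) * bval' S v (U z) Left_End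
           + bval' S v (U z) Right_End"
  shows "donoghue S (dom_coupled S v \<phi> R) z f = (\<lambda>x. donoghue S (dom_sep S v 0 0) z f x
     - (z - \<i>) / K * L2r_inner S (U (cnj z)) f
       * (\<Sum>l\<in>{1,2}. (cis (-\<phi>) * of_real (R$2$2) * W l 2 z + W l 1 z) * e l x))"
proof -
  have fL: "f \<in> L2r S" by (rule ker_max_L2r[OF S f])
  have R0: "resolvent S (dom_sep S v 0 0) z f \<in> L2r S"
    by (rule dom_max_sl_sys(2)[OF S resolvent_reference(1)[OF z fL]])
  note r = resolvent_coupled[OF R z fL U K]
  note m = u_dom_max[OF z]
  have ipU: "(z\<^sup>2 + 1) * pairing S g (U z) =
      cis (-\<phi>) * of_real (R$2$2) * ((z\<^sup>2 + 1) * pairing S g (u2 z)) + (z\<^sup>2 + 1) * pairing S g (u1 z)" if "g \<in> L2r S" for g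
    unfolding U pairing_add_right[OF S that L2r_scale[OF S m(4)] m(3)] pairing_scale_right[OF S]
    by (simp add: algebra_simps)
  have eL: "(\<lambda>x. cnj (e 1 x)) \<in> L2r S" "(\<lambda>x. cnj (e 2 x)) \<in> L2r S"
    using L2r_cnj[OF S ker_max_L2r[OF S orthonormal_basis(1)]] L2r_cnj[OF S ker_max_L2r[OF S orthonormal_basis(2)]] .
  show ?thesis
    unfolding donoghue_basis_difference[OF f ker_max_L2r[OF S r(1)] R0 r(2)] ipU[OF eL(1)] ipU[OF eL(2)]
      basis_coefficients[OF z]
    by (simp add: algebra_simps add_divide_distrib diff_divide_distrib)
qed

end

theorem theorem6p3:
  fixes S :: sl_data
    and v :: "(real \<Rightarrow> complex) \<times> (real \<Rightarrow> complex)"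
    and u1 u2 :: "complex \<Rightarrow> real \<Rightarrow> complex"
    and u_cpl :: "real \<Rightarrow> real^2^2 \<Rightarrow> complex \<Rightarrow> real \<Rightarrow> complex"
    and k_cpl :: "real \<Rightarrow> real^2^2 \<Rightarrow> complex \<Rightarrow> complex"
    and c1 c2 \<kappa> :: real
    and e :: "nat \<Rightarrow> real \<Rightarrow> complex"
    and W :: "nat \<Rightarrow> nat \<Rightarrow> complex \<Rightarrow> complex"
  assumes "sturm_liouville S"
    and "limit_circle S Left_End" and "limit_circle S Right_End"
    and "boundary_reference S v"
    and "\<And>z. z \<in> resolvent_set S (dom_sep S v 0 0) \<Longrightarrow>
           sl_solution S z (u1 z) \<and> bval S v (u1 z) Left_End = 0 \<and> bval S v (u1 z) Right_End = 1"
    and "\<And>z. z \<in> resolvent_set S (dom_sep S v 0 0) \<Longrightarrow>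
           sl_solution S z (u2 z) \<and> bval S v (u2 z) Left_End = 1 \<and> bval S v (u2 z) Right_End = 0"
    and "\<kappa> = Im (bval' S v (u2 \<i>) Right_End) / Im (bval' S v (u1 \<i>) Right_End)"
    and "c1 = inverse (L2r_norm S (u1 \<i>))"
    and "c2 = inverse (L2r_norm S (\<lambda>x. u2 \<i> x - of_real \<kappa> * u1 \<i> x))"
    and "e 1 = (\<lambda>x. of_real c1 * u1 \<i> x)"
    and "e 2 = (\<lambda>x. of_real c2 * (u2 \<i> x - of_real \<kappa> * u1 \<i> x))"
    and "\<And>z. W 1 1 z = of_real c1 *
           (bval' S v (u1 z) Right_End - bval' S v (u1 (-\<i>)) Right_End)"
    and "\<And>z. W 1 2 z = of_real c1 *
           (bval' S v (u2 z) Right_End + bval' S v (u1 (-\<i>)) Left_End)"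
    and "\<And>z. W 2 1 z = - of_real c2 *
           (of_real \<kappa> * (bval' S v (u1 z) Right_End - bval' S v (u1 (-\<i>)) Right_End)
            + bval' S v (u2 (-\<i>)) Right_End + bval' S v (u1 z) Left_End)"
    and "\<And>z. W 2 2 z = - of_real c2 *
           (of_real \<kappa> * (bval' S v (u2 z) Right_End + bval' S v (u1 (-\<i>)) Left_End)
            + bval' S v (u2 z) Left_End - bval' S v (u2 (-\<i>)) Left_End)"
    and "\<And>\<phi> R \<zeta>. u_cpl \<phi> R \<zeta> = (\<lambda>x. cis (-\<phi>) * of_real (R$2$2) * u2 \<zeta> x + u1 \<zeta> x)"
    and "\<And>\<phi> R z. k_cpl \<phi> R z =
           - of_real (R$2$1 * R$2$2)
           - cis \<phi> * of_real (R$2$2) * bval' S v (u_cpl \<phi> R z) Left_End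
           + bval' S v (u_cpl \<phi> R z) Right_End"
  shows
    "(\<forall>\<alpha>. 0 < \<alpha> \<and> \<alpha> < pi \<longrightarrow>
        (\<forall>z. z \<notin> \<real> \<longrightarrow> bounded_op_on S (ker_max S \<i>) (donoghue S (dom_sep S v \<alpha> 0) z)) \<and>
        (\<forall>f \<in> ker_max S \<i>.
           donoghue S (dom_sep S v \<alpha> 0) \<i> f = (\<lambda>x. \<i> * f x) \<and>
           donoghue S (dom_sep S v \<alpha> 0) (-\<i>) f = (\<lambda>x. -\<i> * f x)) \<and>
        (\<forall>z. z \<notin> \<real> \<and> z \<noteq> \<i> \<and> z \<noteq> -\<i> \<longrightarrow>
          (\<forall>f \<in> ker_max S \<i>.
             donoghue S (dom_sep S v \<alpha> 0) z f = (\<lambda>x.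
               donoghue S (dom_sep S v 0 0) z f x
               + (z - \<i>) / (of_real (cot \<alpha>) + bval' S v (u2 z) Left_End)
                 * L2r_inner S (u2 (cnj z)) f
                 * (\<Sum>l\<in>{1,2}. W l 2 z * e l x)))))
     \<and>
     (\<forall>\<beta>. 0 < \<beta> \<and> \<beta> < pi \<longrightarrow>
        (\<forall>z. z \<notin> \<real> \<longrightarrow> bounded_op_on S (ker_max S \<i>) (donoghue S (dom_sep S v 0 \<beta>) z)) \<and>
        (\<forall>f \<in> ker_max S \<i>.
           donoghue S (dom_sep S v 0 \<beta>) \<i> f = (\<lambda>x. \<i> * f x) \<and>
           donoghue S (dom_sep S v 0 \<beta>) (-\<i>) f = (\<lambda>x. -\<i> * f x)) \<and>
        (\<forall>z. z \<notin> \<real> \<and> z \<noteq> \<i> \<and> z \<noteq> -\<i> \<longrightarrow>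
          (\<forall>f \<in> ker_max S \<i>.
             donoghue S (dom_sep S v 0 \<beta>) z f = (\<lambda>x.
               donoghue S (dom_sep S v 0 0) z f x
               - (z - \<i>) / (of_real (cot \<beta>) + bval' S v (u1 z) Right_End)
                 * L2r_inner S (u1 (cnj z)) f
                 * (\<Sum>l\<in>{1,2}. W l 1 z * e l x)))))
     \<and>
     (\<forall>\<phi> R. 0 \<le> \<phi> \<and> \<phi> < 2 * pi \<and> det R = 1 \<and> R$1$2 = 0 \<longrightarrow>
        (\<forall>z. z \<notin> \<real> \<longrightarrow> bounded_op_on S (ker_max S \<i>) (donoghue S (dom_coupled S v \<phi> R) z)) \<and>
        (\<forall>f \<in> ker_max S \<i>.
           donoghue S (dom_coupled S v \<phi> R) \<i> f = (\<lambda>x. \<i> * f x) \<and>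
           donoghue S (dom_coupled S v \<phi> R) (-\<i>) f = (\<lambda>x. -\<i> * f x)) \<and>
        (\<forall>z. z \<notin> \<real> \<and> z \<noteq> \<i> \<and> z \<noteq> -\<i> \<longrightarrow>
          (\<forall>f \<in> ker_max S \<i>.
             donoghue S (dom_coupled S v \<phi> R) z f = (\<lambda>x.
               donoghue S (dom_sep S v 0 0) z f x
               - (z - \<i>) / k_cpl \<phi> R z
                 * L2r_inner S (u_cpl \<phi> R (cnj z)) f
                 * (\<Sum>l\<in>{1,2}. (cis (-\<phi>) * of_real (R$2$2) * W l 2 z + W l 1 z) * e l x)))))"
proof -
  interpret donoghue_basis S v u1 u2 c1 c2 \<kappa> e W
    by unfold_locales (fact assms)+
  show ?thesis
  proof (intro conjI allI impI ballI)
    fix \<alpha> z f assume "0 < \<alpha> \<and> \<alpha> < pi"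
    then have \<alpha>: "0 < \<alpha>" "\<alpha> < pi" by auto
    show "bounded_op_on S (ker_max S \<i>) (donoghue S (dom_sep S v \<alpha> 0) z)" if "z \<notin> \<real>"
      unfolding dom_sep_bc_domain[OF S v] by (rule donoghue_basis_bounded[OF symmetric_bc_sep[OF S v] that])
    assume f: "f \<in> ker_max S \<i>"
    show "donoghue S (dom_sep S v \<alpha> 0) \<i> f = (\<lambda>x. \<i> * f x)"
      "donoghue S (dom_sep S v \<alpha> 0) (-\<i>) f = (\<lambda>x. -\<i> * f x)"
      by (rule donoghue_basis_at_i[OF f])+
    assume "z \<notin> \<real> \<and> z \<noteq> \<i> \<and> z \<noteq> -\<i>"
    then show "donoghue S (dom_sep S v \<alpha> 0) z f = (\<lambda>x. donoghue S (dom_sep S v 0 0) z f x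
      + (z - \<i>) / (of_real (cot \<alpha>) + bval' S v (u2 z) Left_End) * L2r_inner S (u2 (cnj z)) f
        * (\<Sum>l\<in>{1,2}. W l 2 z * e l x))"
      using donoghue_sep_left[OF \<alpha> _ f] by blast
  next
    fix \<beta> z f assume "0 < \<beta> \<and> \<beta> < pi"
    then have \<beta>: "0 < \<beta>" "\<beta> < pi" by auto
    show "bounded_op_on S (ker_max S \<i>) (donoghue S (dom_sep S v 0 \<beta>) z)" if "z \<notin> \<real>"
      unfolding dom_sep_bc_domain[OF S v] by (rule donoghue_basis_bounded[OF symmetric_bc_sep[OF S v] that])
    assume f: "f \<in> ker_max S \<i>"
    show "donoghue S (dom_sep S v 0 \<beta>) \<i> f = (\<lambda>x. \<i> * f x)"
      "donoghue S (dom_sep S v 0 \<beta>) (-\<i>) f = (\<lambda>x. -\<i> * f x)"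
      by (rule donoghue_basis_at_i[OF f])+
    assume "z \<notin> \<real> \<and> z \<noteq> \<i> \<and> z \<noteq> -\<i>"
    then show "donoghue S (dom_sep S v 0 \<beta>) z f = (\<lambda>x. donoghue S (dom_sep S v 0 0) z f x
      - (z - \<i>) / (of_real (cot \<beta>) + bval' S v (u1 z) Right_End) * L2r_inner S (u1 (cnj z)) f
        * (\<Sum>l\<in>{1,2}. W l 1 z * e l x))"
      using donoghue_sep_right[OF \<beta> _ f] by blast
  next
    fix \<phi> and R :: "real^2^2" and z f
    assume "0 \<le> \<phi> \<and> \<phi> < 2 * pi \<and> det R = 1 \<and> R$1$2 = 0"
    then have R: "det R = 1" "R$1$2 = 0" by auto
    show "bounded_op_on S (ker_max S \<i>) (donoghue S (dom_coupled S v \<phi> R) z)" if "z \<notin> \<real>"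
      unfolding dom_coupled_bc_domain[OF S v]
      by (rule donoghue_basis_bounded[OF symmetric_bc_coupled[OF S v R(1)] that])
    assume f: "f \<in> ker_max S \<i>"
    show "donoghue S (dom_coupled S v \<phi> R) \<i> f = (\<lambda>x. \<i> * f x)"
      "donoghue S (dom_coupled S v \<phi> R) (-\<i>) f = (\<lambda>x. -\<i> * f x)"
      by (rule donoghue_basis_at_i[OF f])+
    assume "z \<notin> \<real> \<and> z \<noteq> \<i> \<and> z \<noteq> -\<i>"
    then have z: "z \<notin> \<real>" by simp
    show "donoghue S (dom_coupled S v \<phi> R) z f = (\<lambda>x. donoghue S (dom_sep S v 0 0) z f x
      - (z - \<i>) / k_cpl \<phi> R z * L2r_inner S (u_cpl \<phi> R (cnj z)) f
        * (\<Sum>l\<in>{1,2}. (cis (-\<phi>) * of_real (R$2$2) * W l 2 z + W l 1 z) * e l x))"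
      by (rule donoghue_coupled[where U = "u_cpl \<phi> R" and K = "k_cpl \<phi> R z", OF R z f])
        (rule assms)+
  qed
qed

end
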